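(* Let $(E,(\cdot,\cdot),\mathcal H)$ be an extended affine Lie algebra of nullity $1$ with root system $R$. Let $\mathcal H_R\subseteq\mathcal H$ and $\hat E=\mathcal H_R+E_c$ be as defined in the context. Then $(\hat E,(\cdot,\cdot)|_{\hat E},\mathcal H_R)$ is an affine Lie algebra.
   Context: All Lie algebras are over $\mathbb C$. An extended affine Lie algebra (EALA) is a triple $(E,(\cdot,\cdot),\mathcal H)$ where $E$ is a Lie algebra, $\mathcal H$ a subalgebra and $(\cdot,\cdot)$ a bilinear form on $E$ such that: (EA1) the form is symmetric, non-degenerate and invariant; (EA2) $\mathcal H$ is finite-dimensional and $E=\bigoplus_{\alpha\in\mathcal H^*}E_\alpha$ with $E_\alpha=\{x\in E:[h,x]=\alpha(h)x\ \forall h\in\mathcal H\}$ and $E_0=\mathcal H$. The root system is $R=\{\alpha\in\mathcal H^*:E_\alpha\neq0\}$. The form is non-degenerate on $\mathcal H$; for $\alpha\in\mathcal H^*$ let $t_\alpha\in\mathcal H$ be given by $\alpha(h)=(h,t_\alpha)$, and put $(\alpha,\beta):=(t_\alpha,t_\beta)$; $R^\times=\{\alpha\in R:(\alpha,\alpha)\ne0\}$, $R^0=R\setminus R^\times$. (EA3) $\mathrm{ad}\,x$ is locally nilpotent for $x\in E_\alpha$, $\alpha\in R^\times$; (EA4) $R$ is discrete in $\mathcal H^*$; (EA5) $R^\times$ is connected (it is not a union of two nonempty mutually orthogonal subsets) and each $\sigma\in R^0$ is non-isolated (there is $\alpha\in R^\times$ with $\alpha+\sigma\in R$). Let $\mathcal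 V=\mathrm{span}_{\mathbb R}R$, $\mathcal V^0=\mathrm{span}_{\mathbb R}R^0$; the image $\bar R$ of $R$ in $\mathcal V/\mathcal V^0$ is an irreducible finite root system whose type and rank are called the type and rank of $E$; the nullity of $E$ is $\dim\mathcal V^0$. Throughout, $\bar R$ is assumed reduced. The core $E_c$ is the subalgebra generated by all $E_\alpha$, $\alpha\in R^\times$. $E$ is tame if $E_c^\perp\subseteq Z(E_c)$ (orthogonal complement in $E$, center of $E_c$). Canonical Cartan piece: fix a finite root system $\dot R\subseteq R$ (with $0\in\dot R$) such that $R\subseteq\dot R+\mathcal V^0$ and the projection $\mathcal V\to\mathcal V/\mathcal V^0$ maps $\dot R$ bijectively onto $\bar R$. Put $\dot{\mathcal H}=\sum_{\dot\alpha\in\dot R}\mathbb C t_{\dot\alpha}$, $\mathcal H_c=\sum_{\alpha\in R^\times}\mathbb Ct_\alpha$, $\mathcal H^0=\sum_{\sigma\in R^0}\mathbb Ct_\sigma$ (so $\mathcal H_c=\dot{\mathcal H}\oplus\mathcal H^0$). Choose a subspace $\hat{\mathcal H}^0$ of the orthogonal complement of $\dot{\mathcal H}$ in $\mathcal H$ with $\dim\hat{\mathcal H}^0=\dim\mathcal H^0$, $(\hat{\mathcal H}^0,\hat{\mathcal H}^0)=0$, and the form non-degenerate on $\mathcal H^0\oplus\hat{\mathcal H}^0$. Set $\mathcal H_R=\mathcal H_c\oplus\hat{\mathcal H}^0$ and $\hat E=\mathcal H_R+E_c$. An affine Lie algebra means an affine Kac–Moody Lie algebra (with its standard invariant form and Cartan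 subalgebra); equivalently, a tame EALA of nullity $1$. *)

theory Defs
  imports Complex_Main "HOL-Library.Function_Algebras"
begin

definition lie_algebra :: "(complex \<Rightarrow> 'a::ab_group_add \<Rightarrow> 'a) \<Rightarrow> 'a set \<Rightarrow> ('a \<Rightarrow> 'a \<Rightarrow> 'a) \<Rightarrow> bool" where
  "lie_algebra sc E br \<longleftrightarrow>
     vector_space sc \<and> module.subspace sc E \<and>
     (\<forall>x\<in>E. \<forall>y\<in>E. br x y \<in> E) \<and>
     (\<forall>x\<in>E. \<forall>y\<in>E. \<forall>z\<in>E. br (x + y) z = br x z + br y z \<and> br z (x + y) = br z x + br z y) \<and>
     (\<forall>c. \<forall>x\<in>E. \<forall>y\<in>E. br (sc c x) y = sc c (br x y) \<and> br x (sc c y) = sc c (br x y)) \<and>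
     (\<forall>x\<in>E. br x x = 0) \<and>
     (\<forall>x\<in>E. \<forall>y\<in>E. \<forall>z\<in>E. br x (br y z) + br y (br z x) + br z (br x y) = 0)"

definition lie_subalgebra :: "(complex \<Rightarrow> 'a::ab_group_add \<Rightarrow> 'a) \<Rightarrow> 'a set \<Rightarrow> ('a \<Rightarrow> 'a \<Rightarrow> 'a) \<Rightarrow> 'a set \<Rightarrow> bool" where
  "lie_subalgebra sc E br S \<longleftrightarrow> module.subspace sc S \<and> S \<subseteq> E \<and> (\<forall>x\<in>S. \<forall>y\<in>S. br x y \<in> S)"

definition lie_ideal :: "(complex \<Rightarrow> 'a::ab_group_add \<Rightarrow> 'a) \<Rightarrow> 'a set \<Rightarrow> ('a \<Rightarrow> 'a \<Rightarrow> 'a) \<Rightarrow> 'a set \<Rightarrow> bool" where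
  "lie_ideal sc E br I \<longleftrightarrow> module.subspace sc I \<and> I \<subseteq> E \<and> (\<forall>x\<in>E. \<forall>y\<in>I. br x y \<in> I)"

definition gen_subalgebra :: "(complex \<Rightarrow> 'a::ab_group_add \<Rightarrow> 'a) \<Rightarrow> 'a set \<Rightarrow> ('a \<Rightarrow> 'a \<Rightarrow> 'a) \<Rightarrow> 'a set \<Rightarrow> 'a set" where
  "gen_subalgebra sc E br X = \<Inter> {S. lie_subalgebra sc E br S \<and> X \<subseteq> S}"

definition set_sum :: "'a::plus set \<Rightarrow> 'a set \<Rightarrow> 'a set" where
  "set_sum A C = {x + y | x y. x \<in> A \<and> y \<in> C}"

definition fin_dim :: "(complex \<Rightarrow> 'a::ab_group_add \<Rightarrow> 'a) \<Rightarrow> 'a set \<Rightarrow> bool" where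
  "fin_dim sc V \<longleftrightarrow> (\<exists>S. finite S \<and> S \<subseteq> V \<and> module.span sc S = V)"

definition good_form :: "(complex \<Rightarrow> 'a::ab_group_add \<Rightarrow> 'a) \<Rightarrow> 'a set \<Rightarrow> ('a \<Rightarrow> 'a \<Rightarrow> 'a) \<Rightarrow> ('a \<Rightarrow> 'a \<Rightarrow> complex) \<Rightarrow> bool" where
  "good_form sc E br B \<longleftrightarrow>
     (\<forall>x\<in>E. \<forall>y\<in>E. B x y = B y x) \<and>
     (\<forall>x\<in>E. \<forall>y\<in>E. \<forall>z\<in>E. B (x + y) z = B x z + B y z) \<and>
     (\<forall>c. \<forall>x\<in>E. \<forall>y\<in>E. B (sc c x) y = c * B x y) \<and>
     (\<forall>x\<in>E. (\<forall>y\<in>E. B x y = 0) \<longrightarrow> x = 0) \<and>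
     (\<forall>x\<in>E. \<forall>y\<in>E. \<forall>z\<in>E. B (br x y) z = B x (br y z))"

text \<open>Elements of H^* are represented by functions 'a => complex that are linear on H and
  vanish outside H (so that each functional has a unique representative).\<close>
definition dual_space :: "(complex \<Rightarrow> 'a::ab_group_add \<Rightarrow> 'a) \<Rightarrow> 'a set \<Rightarrow> ('a \<Rightarrow> complex) set" where
  "dual_space sc H = {\<alpha>. (\<forall>x. x \<notin> H \<longrightarrow> \<alpha> x = 0) \<and>
      (\<forall>x\<in>H. \<forall>y\<in>H. \<alpha> (x + y) = \<alpha> x + \<alpha> y) \<and> (\<forall>c. \<forall>x\<in>H. \<alpha> (sc c x) = c * \<alpha> x)}"

definition root_space :: "(complex \<Rightarrow> 'a::ab_group_add \<Rightarrow> 'a) \<Rightarrow> 'a set \<Rightarrow> ('a \<Rightarrow> 'a \<Rightarrow> 'a) \<Rightarrow> 'a set \<Rightarrow> ('a \<Rightarrow> complex) \<Rightarrow> 'a set" where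
  "root_space sc E br H \<alpha> = {x\<in>E. \<forall>h\<in>H. br h x = sc (\<alpha> h) x}"

definition roots :: "(complex \<Rightarrow> 'a::ab_group_add \<Rightarrow> 'a) \<Rightarrow> 'a set \<Rightarrow> ('a \<Rightarrow> 'a \<Rightarrow> 'a) \<Rightarrow> 'a set \<Rightarrow> ('a \<Rightarrow> complex) set" where
  "roots sc E br H = {\<alpha> \<in> dual_space sc H. root_space sc E br H \<alpha> \<noteq> {0}}"

definition tvec :: "('a \<Rightarrow> 'a \<Rightarrow> complex) \<Rightarrow> 'a set \<Rightarrow> ('a \<Rightarrow> complex) \<Rightarrow> 'a" where
  "tvec B H \<alpha> = (THE t. t \<in> H \<and> (\<forall>h\<in>H. \<alpha> h = B h t))"

definition dform :: "('a \<Rightarrow> 'a \<Rightarrow> complex) \<Rightarrow> 'a set \<Rightarrow> ('a \<Rightarrow> complex) \<Rightarrow> ('a \<Rightarrow> complex) \<Rightarrow> complex" where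
  "dform B H \<alpha> \<beta> = B (tvec B H \<alpha>) (tvec B H \<beta>)"

definition roots_x :: "(complex \<Rightarrow> 'a::ab_group_add \<Rightarrow> 'a) \<Rightarrow> 'a set \<Rightarrow> ('a \<Rightarrow> 'a \<Rightarrow> 'a) \<Rightarrow> ('a \<Rightarrow> 'a \<Rightarrow> complex) \<Rightarrow> 'a set \<Rightarrow> ('a \<Rightarrow> complex) set" where
  "roots_x sc E br B H = {\<alpha> \<in> roots sc E br H. dform B H \<alpha> \<alpha> \<noteq> 0}"

definition roots_0 :: "(complex \<Rightarrow> 'a::ab_group_add \<Rightarrow> 'a) \<Rightarrow> 'a set \<Rightarrow> ('a \<Rightarrow> 'a \<Rightarrow> 'a) \<Rightarrow> ('a \<Rightarrow> 'a \<Rightarrow> complex) \<Rightarrow> 'a set \<Rightarrow> ('a \<Rightarrow> complex) set" where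
  "roots_0 sc E br B H = roots sc E br H - roots_x sc E br B H"

definition rscale :: "real \<Rightarrow> ('a \<Rightarrow> complex) \<Rightarrow> ('a \<Rightarrow> complex)" where
  "rscale r f = (\<lambda>x. complex_of_real r * f x)"

text \<open>Discreteness of a subset of the finite-dimensional space H^*: the topology of H^* is the
  norm topology; for a finite spanning set S of H, max over h in S of |alpha h| is a norm on H^*.\<close>
definition discrete_in_dual :: "(complex \<Rightarrow> 'a::ab_group_add \<Rightarrow> 'a) \<Rightarrow> 'a set \<Rightarrow> ('a \<Rightarrow> complex) set \<Rightarrow> bool" where
  "discrete_in_dual sc H R \<longleftrightarrow>
     (\<exists>S. finite S \<and> S \<subseteq> H \<and> module.span sc S = H \<and>
       (\<forall>\<alpha>\<in>R. \<exists>\<epsilon>>0. \<forall>\<beta>\<in>R. (\<forall>h\<in>S. cmod (\<beta> h - \<alpha> h) < \<epsilon>) \<longrightarrow> \<beta> = \<alpha>))"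

definition eala :: "(complex \<Rightarrow> 'a::ab_group_add \<Rightarrow> 'a) \<Rightarrow> 'a set \<Rightarrow> ('a \<Rightarrow> 'a \<Rightarrow> 'a) \<Rightarrow> ('a \<Rightarrow> 'a \<Rightarrow> complex) \<Rightarrow> 'a set \<Rightarrow> bool" where
  "eala sc E br B H \<longleftrightarrow>
     lie_algebra sc E br \<and>
     \<comment> \<open>EA1\<close>
     good_form sc E br B \<and>
     \<comment> \<open>EA2\<close>
     lie_subalgebra sc E br H \<and> fin_dim sc H \<and>
     E = module.span sc (\<Union>\<alpha>\<in>dual_space sc H. root_space sc E br H \<alpha>) \<and>
     root_space sc E br H 0 = H \<and>
     \<comment> \<open>EA3\<close>
     (\<forall>\<alpha>\<in>roots_x sc E br B H. \<forall>x\<in>root_space sc E br H \<alpha>. \<forall>y\<in>E. \<exists>n. (br x ^^ n) y = 0) \<and>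
     \<comment> \<open>EA4\<close>
     discrete_in_dual sc H (roots sc E br H) \<and>
     \<comment> \<open>EA5\<close>
     \<not> (\<exists>A C. A \<noteq> {} \<and> C \<noteq> {} \<and> A \<union> C = roots_x sc E br B H \<and>
            (\<forall>a\<in>A. \<forall>c\<in>C. dform B H a c = 0)) \<and>
     (\<forall>\<sigma>\<in>roots_0 sc E br B H. \<exists>\<alpha>\<in>roots_x sc E br B H. \<alpha> + \<sigma> \<in> roots sc E br H)"

definition V0 :: "(complex \<Rightarrow> 'a::ab_group_add \<Rightarrow> 'a) \<Rightarrow> 'a set \<Rightarrow> ('a \<Rightarrow> 'a \<Rightarrow> 'a) \<Rightarrow> ('a \<Rightarrow> 'a \<Rightarrow> complex) \<Rightarrow> 'a set \<Rightarrow> ('a \<Rightarrow> complex) set" where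
  "V0 sc E br B H = module.span rscale (roots_0 sc E br B H)"

definition nullity :: "(complex \<Rightarrow> 'a::ab_group_add \<Rightarrow> 'a) \<Rightarrow> 'a set \<Rightarrow> ('a \<Rightarrow> 'a \<Rightarrow> 'a) \<Rightarrow> ('a \<Rightarrow> 'a \<Rightarrow> complex) \<Rightarrow> 'a set \<Rightarrow> nat" where
  "nullity sc E br B H = vector_space.dim rscale (V0 sc E br B H)"

text \<open>The image of R in V/V^0 is reduced: for a nonzero image root a, 2a is not an image root.
  (Nonzero image roots are exactly the images of R^x.)\<close>
definition reduced_quotient :: "(complex \<Rightarrow> 'a::ab_group_add \<Rightarrow> 'a) \<Rightarrow> 'a set \<Rightarrow> ('a \<Rightarrow> 'a \<Rightarrow> 'a) \<Rightarrow> ('a \<Rightarrow> 'a \<Rightarrow> complex) \<Rightarrow> 'a set \<Rightarrow> bool" where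
  "reduced_quotient sc E br B H \<longleftrightarrow>
     (\<forall>\<alpha>\<in>roots_x sc E br B H. \<forall>\<beta>\<in>roots sc E br H. \<beta> - (\<alpha> + \<alpha>) \<notin> V0 sc E br B H)"

definition core :: "(complex \<Rightarrow> 'a::ab_group_add \<Rightarrow> 'a) \<Rightarrow> 'a set \<Rightarrow> ('a \<Rightarrow> 'a \<Rightarrow> 'a) \<Rightarrow> ('a \<Rightarrow> 'a \<Rightarrow> complex) \<Rightarrow> 'a set \<Rightarrow> 'a set" where
  "core sc E br B H = gen_subalgebra sc E br (\<Union>\<alpha>\<in>roots_x sc E br B H. root_space sc E br H \<alpha>)"

definition fin_root_system :: "('a \<Rightarrow> 'a \<Rightarrow> complex) \<Rightarrow> 'a set \<Rightarrow> ('a \<Rightarrow> complex) set \<Rightarrow> bool" where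
  "fin_root_system B H Rd \<longleftrightarrow> finite Rd \<and> 0 \<in> Rd \<and>
     (\<forall>\<alpha>\<in>Rd - {0}. dform B H \<alpha> \<alpha> \<noteq> 0 \<and>
        (\<forall>\<beta>\<in>Rd. \<exists>k::int. 2 * dform B H \<beta> \<alpha> / dform B H \<alpha> \<alpha> = of_int k \<and>
                      \<beta> - rscale (of_int k) \<alpha> \<in> Rd))"

definition Rdot_ok :: "(complex \<Rightarrow> 'a::ab_group_add \<Rightarrow> 'a) \<Rightarrow> 'a set \<Rightarrow> ('a \<Rightarrow> 'a \<Rightarrow> 'a) \<Rightarrow> ('a \<Rightarrow> 'a \<Rightarrow> complex) \<Rightarrow> 'a set \<Rightarrow> ('a \<Rightarrow> complex) set \<Rightarrow> bool" where
  "Rdot_ok sc E br B H Rd \<longleftrightarrow>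
     fin_root_system B H Rd \<and> Rd \<subseteq> roots sc E br H \<and>
     roots sc E br H \<subseteq> set_sum Rd (V0 sc E br B H) \<and>
     (\<forall>a\<in>Rd. \<forall>b\<in>Rd. a - b \<in> V0 sc E br B H \<longrightarrow> a = b)"

definition Hdot :: "(complex \<Rightarrow> 'a::ab_group_add \<Rightarrow> 'a) \<Rightarrow> ('a \<Rightarrow> 'a \<Rightarrow> complex) \<Rightarrow> 'a set \<Rightarrow> ('a \<Rightarrow> complex) set \<Rightarrow> 'a set" where
  "Hdot sc B H Rd = module.span sc (tvec B H ` Rd)"

definition H_c :: "(complex \<Rightarrow> 'a::ab_group_add \<Rightarrow> 'a) \<Rightarrow> 'a set \<Rightarrow> ('a \<Rightarrow> 'a \<Rightarrow> 'a) \<Rightarrow> ('a \<Rightarrow> 'a \<Rightarrow> complex) \<Rightarrow> 'a set \<Rightarrow> 'a set" where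
  "H_c sc E br B H = module.span sc (tvec B H ` roots_x sc E br B H)"

definition H_0 :: "(complex \<Rightarrow> 'a::ab_group_add \<Rightarrow> 'a) \<Rightarrow> 'a set \<Rightarrow> ('a \<Rightarrow> 'a \<Rightarrow> 'a) \<Rightarrow> ('a \<Rightarrow> 'a \<Rightarrow> complex) \<Rightarrow> 'a set \<Rightarrow> 'a set" where
  "H_0 sc E br B H = module.span sc (tvec B H ` roots_0 sc E br B H)"

definition Hhat0_ok :: "(complex \<Rightarrow> 'a::ab_group_add \<Rightarrow> 'a) \<Rightarrow> 'a set \<Rightarrow> ('a \<Rightarrow> 'a \<Rightarrow> 'a) \<Rightarrow> ('a \<Rightarrow> 'a \<Rightarrow> complex) \<Rightarrow> 'a set \<Rightarrow> ('a \<Rightarrow> complex) set \<Rightarrow> 'a set \<Rightarrow> bool" where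
  "Hhat0_ok sc E br B H Rd K \<longleftrightarrow>
     module.subspace sc K \<and> K \<subseteq> H \<and>
     (\<forall>x\<in>K. \<forall>y\<in>Hdot sc B H Rd. B x y = 0) \<and>
     vector_space.dim sc K = vector_space.dim sc (H_0 sc E br B H) \<and>
     (\<forall>x\<in>K. \<forall>y\<in>K. B x y = 0) \<and>
     (\<forall>x\<in>set_sum (H_0 sc E br B H) K.
        (\<forall>y\<in>set_sum (H_0 sc E br B H) K. B x y = 0) \<longrightarrow> x = 0)"

text \<open>Affine generalized Cartan matrix (indices 0..n-1), Kac's type (Aff) for an indecomposable
  GCM: corank 1, Au = 0 for some u > 0, and Av >= 0 implies Av = 0.\<close>
definition affine_gcm :: "nat \<Rightarrow> (nat \<Rightarrow> nat \<Rightarrow> int) \<Rightarrow> bool" where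
  "affine_gcm n A \<longleftrightarrow>
     (\<forall>i<n. A i i = 2) \<and> (\<forall>i<n. \<forall>j<n. i \<noteq> j \<longrightarrow> A i j \<le> 0) \<and>
     (\<forall>i<n. \<forall>j<n. A i j = 0 \<longleftrightarrow> A j i = 0) \<and>
     \<comment> \<open>indecomposable\<close>
     \<not> (\<exists>I J. I \<noteq> {} \<and> J \<noteq> {} \<and> I \<inter> J = {} \<and> I \<union> J = {..<n} \<and>
            (\<forall>i\<in>I. \<forall>j\<in>J. A i j = 0)) \<and>
     \<comment> \<open>corank 1 (real null space is one-dimensional)\<close>
     (\<exists>u::nat \<Rightarrow> real. (\<exists>i<n. u i \<noteq> 0) \<and> (\<forall>i<n. (\<Sum>j<n. of_int (A i j) * u j) = 0) \<and>
        (\<forall>v::nat \<Rightarrow> real. (\<forall>i<n. (\<Sum>j<n. of_int (A i j) * v j) = 0) \<longrightarrow>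
            (\<exists>c. \<forall>i<n. v i = c * u i))) \<and>
     (\<exists>u::nat \<Rightarrow> real. (\<forall>i<n. u i > 0) \<and> (\<forall>i<n. (\<Sum>j<n. of_int (A i j) * u j) = 0)) \<and>
     (\<forall>v::nat \<Rightarrow> real. (\<forall>i<n. (\<Sum>j<n. of_int (A i j) * v j) \<ge> 0) \<longrightarrow>
            (\<forall>i<n. (\<Sum>j<n. of_int (A i j) * v j) = 0))"

text \<open>(L, B, H) is an affine (Kac--Moody) Lie algebra with Cartan subalgebra H: L is (isomorphic
  to) g(A) for an affine GCM A with realization (H, Pi, Pi-check), i.e. L is generated by H and
  Chevalley generators e_i, f_i satisfying the defining relations, and L has no nonzero ideal
  meeting H trivially; B is a symmetric non-degenerate invariant bilinear form on L.\<close>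
definition affine_lie_algebra :: "(complex \<Rightarrow> 'a::ab_group_add \<Rightarrow> 'a) \<Rightarrow> 'a set \<Rightarrow> ('a \<Rightarrow> 'a \<Rightarrow> 'a) \<Rightarrow> ('a \<Rightarrow> 'a \<Rightarrow> complex) \<Rightarrow> 'a set \<Rightarrow> bool" where
  "affine_lie_algebra sc L br B H \<longleftrightarrow>
     lie_algebra sc L br \<and> good_form sc L br B \<and> lie_subalgebra sc L br H \<and>
     (\<exists>n A (al :: nat \<Rightarrow> 'a \<Rightarrow> complex) (hv :: nat \<Rightarrow> 'a) (e :: nat \<Rightarrow> 'a) (f :: nat \<Rightarrow> 'a).
        affine_gcm n A \<and>
        \<comment> \<open>realization: dim H = 2n - rank A = n + 1\<close>
        fin_dim sc H \<and> vector_space.dim sc H = n + 1 \<and>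
        (\<forall>i<n. al i \<in> dual_space sc H \<and> hv i \<in> H) \<and>
        (\<forall>c::nat \<Rightarrow> complex. (\<forall>h\<in>H. (\<Sum>i<n. c i * al i h) = 0) \<longrightarrow> (\<forall>i<n. c i = 0)) \<and>
        inj_on hv {..<n} \<and> \<not> module.dependent sc (hv ` {..<n}) \<and>
        (\<forall>i<n. \<forall>j<n. al j (hv i) = of_int (A i j)) \<and>
        \<comment> \<open>defining relations\<close>
        (\<forall>i<n. e i \<in> L \<and> f i \<in> L) \<and>
        (\<forall>h\<in>H. \<forall>h'\<in>H. br h h' = 0) \<and>
        (\<forall>i<n. \<forall>j<n. br (e i) (f j) = (if i = j then hv i else 0)) \<and>
        (\<forall>i<n. \<forall>h\<in>H. br h (e i) = sc (al i h) (e i) \<and> br h (f i) = sc (- al i h) (f i)) \<and>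
        L = gen_subalgebra sc L br (H \<union> e ` {..<n} \<union> f ` {..<n}) \<and>
        (\<forall>I. lie_ideal sc L br I \<and> I \<inter> H = {0} \<longrightarrow> I = {0}))"

end

theory Submission
  imports Defs "HOL-Library.Multiset"
begin

text \<open>
  The nonisotropic roots form an affine root system: the finite root system \<open>Rd\<close> carries a positive
  definite invariant form, the isotropic roots lie on one line \<open>\<real>\<delta>\<close> orthogonal to all roots, and by
  discreteness the \<open>\<delta>\<close>-strings are locally finite. A generic height functional therefore has a set of
  indecomposable positive roots, which is finite, obtuse, connected and linearly independent, and its
  Cartan matrix is affine. Since nonisotropic root spaces are one-dimensional, \<open>sl\<^sub>2\<close>-theory and
  simple reflections show that the core is generated by the simple root vectors.

  What remains is that the invariant form is nondegenerate on \<open>H_R + E_c\<close>, which then excludes ideals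
  meeting the Cartan subalgebra trivially. Only isotropic weights \<open>\<sigma>\<close> are at stake. The part of
  the Casimir operator of degree below \<open>\<sigma>\<close> acts on the \<open>\<sigma>\<close>-component of the positive part by the
  scalar \<open>2 (\<rho>, \<sigma>) - (\<sigma>, \<sigma>) = 2 (\<rho>, \<sigma>)\<close>, which is not zero, while it kills the radical of the form
  once the form is nondegenerate in lower degrees.
\<close>

section \<open>Simple roots of an affine root system\<close>

text \<open>The radical problem arises because \<open>E\<close> need not be tame: for isotropic
  \<sigma> the spaces of weight \<sigma> and -\<sigma> in \<open>E\<close> may be larger than their
  parts in the core, so their pairing in \<open>E\<close> says nothing about the core. Opposite
  nonisotropic root spaces lie in the core entirely. The isotropic case therefore goes by induction
  on height: dual bases exist in lower degrees, and for x in the radical each [w, x] is a radical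
  vector of lower degree, hence zero. Here 2 (\<rho>, \<sigma>) is the sum of the (\<alpha>,
  \<alpha>) over the simple roots \<alpha> making up \<sigma>. It is nonzero because the complex
  form is, on pairs of a nonisotropic root and a root, one constant \<open>kap\<close> times a real
  form \<open>q\<close> that is positive on every real root. The form \<open>q\<close> adds up
  products of coroot values over the finite root system: integrality makes it real, reindexing by
  reflections makes it invariant, and connectedness yields a single \<open>kap\<close>. All root
  combinatorics is over the reals; statements over the complex numbers are recovered by splitting
  coefficients into real and imaginary parts.\<close>

inductive_set addcone :: "'v::ab_group_add set \<Rightarrow> 'v set" for A where
  base: "a \<in> A \<Longrightarrow> a \<in> addcone A"
| add: "a \<in> addcone A \<Longrightarrow> b \<in> addcone A \<Longrightarrow> a + b \<in> addcone A"

text \<open>The height \<open>p\<close> is in general position and stands for the choice of a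
  positive system. Since \<open>q\<close> is only semidefinite, \<open>radical\<close> is what
  controls the equality case of Cauchy-Schwarz. \<open>finite_below\<close> makes induction on real
  heights well-founded, and \<open>finite_mod\<close> bounds the number of simple roots.\<close>

locale affine_roots = vector_space rs
  for rs :: "real \<Rightarrow> 'v::ab_group_add \<Rightarrow> 'v" (infixr "*s" 75) +
  fixes q :: "'v \<Rightarrow> 'v \<Rightarrow> real" and p :: "'v \<Rightarrow> real" and \<Phi> :: "'v set" and \<delta> :: 'v
  assumes q_sym: "q x y = q y x"
    and q_add: "q (x + y) z = q x z + q y z"
    and q_scale: "q (c *s x) z = c * q x z"
    and q_nonneg: "q x x \<ge> 0"
    and p_add: "p (x + y) = p x + p y"
    and p_scale: "p (c *s x) = c * p x"
    and q_delta: "q \<delta> x = 0"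
    and p_delta: "p \<delta> > 0"
    and Phi_pos: "\<alpha> \<in> \<Phi> \<Longrightarrow> q \<alpha> \<alpha> > 0"
    and Phi_neg: "\<alpha> \<in> \<Phi> \<Longrightarrow> - \<alpha> \<in> \<Phi>"
    and Phi_refl: "\<alpha> \<in> \<Phi> \<Longrightarrow> \<beta> \<in> \<Phi> \<Longrightarrow>
          \<exists>k::int. 2 * q \<beta> \<alpha> = of_int k * q \<alpha> \<alpha> \<and> \<beta> - of_int k *s \<alpha> \<in> \<Phi>"
    and Phi_reduced: "\<alpha> \<in> \<Phi> \<Longrightarrow> 2 *s \<alpha> \<notin> \<Phi>"
    and p_nz: "\<alpha> \<in> \<Phi> \<Longrightarrow> p \<alpha> \<noteq> 0"
    and finite_below: "finite {\<alpha> \<in> \<Phi>. 0 < p \<alpha> \<and> p \<alpha> \<le> c}"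
    and finite_mod: "\<exists>F. finite F \<and> (\<forall>\<alpha>\<in>\<Phi>. \<exists>\<beta>\<in>F. \<exists>r. \<alpha> = \<beta> + r *s \<delta>)"
    and radical: "x \<in> span \<Phi> \<Longrightarrow> q x x = 0 \<Longrightarrow> \<exists>r. x = r *s \<delta>"
    and delta_span: "\<delta> \<in> span \<Phi>"
    and connected: "\<not> (\<exists>A C. A \<noteq> {} \<and> C \<noteq> {} \<and> A \<union> C = \<Phi> \<and> (\<forall>a\<in>A. \<forall>c\<in>C. q a c = 0))"
begin

lemma q_add_right: "q z (x + y) = q z x + q z y"
  by (metis q_add q_sym)

lemma q_scale_right: "q z (c *s x) = c * q z x"
  by (metis q_scale q_sym)

lemma q_zero [simp]: "q 0 x = 0" "q x 0 = 0"
  using q_scale[of 0 0 x] q_scale_right[of x 0 0] by simp_all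

lemma q_minus: "q (- x) z = - q x z" "q z (- x) = - q z x"
  using q_add[of x "- x" z] q_add_right[of z x "- x"] by simp_all

lemma q_diff: "q (x - y) z = q x z - q y z" "q z (x - y) = q z x - q z y"
  using q_add[of x "- y" z] q_add_right[of z x "- y"] by (simp_all add: q_minus)

lemma q_sum: "q (\<Sum>i\<in>I. f i) z = (\<Sum>i\<in>I. q (f i) z)"
  by (induction I rule: infinite_finite_induct) (auto simp: q_add)

lemma q_sum_right: "q z (\<Sum>i\<in>I. f i) = (\<Sum>i\<in>I. q z (f i))"
  by (induction I rule: infinite_finite_induct) (auto simp: q_add_right)

lemma p_zero [simp]: "p 0 = 0"
  using p_scale[of 0 0] by simp

lemma p_minus: "p (- x) = - p x"
  using p_add[of x "- x"] by simp

lemma p_diff: "p (x - y) = p x - p y"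
  using p_add[of x "- y"] by (simp add: p_minus)

lemma p_sum: "p (\<Sum>i\<in>I. f i) = (\<Sum>i\<in>I. p (f i))"
  by (induction I rule: infinite_finite_induct) (auto simp: p_add)

lemma q_delta_right: "q x \<delta> = 0"
  using q_delta q_sym by metis

lemma q_isotropic: assumes "q x x = 0" shows "q x y = 0"
proof (rule ccontr)
  \<comment> \<open>With q x x = 0 the form at c x + y is 2 c q x y + q y y, affine in c. The
    constant below makes it -1, against semidefiniteness.\<close>
  assume n: "q x y \<noteq> 0"
  define c where "c = - (q y y + 1) / (2 * q x y)"
  have "q (c *s x + y) (c *s x + y) = 2 * c * q x y + q y y"
    using assms q_sym[of x y] by (simp add: q_add q_add_right q_scale q_scale_right)
  also have "\<dots> = -1" using n by (simp add: c_def field_simps)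
  finally show False using q_nonneg[of "c *s x + y"] by simp
qed

lemma q_Cauchy_Schwarz: "(q x y)\<^sup>2 \<le> q x x * q y y"
proof (cases "q y y = 0")
  case True
  then show ?thesis using q_isotropic[of y x] q_sym[of x y] by simp
next
  case False
  hence pos: "q y y > 0" using q_nonneg[of y] by simp
  define z where "z = q y y *s x - q x y *s y"
  have "q z z = q y y * (q x x * q y y - (q x y)\<^sup>2)"
    using q_sym[of x y] unfolding z_def
    by (simp add: q_diff q_scale q_scale_right power2_eq_square algebra_simps)
  then show ?thesis using q_nonneg[of z] pos by (simp add: zero_le_mult_iff)
qed

section \<open>Positive roots, simple roots and reflections\<close>

definition P where "P = {\<alpha> \<in> \<Phi>. p \<alpha> > 0}"

text \<open>Indecomposability is tested against nonempty sums of positive roots, not only against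
  pairs of roots: multiples of \<delta> are not in \<open>\<Phi>\<close>, yet they have to count as
  summands when two roots differ by one.\<close>

definition simple where
  "simple = P - {a + b |a b. a \<in> addcone P \<and> b \<in> addcone P}"

lemma simple_P: "s \<in> simple \<Longrightarrow> s \<in> P" by (simp add: simple_def)
lemma P_Phi: "s \<in> P \<Longrightarrow> s \<in> \<Phi>" by (simp add: P_def)
lemma P_pos: "s \<in> P \<Longrightarrow> p s > 0" by (simp add: P_def)
lemma simple_Phi: "s \<in> simple \<Longrightarrow> s \<in> \<Phi>" by (simp add: simple_P P_Phi)
lemma simple_pos: "s \<in> simple \<Longrightarrow> p s > 0" by (simp add: simple_P P_pos)

lemma Phi_cases: "\<alpha> \<in> \<Phi> \<Longrightarrow> \<alpha> \<in> P \<or> - \<alpha> \<in> P"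
  using p_nz[of \<alpha>] Phi_neg[of \<alpha>] by (auto simp: P_def p_minus)

lemma addcone_pos: "a \<in> addcone P \<Longrightarrow> p a > 0"
  by (induction rule: addcone.induct) (auto simp: P_def p_add)

lemma simple_not_sum: "a \<in> addcone P \<Longrightarrow> b \<in> addcone P \<Longrightarrow> a + b \<notin> simple"
  by (auto simp: simple_def)

lemma finite_P_below: "finite {\<alpha> \<in> P. p \<alpha> \<le> c}"
  by (rule finite_subset[OF _ finite_below[of c]]) (auto simp: P_def)

text \<open>Heights are real numbers, so the measure is the number of positive roots of height at
  most \<open>p \<alpha>\<close>, which is finite by \<open>finite_below\<close>.\<close>

lemma P_p_induct [consumes 1]:
  assumes "\<alpha> \<in> P" and step: "\<And>\<alpha>. \<alpha> \<in> P \<Longrightarrow> (\<And>\<beta>. \<beta> \<in> P \<Longrightarrow> p \<beta> < p \<alpha> \<Longrightarrow> Q \<beta>) \<Longrightarrow> Q \<alpha>"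
  shows "Q \<alpha>"
  using assms(1)
proof (induction "card {\<beta> \<in> P. p \<beta> \<le> p \<alpha>}" arbitrary: \<alpha> rule: less_induct)
  case less
  show ?case
  proof (rule step[OF less.prems])
    fix \<beta> assume b: "\<beta> \<in> P" "p \<beta> < p \<alpha>"
    have "{\<gamma> \<in> P. p \<gamma> \<le> p \<beta>} \<subset> {\<gamma> \<in> P. p \<gamma> \<le> p \<alpha>}"
      using b less.prems by force
    from psubset_card_mono[OF finite_P_below this] show "Q \<beta>" by (rule less.hyps) (rule b(1))
  qed
qed

lemma P_addcone_simple: "\<alpha> \<in> P \<Longrightarrow> \<alpha> \<in> addcone simple"
proof (induction rule: P_p_induct)
  case (1 \<alpha>)
  show ?case
  proof (cases "\<alpha> \<in> simple")
    case True then show ?thesis by (rule addcone.base)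
  next
    case False
    then obtain a b where ab: "\<alpha> = a + b" "a \<in> addcone P" "b \<in> addcone P"
      using 1(1) by (auto simp: simple_def)
    have *: "x \<in> addcone P \<Longrightarrow> p x < p \<alpha> \<Longrightarrow> x \<in> addcone simple" for x
    proof (induction rule: addcone.induct)
      case (base x) then show ?case using 1(2) by simp
    next
      case (add x y)
      then have "p x < p \<alpha>" "p y < p \<alpha>" using addcone_pos[of x] addcone_pos[of y] by (simp_all add: p_add)
      then show ?case using add.IH by (simp add: addcone.add)
    qed
    have "p a < p \<alpha>" "p b < p \<alpha>" using ab addcone_pos[of a] addcone_pos[of b] by (simp_all add: p_add)
    then show ?thesis using ab(1) addcone.add[OF *[OF ab(2)] *[OF ab(3)]] by simp
  qed
qed

text \<open>Along \<beta> + r \<delta>, a reflection followed by negation acts on the coefficient as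
  the point reflection b \<mapsto> 2 a - b. Starting from the points 0 and r these generate all
  integer multiples of r.\<close>

lemma delta_string:
  assumes "\<beta> \<in> \<Phi>" "\<beta> + r *s \<delta> \<in> \<Phi>"
  shows "\<beta> + (of_int j * r) *s \<delta> \<in> \<Phi>"
proof -
  have refl: "\<beta> + (2 * a - b) *s \<delta> \<in> \<Phi>" if ab: "\<beta> + a *s \<delta> \<in> \<Phi>" "\<beta> + b *s \<delta> \<in> \<Phi>" for a b
  proof -
    obtain k :: int where k: "2 * q (\<beta> + b *s \<delta>) (\<beta> + a *s \<delta>) = of_int k * q (\<beta> + a *s \<delta>) (\<beta> + a *s \<delta>)"
      "(\<beta> + b *s \<delta>) - of_int k *s (\<beta> + a *s \<delta>) \<in> \<Phi>"
      using Phi_refl[OF ab] by blast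
    from k(1) have "2 * q \<beta> \<beta> = of_int k * q \<beta> \<beta>"
      by (simp add: q_add q_add_right q_scale q_scale_right q_delta q_delta_right)
    hence "k = 2" using Phi_pos[OF assms(1)] by simp
    from Phi_neg[OF k(2)] have "- ((\<beta> + b *s \<delta>) - 2 *s (\<beta> + a *s \<delta>)) \<in> \<Phi>" using \<open>k = 2\<close> by simp
    moreover have "- ((\<beta> + b *s \<delta>) - 2 *s (\<beta> + a *s \<delta>)) = \<beta> + (2 * a - b) *s \<delta>"
      using scale_left_distrib[of 1 1 \<beta>] by (simp add: algebra_simps)
    ultimately show ?thesis by simp
  qed
  have nat: "\<beta> + (of_nat m * r) *s \<delta> \<in> \<Phi> \<and> \<beta> + (of_nat (Suc m) * r) *s \<delta> \<in> \<Phi>" for m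
  proof (induction m)
    case 0 then show ?case using assms by simp
  next
    case (Suc m)
    have "2 * (of_nat (Suc m) * r) - of_nat m * r = of_nat (Suc (Suc m)) * r" by (simp add: algebra_simps)
    then show ?case using refl[of "of_nat (Suc m) * r" "of_nat m * r"] Suc by metis
  qed
  show ?thesis
  proof (cases "j \<ge> 0")
    case True
    then show ?thesis using nat[of "nat j"] by simp
  next
    case False
    then show ?thesis using refl[of 0 "of_nat (nat (- j)) * r"] nat[of "nat (- j)"] assms by simp
  qed
qed

text \<open>If two real roots differ by an isotropic vector, the whole string through them consists of
  roots, and at the place where the string changes sign the difference splits as a sum of two
  positive real roots.\<close>
lemma delta_decomposable:
  assumes "\<beta> \<in> \<Phi>" "\<beta> + r *s \<delta> \<in> \<Phi>" "r > 0"
  shows "r *s \<delta> \<in> addcone P"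
proof -
  define c where "c = r * p \<delta>"
  have c: "c > 0" using assms(3) p_delta by (simp add: c_def)
  define j where "j = \<lfloor>- p \<beta> / c\<rfloor> + 1"
  have j1: "- p \<beta> / c < of_int j" "of_int j - 1 \<le> - p \<beta> / c"
    unfolding j_def by linarith+
  define a where "a = \<beta> + (of_int j * r) *s \<delta>"
  define b where "b = \<beta> + (of_int (j - 1) * r) *s \<delta>"
  have ab: "a \<in> \<Phi>" "b \<in> \<Phi>" using delta_string[OF assms(1,2)] unfolding a_def b_def by blast+
  have "p a = p \<beta> + of_int j * c" by (simp add: a_def p_add p_scale c_def)
  hence "p a > 0" using j1(1) c by (simp add: field_simps)
  have "p b = p \<beta> + (of_int j - 1) * c" by (simp add: b_def p_add p_scale c_def)
  hence "p b \<le> 0" using j1(2) c by (simp add: field_simps)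
  hence "p (- b) > 0" using p_nz[OF ab(2)] by (simp add: p_minus)
  have "a + - b = (of_int j * r - of_int (j - 1) * r) *s \<delta>"
    by (simp add: a_def b_def algebra_simps)
  also have "of_int j * r - of_int (j - 1) * r = r" by (simp add: algebra_simps)
  finally have "r *s \<delta> = a + - b" by simp
  moreover have "a \<in> P" "- b \<in> P" using ab \<open>p a > 0\<close> \<open>p (-b) > 0\<close> Phi_neg by (auto simp: P_def)
  ultimately show ?thesis by (metis addcone.intros)
qed

text \<open>If r were positive, r \<delta> would be a sum of positive roots by
  \<open>delta_decomposable\<close>, and s = t + r \<delta> would decompose. Exchanging s and t
  excludes negative r.\<close>

lemma simple_cong:
  assumes "s \<in> simple" "t \<in> simple" "s = t + r *s \<delta>"
  shows "s = t"
proof -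
  have *: "\<not> r > 0" if "s \<in> simple" "t \<in> simple" "s = t + r *s \<delta>" for s t r
    using delta_decomposable[of t r] simple_not_sum[of t "r *s \<delta>"] that
    by (auto dest: simple_Phi simple_P intro: addcone.base)
  have "t = s + (- r) *s \<delta>" using assms(3) by simp
  hence "\<not> - r > 0" using *[OF assms(2,1)] by blast
  with *[OF assms] have "r = 0" by linarith
  then show ?thesis using assms(3) by simp
qed

lemma simple_diff_notin: 
  assumes "s \<in> simple" "t \<in> simple"
  shows "s - t \<notin> \<Phi>"
proof
  assume "s - t \<in> \<Phi>"
  then consider "s - t \<in> P" | "t - s \<in> P" using Phi_cases by fastforce
  then show False
  proof cases
    case 1
    then have "(s - t) + t \<notin> simple"
      using assms by (intro simple_not_sum) (auto intro: addcone.base simple_P)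
    then show False using assms by simp
  next
    case 2
    then have "(t - s) + s \<notin> simple"
      using assms by (intro simple_not_sum) (auto intro: addcone.base simple_P)
    then show False using assms by simp
  qed
qed

text \<open>If q s t were positive, both Cartan integers would be positive with product at most 4.
  Neither can be 1, because a difference of simple roots is not a root, so both are 2 and s - t is
  isotropic. This last case, absent from finite root systems, falls to \<open>radical\<close> and
  \<open>simple_cong\<close>.\<close>

lemma simple_obtuse:
  assumes s: "s \<in> simple" and t: "t \<in> simple" and "s \<noteq> t"
  shows "q s t \<le> 0"
proof (rule ccontr)
  assume "\<not> q s t \<le> 0"
  hence pos: "q s t > 0" by simp
  note S = simple_Phi[OF s] simple_Phi[OF t]
  obtain k :: int where k: "2 * q s t = of_int k * q t t" "s - of_int k *s t \<in> \<Phi>"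
    using Phi_refl[OF S(2,1)] by blast
  obtain l :: int where l: "2 * q t s = of_int l * q s s" "t - of_int l *s s \<in> \<Phi>"
    using Phi_refl[OF S(1,2)] by blast
  have qs: "q s s > 0" "q t t > 0" using S Phi_pos by auto
  have kp: "k > 0" using k(1) pos qs
    by (metis mult_pos_pos of_int_0_less_iff zero_less_mult_pos2 zero_less_numeral)
  have lp: "l > 0" using l(1) pos qs q_sym[of s t]
    by (metis mult_pos_pos of_int_0_less_iff zero_less_mult_pos2 zero_less_numeral)
  have "k \<noteq> 1" using k(2) simple_diff_notin[OF s t] by auto
  have "l \<noteq> 1" using l(2) simple_diff_notin[OF t s] by auto
  have "of_int (k * l) * (q s s * q t t) = (of_int k * q t t) * (of_int l * q s s)" by simp
  also have "\<dots> = 4 * (q s t)\<^sup>2"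
    unfolding k(1)[symmetric] l(1)[symmetric] q_sym[of t s] by (simp add: power2_eq_square)
  also have "\<dots> \<le> 4 * (q s s * q t t)" using q_Cauchy_Schwarz[of s t] by simp
  finally have "of_int (k * l) \<le> (4::real)" using qs by (simp add: mult_le_cancel_right)
  hence "k * l \<le> 4" by linarith
  moreover have "2 * l \<le> k * l" "k * 2 \<le> k * l" using kp lp \<open>k \<noteq> 1\<close> \<open>l \<noteq> 1\<close> by simp_all
  ultimately have "k = 2" "l = 2" using kp lp \<open>k \<noteq> 1\<close> \<open>l \<noteq> 1\<close> by linarith+
  hence "q (s - t) (s - t) = 0" using k(1) l(1) q_sym[of s t] by (simp add: q_diff)
  moreover have "s - t \<in> span \<Phi>" using S by (intro span_diff span_base)
  ultimately obtain r where "s - t = r *s \<delta>" using radical by blast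
  hence "s = t + r *s \<delta>" by (simp add: algebra_simps)
  then show False using simple_cong[OF s t] \<open>s \<noteq> t\<close> by blast
qed

text \<open>By \<open>simple_cong\<close> a simple root is determined by its class modulo \<delta>,
  and there are finitely many classes.\<close>

lemma finite_simple: "finite simple"
proof -
  obtain F where F: "finite F" "\<forall>\<alpha>\<in>\<Phi>. \<exists>\<beta>\<in>F. \<exists>r. \<alpha> = \<beta> + r *s \<delta>" using finite_mod by blast
  then obtain g where g: "\<And>\<alpha>. \<alpha> \<in> \<Phi> \<Longrightarrow> g \<alpha> \<in> F \<and> (\<exists>r. \<alpha> = g \<alpha> + r *s \<delta>)" by metis
  have "inj_on g simple"
  proof (rule inj_onI)
    fix s t assume st: "s \<in> simple" "t \<in> simple" "g s = g t"
    obtain a b where "s = g s + a *s \<delta>" "t = g t + b *s \<delta>" using g st simple_Phi by metis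
    hence "s = t + (a - b) *s \<delta>" using st(3) by (simp add: algebra_simps)
    then show "s = t" using simple_cong st by blast
  qed
  then show ?thesis using F(1) g simple_Phi by (metis finite_imageD finite_subset image_subsetI)
qed

lemma addcone_repr:
  "x \<in> addcone simple \<Longrightarrow> \<exists>k::'v \<Rightarrow> nat. x = (\<Sum>s\<in>simple. of_nat (k s) *s s)"
proof (induction rule: addcone.induct)
  case (base a)
  have "a = (\<Sum>s\<in>simple. if s = a then s else 0)" using base finite_simple by simp
  also have "\<dots> = (\<Sum>s\<in>simple. of_nat (if s = a then 1 else 0) *s s)"
    by (intro sum.cong) auto
  finally show ?case by (intro exI[of _ "\<lambda>s. if s = a then 1 else 0"]) simp
next
  case (add a b)
  then obtain k l :: "'v \<Rightarrow> nat" where "a = (\<Sum>s\<in>simple. of_nat (k s) *s s)"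
    "b = (\<Sum>s\<in>simple. of_nat (l s) *s s)" by blast
  hence "a + b = (\<Sum>s\<in>simple. of_nat (k s + l s) *s s)"
    by (simp add: sum.distrib scale_left_distrib)
  then show ?case by (intro exI[of _ "\<lambda>s. k s + l s"])
qed

lemma P_repr: "\<alpha> \<in> P \<Longrightarrow> \<exists>k::'v \<Rightarrow> nat. \<alpha> = (\<Sum>s\<in>simple. of_nat (k s) *s s)"
  by (intro addcone_repr P_addcone_simple)

text \<open>The Cartan integer k of s against n s satisfies k n = 2, so n is 1 or 2, and reducedness
  excludes 2.\<close>

lemma multiple_eq:
  assumes "s \<in> \<Phi>" "\<alpha> \<in> \<Phi>" "\<alpha> = of_nat n *s s"
  shows "\<alpha> = s"
proof -
  obtain k :: int where k: "2 * q s \<alpha> = of_int k * q \<alpha> \<alpha>" using Phi_refl assms by blast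
  have qs: "q s s > 0" using Phi_pos assms by simp
  have "2 * of_nat n * q s s = of_int k * of_nat n * of_nat n * q s s"
    using k by (auto simp: assms(3) q_scale q_scale_right)
  moreover have n: "n \<noteq> 0" using Phi_pos[OF assms(2)] assms(3) by (cases n) auto
  ultimately have "(2::real) = of_int k * of_nat n" using qs by auto
  hence "2 = k * int n" by (metis of_int_eq_iff of_int_mult of_int_numeral of_int_of_nat_eq)
  hence "int n dvd 2" by (metis dvd_triv_right)
  hence "n dvd 2" by presburger
  hence "n \<le> 2" by (rule dvd_imp_le) simp
  moreover have "n \<noteq> 2" using Phi_reduced[OF assms(1)] assms(2,3) by auto
  ultimately have "n = 1" using n by linarith
  then show ?thesis using assms(3) by simp
qed

text \<open>Otherwise \<alpha> and the negative of its reflection are both natural combinations of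
  simple roots, and they add up to k s. Comparing the two sides off s, obtuseness makes the
  remaining multiple of s nonpositive while heights make it nonnegative, so only s occurs in
  \<alpha>. Linear independence of the simple roots is not yet available at this point.\<close>

lemma refl_pos:
  assumes \<alpha>: "\<alpha> \<in> P" and s: "s \<in> simple" and "\<alpha> \<noteq> s" and r: "\<alpha> - of_int k *s s \<in> \<Phi>"
  shows "\<alpha> - of_int k *s s \<in> P"
proof (rule ccontr)
  assume "\<not> ?thesis"
  hence "- (\<alpha> - of_int k *s s) \<in> P" using Phi_cases r by blast
  then obtain m :: "'v \<Rightarrow> nat" where m: "- (\<alpha> - of_int k *s s) = (\<Sum>t\<in>simple. of_nat (m t) *s t)"
    using P_repr by blast
  obtain n :: "'v \<Rightarrow> nat" where n: "\<alpha> = (\<Sum>t\<in>simple. of_nat (n t) *s t)"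
    using P_repr[OF \<alpha>] by blast
  define N where "N t = n t + m t" for t
  have "of_int k *s s = (\<Sum>t\<in>simple. of_nat (N t) *s t)"
    using m n by (simp add: N_def scale_left_distrib sum.distrib algebra_simps)
  also have "\<dots> = of_nat (N s) *s s + (\<Sum>t\<in>simple - {s}. of_nat (N t) *s t)"
    using finite_simple s by (simp add: sum.remove)
  finally have eq: "(of_int k - of_nat (N s)) *s s = (\<Sum>t\<in>simple - {s}. of_nat (N t) *s t)"
    by (simp add: algebra_simps)
  have "(of_int k - of_nat (N s)) * q s s = (\<Sum>t\<in>simple - {s}. of_nat (N t) * q t s)"
    using arg_cong[OF eq, of "\<lambda>x. q x s"] by (simp add: q_sum q_scale)
  also have "\<dots> \<le> 0"
    by (intro sum_nonpos mult_nonneg_nonpos) (use s simple_obtuse in auto)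
  finally have le: "of_int k - of_nat (N s) \<le> (0::real)"
    using Phi_pos[OF simple_Phi[OF s]] by (simp add: mult_le_0_iff)
  have p1: "(of_int k - of_nat (N s)) * p s = (\<Sum>t\<in>simple - {s}. of_nat (N t) * p t)"
    using arg_cong[OF eq, of p] by (simp add: p_sum p_scale)
  have nn: "\<And>t. t \<in> simple - {s} \<Longrightarrow> of_nat (N t) * p t \<ge> 0" using simple_pos by fastforce
  have "(\<Sum>t\<in>simple - {s}. of_nat (N t) * p t) \<le> 0"
    using le simple_pos[OF s] p1 by (metis less_eq_real_def mult_nonpos_nonneg)
  hence "(\<Sum>t\<in>simple - {s}. of_nat (N t) * p t) = 0" using sum_nonneg[of "simple - {s}" "\<lambda>t. of_nat (N t) * p t", OF nn] by linarith
  hence "\<forall>t\<in>simple - {s}. of_nat (N t) * p t = 0"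
    using sum_nonneg_eq_0_iff[of "simple - {s}" "\<lambda>t. of_nat (N t) * p t"] nn finite_simple by auto
  hence "\<forall>t\<in>simple - {s}. N t = 0" using simple_pos
    by (metis DiffD1 less_irrefl mult_eq_0_iff of_nat_eq_0_iff)
  hence "\<forall>t\<in>simple - {s}. n t = 0" by (simp add: N_def)
  hence "\<alpha> = of_nat (n s) *s s"
    using n finite_simple s by (simp add: sum.remove)
  then show False using multiple_eq[of s \<alpha> "n s"] simple_Phi[OF s] P_Phi[OF \<alpha>] \<open>\<alpha> \<noteq> s\<close> by blast
qed

text \<open>Expanding one argument of q \<alpha> \<alpha> > 0 in simple roots gives a simple s with
  q \<alpha> s > 0. If \<alpha> is not simple, reflecting in s keeps it positive and lowers its
  height. So every positive root is reached from a simple one by simple reflections that raise the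
  height.\<close>

lemma P_induct [consumes 1, case_names simple step]:
  assumes "\<alpha> \<in> P"
    and base: "\<And>s. s \<in> simple \<Longrightarrow> Q s"
    and step: "\<And>\<alpha> s k. \<alpha> \<in> P \<Longrightarrow> s \<in> simple \<Longrightarrow> 0 < k \<Longrightarrow> 2 * q \<alpha> s = of_nat k * q s s
       \<Longrightarrow> \<alpha> - of_nat k *s s \<in> P \<Longrightarrow> Q (\<alpha> - of_nat k *s s) \<Longrightarrow> Q \<alpha>"
  shows "Q \<alpha>"
  using assms(1)
proof (induction rule: P_p_induct)
  case (1 \<alpha>)
  show ?case
  proof (cases "\<alpha> \<in> simple")
    case True then show ?thesis by (rule base)
  next
    case False
    obtain c :: "'v \<Rightarrow> nat" where c: "\<alpha> = (\<Sum>t\<in>simple. of_nat (c t) *s t)"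
      using P_repr[OF 1(1)] by blast
    have "q \<alpha> \<alpha> = (\<Sum>t\<in>simple. of_nat (c t) * q \<alpha> t)"
      by (subst (2) c) (simp add: q_sum_right q_scale_right)
    moreover have "q \<alpha> \<alpha> > 0" using Phi_pos P_Phi[OF 1(1)] by blast
    ultimately obtain s where s: "s \<in> simple" "q \<alpha> s > 0"
      by (smt (verit) mult_nonneg_nonpos of_nat_0_le_iff sum_nonpos)
    have qs: "q s s > 0" using Phi_pos simple_Phi s by blast
    obtain k :: int where k: "2 * q \<alpha> s = of_int k * q s s" "\<alpha> - of_int k *s s \<in> \<Phi>"
      using Phi_refl simple_Phi[OF s(1)] P_Phi[OF 1(1)] by blast
    have "k > 0" using k(1) s(2) qs
      by (metis mult_pos_pos of_int_0_less_iff zero_less_mult_pos2 zero_less_numeral)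
    then obtain n where n: "k = int n" "n > 0" by (metis pos_int_cases)
    have "\<alpha> - of_int k *s s \<in> P" using refl_pos[OF 1(1) s(1) _ k(2)] False s(1) by auto
    hence P': "\<alpha> - of_nat n *s s \<in> P" using n by simp
    moreover have "p (\<alpha> - of_nat n *s s) < p \<alpha>" using n simple_pos[OF s(1)] by (simp add: p_diff p_scale)
    ultimately have "Q (\<alpha> - of_nat n *s s)" using 1(2) by blast
    then show ?thesis using step[OF 1(1) s(1) n(2) _ P'] k(1) n(1) by simp
  qed
qed

section \<open>Connectedness, linear independence and the coefficients of \<delta>\<close>

lemma q_span_orthogonal:
  assumes "\<And>a b. a \<in> I \<Longrightarrow> b \<in> J \<Longrightarrow> q a b = 0" and "x \<in> span I" "y \<in> span J"
  shows "q x y = 0"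
proof -
  have 1: "q x b = 0" if b: "b \<in> J" for b
    using assms(2)
  proof (induction rule: span_induct_alt)
    case (step c a z) then show ?case using assms(1) b by (simp add: q_add q_scale)
  qed simp
  show ?thesis using assms(3)
  proof (induction rule: span_induct_alt)
    case (step c a z) then show ?case using 1 by (simp add: q_add_right q_scale_right)
  qed simp
qed

text \<open>In a step of \<open>P_induct\<close> the smaller root is not orthogonal to the
  reflecting simple root, so both belong to the span of the same part. Hence every root lies in one
  of the two spans, and a splitting of the simple roots would split \<open>\<Phi>\<close>.\<close>

lemma simple_connected:
  assumes "I \<union> J = simple" "\<And>a b. a \<in> I \<Longrightarrow> b \<in> J \<Longrightarrow> q a b = 0"
  shows "I = {} \<or> J = {}"
proof (rule ccontr)
  assume ne: "\<not> ?thesis"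
  have P: "\<alpha> \<in> span I \<or> \<alpha> \<in> span J" if "\<alpha> \<in> P" for \<alpha>
    using that
  proof (induction rule: P_induct)
    case (simple s) then show ?case using assms(1) span_base by blast
  next
    case (step \<alpha> s k)
    let ?\<beta> = "\<alpha> - of_nat k *s s"
    have eq: "\<alpha> = ?\<beta> + of_nat k *s s" by simp
    have nz: "q ?\<beta> s \<noteq> 0"
    proof -
      have "q ?\<beta> s = - q \<alpha> s" using step(4) by (simp add: q_diff q_scale)
      moreover have "q \<alpha> s > 0" using step(3,4) Phi_pos[OF simple_Phi[OF step(2)]]
        by (metis mult_pos_pos of_nat_0_less_iff zero_less_mult_pos zero_less_numeral)
      ultimately show ?thesis by simp
    qed
    have sJ: "s \<in> span I \<or> s \<in> span J" "s \<in> I \<or> s \<in> J" using assms(1) step(2) span_base by blast+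
    from step(6) show ?case
    proof
      assume b: "?\<beta> \<in> span I"
      hence "s \<notin> J" using nz q_span_orthogonal[of I J ?\<beta> s] assms(2) span_base by blast
      hence "s \<in> span I" using sJ span_base by blast
      then show ?thesis using b eq by (metis span_add span_scale)
    next
      assume b: "?\<beta> \<in> span J"
      hence "s \<notin> I" using nz q_span_orthogonal[of I J s ?\<beta>] assms(2) span_base q_sym[of s ?\<beta>] by auto
      hence "s \<in> span J" using sJ span_base by blast
      then show ?thesis using b eq by (metis span_add span_scale)
    qed
  qed
  have Phi: "\<alpha> \<in> span I \<or> \<alpha> \<in> span J" if "\<alpha> \<in> \<Phi>" for \<alpha>
    using Phi_cases[OF that] P[of \<alpha>] P[of "- \<alpha>"] span_neg[of "- \<alpha>"] by auto
  have "\<Phi> \<inter> span I \<noteq> {}" "\<Phi> \<inter> span J \<noteq> {}"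
  proof -
    obtain a b where "a \<in> I" "b \<in> J" using ne by blast
    moreover from this have "a \<in> \<Phi>" "b \<in> \<Phi>" using assms(1) simple_Phi by blast+
    ultimately show "\<Phi> \<inter> span I \<noteq> {}" "\<Phi> \<inter> span J \<noteq> {}" using span_base by blast+
  qed
  moreover have "(\<Phi> \<inter> span I) \<union> (\<Phi> \<inter> span J) = \<Phi>" using Phi by blast
  moreover have "\<forall>a\<in>\<Phi> \<inter> span I. \<forall>c\<in>\<Phi> \<inter> span J. q a c = 0"
  proof (intro ballI)
    fix a c assume "a \<in> \<Phi> \<inter> span I" "c \<in> \<Phi> \<inter> span J"
    then show "q a c = 0" using q_span_orthogonal[of I J a c] assms(2) by blast
  qed
  ultimately show False using connected by (metis (no_types, lifting))
qed

text \<open>Let a be the part of x with positive coefficients. Since x is isotropic it is orthogonal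
  to a, and by obtuseness the rest of x pairs nonnegatively with a; hence a is isotropic as well and
  orthogonal to everything. Then no simple root in the support of a is linked to one outside, and
  connectedness leaves nothing or everything.\<close>

lemma isotropic_support:
  assumes "q (\<Sum>s\<in>simple. c s *s s) (\<Sum>s\<in>simple. c s *s s) = 0"
  shows "(\<forall>s\<in>simple. c s \<le> 0) \<or> (\<forall>s\<in>simple. c s > 0)"
proof -
  define A where "A = {s \<in> simple. c s > 0}"
  define x where "x = (\<Sum>s\<in>simple. c s *s s)"
  define a where "a = (\<Sum>s\<in>A. c s *s s)"
  have fA: "finite A" "A \<subseteq> simple" using finite_simple by (auto simp: A_def)
  have x: "x = a + (\<Sum>s\<in>simple - A. c s *s s)"
    unfolding x_def a_def using sum.subset_diff[OF fA(2) finite_simple] by (simp add: add.commute)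
  have ta: "q a t = (\<Sum>s\<in>A. c s * q s t)" for t
    by (simp add: a_def q_sum q_scale)
  have tneg: "q a t \<le> 0" if "t \<in> simple - A" for t
    unfolding ta by (intro sum_nonpos mult_nonneg_nonpos) (use that simple_obtuse in \<open>auto simp: A_def\<close>)
  have "0 = q a x" using q_isotropic[of x a] assms q_sym[of a x] by (simp add: x_def)
  also have "\<dots> = q a a + (\<Sum>t\<in>simple - A. c t * q a t)"
    by (subst x) (simp add: q_add_right q_sum_right q_scale_right)
  finally have "q a a = - (\<Sum>t\<in>simple - A. c t * q a t)" by simp
  moreover have "(\<Sum>t\<in>simple - A. c t * q a t) \<ge> 0"
    by (intro sum_nonneg mult_nonpos_nonpos) (use tneg in \<open>auto simp: A_def\<close>)
  ultimately have "q a a = 0" using q_nonneg[of a] by simp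
  hence z: "q a t = 0" for t using q_isotropic by blast
  have "q s t = 0" if st: "s \<in> A" "t \<in> simple - A" for s t
  proof -
    have "\<forall>s\<in>A. - (c s * q s t) = 0"
    proof (subst sum_nonneg_eq_0_iff[symmetric])
      show "(\<Sum>s\<in>A. - (c s * q s t)) = 0" using z[of t] ta[of t] by (simp add: sum_negf)
      fix u assume "u \<in> A" then show "0 \<le> - (c u * q u t)"
        using simple_obtuse[of u t] st(2) by (auto simp: A_def mult_le_0_iff)
    qed (use fA in auto)
    then show ?thesis using st by (auto simp: A_def)
  qed
  from simple_connected[of A "simple - A", OF _ this] fA have "A = {} \<or> simple - A = {}" by blast
  then show ?thesis by (auto simp: A_def not_less)
qed

lemma simple_nonempty: "simple \<noteq> {}"
proof
  assume "simple = {}"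
  have "x \<notin> addcone simple" for x
  proof
    assume "x \<in> addcone simple"
    then show False by induction (simp_all add: \<open>simple = {}\<close>)
  qed
  hence "P = {}" using P_addcone_simple by (metis equals0I)
  hence "\<Phi> = {}" using Phi_cases by blast
  hence "\<delta> = 0" using delta_span by simp
  then show False using p_delta by simp
qed

text \<open>Zero is isotropic, so \<open>isotropic_support\<close> applies to c and to -c. The
  strictly positive alternative would give zero a positive height.\<close>

lemma simple_independent:
  assumes "(\<Sum>s\<in>simple. c s *s s) = 0" "s \<in> simple"
  shows "c s = 0"
proof -
  have *: "d s \<le> 0" if d: "(\<Sum>s\<in>simple. d s *s s) = 0" "s \<in> simple" for d s
  proof -
    have "\<not> (\<forall>s\<in>simple. d s > 0)"
    proof
      assume a: "\<forall>s\<in>simple. d s > 0"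
      have "(\<Sum>s\<in>simple. d s * p s) = p (\<Sum>s\<in>simple. d s *s s)" by (simp add: p_sum p_scale)
      moreover have "(\<Sum>s\<in>simple. d s * p s) > 0"
        by (intro sum_pos finite_simple simple_nonempty mult_pos_pos) (use a simple_pos in auto)
      ultimately show False using d by simp
    qed
    then show ?thesis using isotropic_support[of d] d by auto
  qed
  have "(\<Sum>s\<in>simple. (- c s) *s s) = 0" using assms(1) by (simp add: sum_negf)
  then show ?thesis using *[of c] *[of "\<lambda>s. - c s"] assms by fastforce
qed

lemma span_Phi: "span \<Phi> = span simple"
proof
  have "\<alpha> \<in> span simple" if \<alpha>: "\<alpha> \<in> P" for \<alpha>
  proof -
    obtain c :: "'v \<Rightarrow> nat" where "\<alpha> = (\<Sum>t\<in>simple. of_nat (c t) *s t)"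
      using P_repr[OF \<alpha>] by blast
    then show ?thesis by (auto intro!: span_sum span_scale intro: span_base)
  qed
  hence "\<Phi> \<subseteq> span simple" using Phi_cases span_neg by (metis minus_minus subsetI)
  then show "span \<Phi> \<subseteq> span simple" by (simp add: span_minimal subspace_span)
  show "span simple \<subseteq> span \<Phi>" by (rule span_mono) (use simple_Phi in blast)
qed

text \<open>The vector \<delta> is isotropic of positive height, which leaves only the strictly
  positive alternative of \<open>isotropic_support\<close>. The coefficients are the positive null
  vector of the Cartan matrix.\<close>

lemma delta_repr: "\<exists>u. \<delta> = (\<Sum>s\<in>simple. u s *s s) \<and> (\<forall>s\<in>simple. u s > 0)"
proof -
  obtain u where u: "\<delta> = (\<Sum>s\<in>simple. u s *s s)"
    using delta_span unfolding span_Phi span_finite[OF finite_simple] by blast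
  have "\<not> (\<forall>s\<in>simple. u s \<le> 0)"
  proof
    assume "\<forall>s\<in>simple. u s \<le> 0"
    hence "(\<Sum>s\<in>simple. u s * p s) \<le> 0" 
      by (intro sum_nonpos mult_nonpos_nonneg) (use simple_pos in \<open>auto intro: less_imp_le\<close>)
    moreover have "p \<delta> = (\<Sum>s\<in>simple. u s * p s)" by (subst u) (simp add: p_sum p_scale)
    ultimately show False using p_delta by simp
  qed
  then show ?thesis using isotropic_support[of u] u q_delta[of \<delta>] by metis
qed

lemma affine_gcm_simple:
  assumes a: "bij_betw a {..<n} simple"
    and A: "\<And>i j. i < n \<Longrightarrow> j < n \<Longrightarrow> 2 * q (a j) (a i) = of_int (A i j) * q (a i) (a i)"
  shows "affine_gcm n A"
proof -
  have ai: "a i \<in> simple" if "i < n" for i using a that by (auto simp: bij_betw_def)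
  have inj: "a i = a j \<longleftrightarrow> i = j" if "i < n" "j < n" for i j
    using a that by (auto simp: bij_betw_def inj_on_def)
  have qi: "q (a i) (a i) > 0" if "i < n" for i using Phi_pos simple_Phi ai that by blast
  have zero: "A i j = 0 \<longleftrightarrow> q (a i) (a j) = 0" if "i < n" "j < n" for i j
    using A[OF that] qi[OF that(1)] q_sym[of "a i" "a j"] by auto
  \<comment> \<open>Row i of A v is, up to the positive factor q (a i) (a i), twice the pairing of
    the vector with coordinates v with a i. So A v = 0 means that this vector is isotropic.\<close>
  have row: "2 * q (\<Sum>j<n. v j *s a j) (a i) = (\<Sum>j<n. of_int (A i j) * v j) * q (a i) (a i)"
    if "i < n" for v i
  proof -
    have "2 * q (\<Sum>j<n. v j *s a j) (a i) = (\<Sum>j<n. v j * (2 * q (a j) (a i)))"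
      by (simp add: q_sum q_scale sum_distrib_left mult_ac)
    also have "\<dots> = (\<Sum>j<n. v j * (of_int (A i j) * q (a i) (a i)))"
      using A that by (intro sum.cong) auto
    finally show ?thesis by (simp add: sum_distrib_left mult_ac)
  qed
  have reidx: "(\<Sum>j<n. v j *s a j) = (\<Sum>s\<in>simple. v (inv_into {..<n} a s) *s s)" for v
  proof -
    have "(\<Sum>s\<in>simple. v (inv_into {..<n} a s) *s s) = (\<Sum>j<n. v (inv_into {..<n} a (a j)) *s a j)"
      by (rule sum.reindex_bij_betw[OF a, symmetric])
    also have "\<dots> = (\<Sum>j<n. v j *s a j)"
      using a by (intro sum.cong) (auto simp: bij_betw_def)
    finally show ?thesis by simp
  qed
  obtain u' where u': "\<delta> = (\<Sum>s\<in>simple. u' s *s s)" "\<forall>s\<in>simple. u' s > 0" using delta_repr by blast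
  define u where "u j = u' (a j)" for j
  have u: "\<delta> = (\<Sum>j<n. u j *s a j)"
    unfolding u_def u'(1) by (rule sum.reindex_bij_betw[OF a, symmetric])
  have upos: "u i > 0" if "i < n" for i using u'(2) ai that by (simp add: u_def)
  have n: "n > 0" using a simple_nonempty by (cases n) (auto simp: bij_betw_def)
  have unull: "(\<Sum>j<n. of_int (A i j) * u j) = 0" if "i < n" for i
    using row[OF that, of u] qi[OF that] q_delta unfolding u[symmetric] by simp
  have null: "\<exists>c. \<forall>i<n. v i = c * u i" if v: "\<forall>i<n. (\<Sum>j<n. of_int (A i j) * v j) = 0" for v :: "nat \<Rightarrow> real"
  proof -
    define x where "x = (\<Sum>j<n. v j *s a j)"
    have "q x (a i) = 0" if "i < n" for i using row[OF that, of v] v that by (simp add: x_def)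
    hence "q x x = 0" by (subst (2) x_def) (simp add: q_sum_right q_scale_right)
    moreover have "x \<in> span \<Phi>" unfolding x_def
      by (intro span_sum span_scale span_base simple_Phi ai) auto
    ultimately obtain r where r: "x = r *s \<delta>" using radical by blast
    have "(\<Sum>j<n. (v j - r * u j) *s a j) = x - r *s \<delta>"
      by (simp add: x_def u scale_sum_right scale_left_diff_distrib sum_subtractf)
    hence "(\<Sum>s\<in>simple. (\<lambda>j. v j - r * u j) (inv_into {..<n} a s) *s s) = 0"
      using reidx[of "\<lambda>j. v j - r * u j"] r by simp
    from simple_independent[OF this] have "v j - r * u j = 0" if "j < n" for j
      using ai[OF that] that a by (force simp: bij_betw_def)
    then show ?thesis by (intro exI[of _ r]) auto
  qed
  \<comment> \<open>Pairing x with \<delta> gives zero, and it is also a sum of the nonnegative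
    numbers q x (a i) with positive weights u i.\<close>
  have semi: "(\<Sum>j<n. of_int (A i j) * v j) = 0"
    if v: "\<forall>i<n. (\<Sum>j<n. of_int (A i j) * v j) \<ge> 0" and i: "i < n" for v :: "nat \<Rightarrow> real" and i
  proof -
    define x where "x = (\<Sum>j<n. v j *s a j)"
    have nn: "q x (a i) \<ge> 0" if "i < n" for i
    proof -
      have "(\<Sum>j<n. of_int (A i j) * v j) * q (a i) (a i) \<ge> 0"
        using v that qi[OF that] by (intro mult_nonneg_nonneg) auto
      then show ?thesis using row[OF that, of v] by (simp add: x_def)
    qed
    have "0 = q x \<delta>" by (simp add: q_delta_right)
    also have "\<dots> = (\<Sum>i<n. u i * q x (a i))" by (subst u) (simp add: q_sum_right q_scale_right)
    finally have "\<forall>i\<in>{..<n}. u i * q x (a i) = 0"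
      by (subst (asm) eq_commute, subst (asm) sum_nonneg_eq_0_iff) 
         (auto intro!: mult_nonneg_nonneg less_imp_le[OF upos] nn)
    hence "q x (a i) = 0" using upos i by force
    then show ?thesis using row[OF i, of v] qi[OF i] by (simp add: x_def)
  qed
  have indec: False if IJ: "I \<noteq> {}" "J \<noteq> {}" "I \<inter> J = {}" "I \<union> J = {..<n}" "\<forall>i\<in>I. \<forall>j\<in>J. A i j = 0" for I J
  proof -
    have "a ` I \<union> a ` J = simple" using IJ(4) a unfolding bij_betw_def by (metis image_Un)
    moreover have "q x y = 0" if xy: "x \<in> a ` I" "y \<in> a ` J" for x y
    proof -
      obtain i j where ij: "x = a i" "y = a j" "i \<in> I" "j \<in> J" using xy by blast
      moreover have "i < n" "j < n" using ij(3,4) IJ(4) by blast+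
      ultimately show ?thesis using IJ(5) zero[of i j] by simp
    qed
    ultimately show False using simple_connected[of "a ` I" "a ` J"] IJ by blast
  qed
  show ?thesis unfolding affine_gcm_def
  proof (intro conjI)
    show "\<forall>i<n. A i i = 2"
    proof (intro allI impI)
      fix i assume i: "i < n"
      have "2 * q (a i) (a i) = of_int (A i i) * q (a i) (a i)" by (rule A[OF i i])
      then show "A i i = 2" using qi[OF i] by simp
    qed
    show "\<forall>i<n. \<forall>j<n. i \<noteq> j \<longrightarrow> A i j \<le> 0"
    proof (intro allI impI)
      fix i j assume ij: "i < n" "j < n" "i \<noteq> j"
      have "q (a j) (a i) \<le> 0" using simple_obtuse[OF ai ai] ij inj by blast
      then have "of_int (A i j) * q (a i) (a i) \<le> 0" using A[OF ij(1,2)] by linarith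
      then show "A i j \<le> 0" using qi[OF ij(1)] by (simp add: mult_le_0_iff)
    qed
    show "\<forall>i<n. \<forall>j<n. (A i j = 0) = (A j i = 0)" using zero q_sym by metis
    show "\<nexists>I J. I \<noteq> {} \<and> J \<noteq> {} \<and> I \<inter> J = {} \<and> I \<union> J = {..<n} \<and> (\<forall>i\<in>I. \<forall>j\<in>J. A i j = 0)"
      using indec by blast
    show "\<exists>u::nat \<Rightarrow> real. (\<exists>i<n. u i \<noteq> 0) \<and> (\<forall>i<n. (\<Sum>j<n. of_int (A i j) * u j) = 0) \<and>
        (\<forall>v::nat \<Rightarrow> real. (\<forall>i<n. (\<Sum>j<n. of_int (A i j) * v j) = 0) \<longrightarrow> (\<exists>c. \<forall>i<n. v i = c * u i))"
      using upos[of 0] n unull null by (intro exI[of _ u]) force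
    show "\<exists>u::nat \<Rightarrow> real. (\<forall>i<n. u i > 0) \<and> (\<forall>i<n. (\<Sum>j<n. of_int (A i j) * u j) = 0)"
      using upos unull by blast
    show "\<forall>v::nat \<Rightarrow> real. (\<forall>i<n. (\<Sum>j<n. of_int (A i j) * v j) \<ge> 0) \<longrightarrow>
            (\<forall>i<n. (\<Sum>j<n. of_int (A i j) * v j) = 0)"
      using semi by blast
  qed
qed

end

section \<open>Lie algebras with an invariant form\<close>

context vector_space
begin

lemma span_image_sum:
  assumes "finite I" "x \<in> span (g ` I)"
  shows "\<exists>a. x = (\<Sum>i\<in>I. scale (a i) (g i))"
  using assms(2)
proof (induction rule: span_induct_alt)
  case base
  show ?case by (rule exI[of _ "\<lambda>_. 0"]) simp
next
  case (step c y z)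
  then obtain a j where a: "z = (\<Sum>i\<in>I. scale (a i) (g i))" and j: "j \<in> I" "y = g j" by blast
  have "(\<Sum>i\<in>I. scale (if i = j then c else 0) (g i)) = (\<Sum>i\<in>I. if i = j then scale c (g i) else 0)"
    by (intro sum.cong) auto
  also have "\<dots> = scale c y" using assms(1) j by simp
  finally have "scale c y + z = (\<Sum>i\<in>I. scale ((if i = j then c else 0) + a i) (g i))"
    unfolding a by (simp add: scale_left_distrib sum.distrib)
  then show ?case by (intro exI)
qed

lemma independent_family:
  assumes "finite I" "\<And>c. (\<Sum>i\<in>I. scale (c i) (t i)) = 0 \<Longrightarrow> \<forall>i\<in>I. c i = 0"
  shows "inj_on t I" "independent (t ` I)"
proof -
  show inj: "inj_on t I"
  proof (rule inj_onI, rule ccontr)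
    fix i j assume ij: "i \<in> I" "j \<in> I" "t i = t j" "i \<noteq> j"
    define c :: "_ \<Rightarrow> 'a" where "c k = (if k = i then 1 else 0) - (if k = j then 1 else 0)" for k
    have "(\<Sum>k\<in>I. scale (c k) (t k)) = (\<Sum>k\<in>I. (if k = i then t k else 0) - (if k = j then t k else 0))"
      by (intro sum.cong) (auto simp: c_def)
    also have "\<dots> = t i - t j" using ij assms(1) by (simp add: sum_subtractf)
    finally have "\<forall>k\<in>I. c k = 0" using ij(3) by (intro assms(2)) simp
    then show False using ij by (auto simp: c_def split: if_splits)
  qed
  show "independent (t ` I)"
  proof
    assume "dependent (t ` I)"
    then obtain u where u: "\<exists>v\<in>t ` I. u v \<noteq> 0" "(\<Sum>v\<in>t ` I. scale (u v) v) = 0"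
      using dependent_finite[of "t ` I"] assms(1) by auto
    have "(\<Sum>i\<in>I. scale (u (t i)) (t i)) = 0" using u(2) by (simp add: sum.reindex[OF inj])
    from assms(2)[OF this] u(1) show False by auto
  qed
qed

lemma span_Union_sum:
  assumes "\<And>k. subspace (V k)" "x \<in> span (\<Union>k. V k)"
  shows "\<exists>F y. finite F \<and> (\<forall>k. y k \<in> V k) \<and> x = (\<Sum>k\<in>F. y k)"
  using assms(2)
proof (induction rule: span_induct_alt)
  case base
  show ?case by (rule exI[of _ "{}"], rule exI[of _ "\<lambda>_. 0"]) (simp add: assms(1) subspace_0)
next
  case (step c v z)
  then obtain F y j where y: "finite F" "\<forall>k. y k \<in> V k" "z = (\<Sum>k\<in>F. y k)" and j: "v \<in> V j" by blast
  define y' where "y' k = (if k \<in> F then y k else 0) + (if k = j then scale c v else 0)" for k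
  have "\<forall>k. y' k \<in> V k"
    using y(2) j assms(1) by (auto simp: y'_def subspace_0 intro: subspace_add subspace_scale)
  moreover have "(\<Sum>k\<in>insert j F. y' k) = scale c v + z"
  proof -
    have "(\<Sum>k\<in>insert j F. if k \<in> F then y k else 0) = z"
      using y(1) unfolding y(3) by (subst sum.inter_restrict[symmetric]) (auto intro: sum.cong)
    then show ?thesis using y(1) by (simp add: y'_def sum.distrib add.commute)
  qed
  ultimately show ?case using y(1) by (metis finite_insert)
qed

end

locale lie_form = vector_space sc
  for sc :: "complex \<Rightarrow> 'a::ab_group_add \<Rightarrow> 'a" (infixr "*s" 75) +
  fixes E :: "'a set" and br :: "'a \<Rightarrow> 'a \<Rightarrow> 'a" and B :: "'a \<Rightarrow> 'a \<Rightarrow> complex"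
  assumes lie: "lie_algebra sc E br" and form: "good_form sc E br B"
begin

lemma E_subspace: "subspace E" using lie by (simp add: lie_algebra_def)

lemma E_0 [simp]: "0 \<in> E" using E_subspace by (rule subspace_0)
lemma E_add [simp]: "x \<in> E \<Longrightarrow> y \<in> E \<Longrightarrow> x + y \<in> E" using E_subspace by (rule subspace_add)
lemma E_diff [simp]: "x \<in> E \<Longrightarrow> y \<in> E \<Longrightarrow> x - y \<in> E" using E_subspace by (rule subspace_diff)
lemma E_neg [simp]: "x \<in> E \<Longrightarrow> - x \<in> E" using E_subspace by (rule subspace_neg)
lemma E_scale [simp]: "x \<in> E \<Longrightarrow> c *s x \<in> E" using E_subspace by (rule subspace_scale)
lemma E_sum [simp]: "(\<And>i. i \<in> I \<Longrightarrow> f i \<in> E) \<Longrightarrow> sum f I \<in> E" using E_subspace by (rule subspace_sum)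
lemma E_br [simp]: "x \<in> E \<Longrightarrow> y \<in> E \<Longrightarrow> br x y \<in> E" using lie by (simp add: lie_algebra_def)
lemma E_span: "S \<subseteq> E \<Longrightarrow> span S \<subseteq> E" using E_subspace by (simp add: span_minimal)

lemma br_add:
  assumes "x \<in> E" "y \<in> E" "z \<in> E"
  shows "br (x + y) z = br x z + br y z" "br z (x + y) = br z x + br z y"
  using lie assms by (auto simp: lie_algebra_def)

lemma br_scale:
  assumes "x \<in> E" "y \<in> E"
  shows "br (c *s x) y = c *s br x y" "br x (c *s y) = c *s br x y"
  using lie assms by (auto simp: lie_algebra_def)

lemma br_self: "x \<in> E \<Longrightarrow> br x x = 0" using lie by (simp add: lie_algebra_def)

lemma br_anti: assumes "x \<in> E" "y \<in> E" shows "br y x = - br x y"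
proof -
  have "0 = br (x + y) (x + y)" using assms by (simp add: br_self)
  also have "\<dots> = br x y + br y x" unfolding br_add(1)[OF assms E_add[OF assms]]
    using assms by (simp add: br_add(2) br_self)
  finally show ?thesis by (metis add_eq_0_iff)
qed

lemma br_zero [simp]: assumes "x \<in> E" shows "br 0 x = 0" "br x 0 = 0"
  using br_scale[of 0 x 0] br_scale[of x 0 0] assms by simp_all

lemma br_neg: assumes "x \<in> E" "y \<in> E" shows "br (- x) y = - br x y" "br x (- y) = - br x y"
  using br_scale[OF assms, of "- 1"] by simp_all

lemma br_sum:
  assumes "\<And>i. i \<in> I \<Longrightarrow> f i \<in> E" "z \<in> E"
  shows "br (\<Sum>i\<in>I. f i) z = (\<Sum>i\<in>I. br (f i) z)"
  using assms(1) by (induction I rule: infinite_finite_induct) (auto simp: br_add assms(2))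

lemma br_sum_right:
  assumes "\<And>i. i \<in> I \<Longrightarrow> f i \<in> E" "z \<in> E"
  shows "br z (\<Sum>i\<in>I. f i) = (\<Sum>i\<in>I. br z (f i))"
  using assms(1) by (induction I rule: infinite_finite_induct) (auto simp: br_add assms(2))

lemma jacobi:
  assumes "x \<in> E" "y \<in> E" "z \<in> E"
  shows "br x (br y z) = br (br x y) z + br y (br x z)"
proof -
  have "br x (br y z) + br y (br z x) + br z (br x y) = 0"
    using lie assms by (simp add: lie_algebra_def)
  moreover have "br y (br z x) = - br y (br x z)" using assms br_anti[of x z] by (simp add: br_neg)
  moreover have "br z (br x y) = - br (br x y) z" using assms by (intro br_anti) auto
  ultimately show ?thesis by (simp add: algebra_simps add_eq_0_iff)
qed

lemma B_sym: "x \<in> E \<Longrightarrow> y \<in> E \<Longrightarrow> B x y = B y x" using form by (simp add: good_form_def)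

lemma B_add:
  assumes "x \<in> E" "y \<in> E" "z \<in> E"
  shows "B (x + y) z = B x z + B y z" "B z (x + y) = B z x + B z y"
proof -
  show *: "B (x + y) z = B x z + B y z" using form assms unfolding good_form_def by blast
  then show "B z (x + y) = B z x + B z y" using assms B_sym[of z] by simp
qed

lemma B_scale:
  assumes "x \<in> E" "y \<in> E"
  shows "B (c *s x) y = c * B x y" "B x (c *s y) = c * B x y"
proof -
  show "B (c *s x) y = c * B x y" using form assms unfolding good_form_def by blast
  have "B (c *s y) x = c * B y x" using form assms unfolding good_form_def by blast
  then show "B x (c *s y) = c * B x y" using assms B_sym[of x] by simp
qed

lemma B_zero [simp]: assumes "x \<in> E" shows "B 0 x = 0" "B x 0 = 0"
  using B_scale[of 0 x 0] B_scale[of x 0 0] assms by simp_all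

lemma B_neg: assumes "x \<in> E" "y \<in> E" shows "B (- x) y = - B x y" "B x (- y) = - B x y"
  using B_scale[OF assms, of "- 1"] by simp_all

lemma B_diff:
  assumes "x \<in> E" "y \<in> E" "z \<in> E"
  shows "B (x - y) z = B x z - B y z" "B z (x - y) = B z x - B z y"
  using B_add[of x "- y" z] assms by (simp_all add: B_neg)

lemma B_sum:
  assumes "\<And>i. i \<in> I \<Longrightarrow> f i \<in> E" "z \<in> E"
  shows "B (\<Sum>i\<in>I. f i) z = (\<Sum>i\<in>I. B (f i) z)"
  using assms(1) by (induction I rule: infinite_finite_induct) (auto simp: B_add assms(2))

lemma B_sum_right:
  assumes "\<And>i. i \<in> I \<Longrightarrow> f i \<in> E" "z \<in> E"
  shows "B z (\<Sum>i\<in>I. f i) = (\<Sum>i\<in>I. B z (f i))"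
  using assms(1) by (induction I rule: infinite_finite_induct) (auto simp: B_add assms(2))

lemma B_invariant: "x \<in> E \<Longrightarrow> y \<in> E \<Longrightarrow> z \<in> E \<Longrightarrow> B (br x y) z = B x (br y z)"
  using form unfolding good_form_def by blast

lemma B_nondegenerate: "x \<in> E \<Longrightarrow> (\<And>y. y \<in> E \<Longrightarrow> B x y = 0) \<Longrightarrow> x = 0"
  using form unfolding good_form_def by blast

lemma B_span_zero:
  assumes "S \<subseteq> E" "x \<in> E" "\<And>y. y \<in> S \<Longrightarrow> B x y = 0" "y \<in> span S"
  shows "B x y = 0"
proof -
  have "y \<in> E \<and> B x y = 0" using assms(4)
  proof (induction rule: span_induct_alt)
    case base then show ?case using assms by simp
  next
    case (step c y z)
    then show ?case using assms by (auto simp: B_add B_scale subset_iff)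
  qed
  then show ?thesis by simp
qed

text \<open>Elimination as in Gram-Schmidt: choose a in \<open>F\<close> and b in \<open>W\<close>
  that pair, and project along a onto the vectors orthogonal to b. The projection kills a, so the
  images of the others generate a smaller space to which induction applies. Only \<open>F\<close>
  has to be finite.\<close>

lemma dual_pairs:
  assumes "finite F" "F \<subseteq> E" "W \<subseteq> E"
    and "\<And>x. x \<in> span F \<Longrightarrow> (\<And>y. y \<in> W \<Longrightarrow> B x y = 0) \<Longrightarrow> x = 0"
  shows "\<exists>(m::nat) u w. (\<forall>i<m. u i \<in> span F \<and> w i \<in> W) \<and> (\<forall>x\<in>span F. x = (\<Sum>i<m. B x (w i) *s u i))"
  using assms
proof (induction "card F" arbitrary: F rule: less_induct)
  case less
  show ?case
  proof (cases "F \<subseteq> {0}")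
    case True
    hence "span F \<subseteq> {0}" by (simp add: span_minimal subspace_single_0)
    then show ?thesis by (intro exI[of _ "0::nat"]) auto
  next
    case False
    then obtain a where a: "a \<in> F" "a \<noteq> 0" by blast
    have FE: "x \<in> E" if "x \<in> span F" for x using E_span[OF less.prems(2)] that by blast
    have aE: "a \<in> E" using a less.prems by blast
    obtain b where b: "b \<in> W" "B a b \<noteq> 0" using less.prems(4)[of a] a span_base by metis
    have bE: "b \<in> E" using b less.prems by blast
    define g where "g x = x - (B x b / B a b) *s a" for x
    define F' where "F' = g ` (F - {a})"
    have gadd: "g (c *s x + y) = c *s g x + g y" if "x \<in> E" "y \<in> E" for c x y
      using that bE by (simp add: g_def B_add B_scale algebra_simps add_divide_distrib)
    have ga: "g a = 0" using b by (simp add: g_def)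
    have gspan: "g x \<in> span F'" if "x \<in> span F" for x
    proof -
      have "x \<in> E \<and> g x \<in> span F'" using that
      proof (induction rule: span_induct_alt)
        case base
        show ?case using bE by (simp add: g_def span_zero)
      next
        case (step c x y)
        have "g x \<in> span F'" using step(1) ga by (cases "x = a") (auto simp: F'_def span_zero intro: span_base)
        then show ?case using step less.prems(2) by (auto simp: gadd subset_iff intro: span_add span_scale)
      qed
      then show ?thesis by simp
    qed
    have F'F: "F' \<subseteq> span F" using a by (auto simp: F'_def g_def intro: span_diff span_scale span_base)
    hence sF': "span F' \<subseteq> span F" by (simp add: span_minimal)
    have "card F' < card F"
      unfolding F'_def using a less.prems(1) by (metis card_Diff1_less card_image_le finite_Diff le_less_trans)
    moreover have "finite F'" using less.prems(1) by (simp add: F'_def)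
    moreover have "F' \<subseteq> E" using F'F FE by blast
    moreover have "\<And>x. x \<in> span F' \<Longrightarrow> (\<And>y. y \<in> W \<Longrightarrow> B x y = 0) \<Longrightarrow> x = 0"
      using less.prems(4) sF' by blast
    ultimately obtain m :: nat and u w where
      uw: "\<forall>i<m. u i \<in> span F' \<and> w i \<in> W" "\<forall>x\<in>span F'. x = (\<Sum>i<m. B x (w i) *s u i)"
      using less.hyps[of F'] less.prems(3) by blast
    have uE: "u i \<in> E" "w i \<in> E" "u i \<in> span F" if "i < m" for i
      using uw(1) that sF' FE less.prems(3) by blast+
    \<comment> \<open>The projected part of x is expanded by induction with coefficients B (g x) (w
      i). Rewriting these as B x (w i) leaves a correction proportional to B x b, and v is its
      coefficient vector.\<close>
    define v where "v = (1 / B a b) *s (a - (\<Sum>i<m. B a (w i) *s u i))"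
    have vF: "v \<in> span F" unfolding v_def
      using a uE by (intro span_scale span_diff span_sum) (auto intro: span_base)
    have rep: "x = (\<Sum>i<m. B x (w i) *s u i) + B x b *s v" if x: "x \<in> span F" for x
    proof -
      have xE: "x \<in> E" using FE x by simp
      have "g x = (\<Sum>i<m. B (g x) (w i) *s u i)" using uw(2) gspan x by blast
      also have "\<dots> = (\<Sum>i<m. (B x (w i) - (B x b / B a b) * B a (w i)) *s u i)"
        using xE aE uE by (intro sum.cong) (auto simp: g_def B_diff B_scale)
      also have "\<dots> = (\<Sum>i<m. B x (w i) *s u i) - (B x b / B a b) *s (\<Sum>i<m. B a (w i) *s u i)"
        by (simp add: scale_left_diff_distrib sum_subtractf scale_sum_right)
      finally have "x = (\<Sum>i<m. B x (w i) *s u i) + (B x b / B a b) *s (a - (\<Sum>i<m. B a (w i) *s u i))"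
        unfolding g_def by (simp add: algebra_simps)
      then show ?thesis by (simp add: v_def)
    qed
    show ?thesis
      by (rule exI[of _ "Suc m"], rule exI[of _ "u(m := v)"], rule exI[of _ "w(m := b)"])
         (use uw(1) uE vF b rep in \<open>auto simp: less_Suc_eq\<close>)
  qed
qed

lemma linear_map_span:
  assumes "subspace W" "S \<subseteq> E" "z \<in> E" "\<And>y. y \<in> S \<Longrightarrow> br z y \<in> W" "x \<in> span S"
  shows "br z x \<in> W"
proof -
  have "x \<in> E \<and> br z x \<in> W" using assms(5)
  proof (induction rule: span_induct_alt)
    case base then show ?case using assms by (simp add: subspace_0)
  next
    case (step c y x)
    then show ?case using assms by (auto simp: br_add br_scale subset_iff intro: subspace_add subspace_scale)
  qed
  then show ?thesis by simp
qed

lemma linear_map_span_left: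
  assumes "subspace W" "S \<subseteq> E" "z \<in> E" "\<And>y. y \<in> S \<Longrightarrow> br y z \<in> W" "x \<in> span S"
  shows "br x z \<in> W"
proof -
  have xE: "x \<in> E" using E_span assms by blast
  have "br z x \<in> W"
  proof (rule linear_map_span[OF assms(1-3) _ assms(5)])
    fix y assume y: "y \<in> S"
    then have "br z y = - br y z" using assms(2,3) by (intro br_anti) auto
    then show "br z y \<in> W" using assms(4)[OF y] subspace_neg[OF assms(1)] by simp
  qed
  then show ?thesis using br_anti[OF assms(3) xE] assms(1) subspace_neg by metis
qed

lemma gen_subalgebra_subalgebra:
  assumes "X \<subseteq> E"
  shows "lie_subalgebra sc E br (gen_subalgebra sc E br X)"
proof -
  have "lie_subalgebra sc E br E" using E_subspace by (simp add: lie_subalgebra_def)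
  hence "gen_subalgebra sc E br X \<subseteq> E" using assms by (auto simp: gen_subalgebra_def)
  then show ?thesis unfolding lie_subalgebra_def gen_subalgebra_def
    by (auto intro!: subspace_Inter simp: lie_subalgebra_def)
qed

lemma gen_subalgebra_minimal:
  "lie_subalgebra sc E br S \<Longrightarrow> X \<subseteq> S \<Longrightarrow> gen_subalgebra sc E br X \<subseteq> S"
  by (auto simp: gen_subalgebra_def)

lemma gen_subalgebra_superset: "X \<subseteq> gen_subalgebra sc E br X"
  by (auto simp: gen_subalgebra_def)

lemma subalgebra_lie_algebra: assumes "lie_subalgebra sc E br L" shows "lie_algebra sc L br"
  using lie assms unfolding lie_algebra_def lie_subalgebra_def by (auto simp: subset_iff)

text \<open>Applying ad d minus a kills the component of degree a and multiplies the one of degree k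
  by k - a, which is invertible for the remaining degrees.\<close>

lemma eigen_components:
  assumes "subspace I" "\<And>x. x \<in> I \<Longrightarrow> br d x \<in> I" "d \<in> E"
    and "finite F" "\<And>k. k \<in> F \<Longrightarrow> y k \<in> E \<and> br d (y k) = of_int k *s y k" "(\<Sum>k\<in>F. y k) \<in> I"
  shows "\<forall>k\<in>F. y k \<in> I"
  using assms(4-6)
proof (induction F arbitrary: y rule: finite_induct)
  case empty
  then show ?case by simp
next
  case (insert a F)
  let ?x = "\<Sum>k\<in>insert a F. y k"
  have "br d ?x - of_int a *s ?x = (\<Sum>k\<in>insert a F. of_int k *s y k) - (\<Sum>k\<in>insert a F. of_int a *s y k)"
    using insert.prems(1) assms(3)
    by (subst br_sum_right) (auto simp: scale_sum_right simp del: sum.insert intro!: sum.cong)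
  also have "\<dots> = (\<Sum>k\<in>insert a F. of_int (k - a) *s y k)"
    by (simp add: scale_left_diff_distrib sum_subtractf del: sum.insert)
  also have "\<dots> = (\<Sum>k\<in>F. of_int (k - a) *s y k)" using insert.hyps by simp
  finally have *: "(\<Sum>k\<in>F. of_int (k - a) *s y k) \<in> I"
    using insert.prems(2) assms(1,2) by (metis subspace_diff subspace_scale)
  have "\<forall>k\<in>F. of_int (k - a) *s y k \<in> I"
  proof (rule insert.IH[OF _ *])
    fix k assume "k \<in> F"
    then show "of_int (k - a) *s y k \<in> E \<and>
         br d (of_int (k - a) *s y k) = of_int k *s of_int (k - a) *s y k"
      using insert.prems(1)[of k] assms(3) by (simp add: br_scale mult.commute)
  qed
  hence F: "\<forall>k\<in>F. y k \<in> I"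
  proof (intro ballI)
    fix k assume k: "k \<in> F" and "\<forall>k\<in>F. of_int (k - a) *s y k \<in> I"
    hence "(1 / of_int (k - a)) *s of_int (k - a) *s y k \<in> I" using assms(1) subspace_scale by blast
    moreover have "k \<noteq> a" using k insert.hyps by blast
    ultimately show "y k \<in> I" by simp
  qed
  have "(\<Sum>k\<in>F. y k) \<in> I" using F by (intro subspace_sum[OF assms(1)]) blast
  with insert.prems(2) have "?x - (\<Sum>k\<in>F. y k) \<in> I" by (rule subspace_diff[OF assms(1)])
  moreover have "?x - (\<Sum>k\<in>F. y k) = y a" using insert.hyps by simp
  ultimately have "y a \<in> I" by simp
  with F show ?case by blast
qed

end

section \<open>Nondegeneracy on algebras with Chevalley generators\<close>

text \<open>Right-nested brackets; their spans turn out to exhaust the positive and the negative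
  part. The value 0 on the empty list lets the weight formulas hold for every list.\<close>

fun monom :: "('a::zero \<Rightarrow> 'a \<Rightarrow> 'a) \<Rightarrow> (nat \<Rightarrow> 'a) \<Rightarrow> nat list \<Rightarrow> 'a" where
  "monom br g [] = 0"
| "monom br g [i] = g i"
| "monom br g (i # j # is) = br (g i) (monom br g (j # is))"

lemma monom_Cons: "is \<noteq> [] \<Longrightarrow> monom br g (i # is) = br (g i) (monom br g is)"
  by (cases "is") auto

text \<open>Also used with scalar values: with (t i, t i) in place of t i it computes 2 (\<rho>,
  \<beta>) for the weight \<beta> of the list, since 2 (\<rho>, \<alpha>) = (\<alpha>, \<alpha>) for
  simple \<alpha>.\<close>

definition list_wt :: "(nat \<Rightarrow> 'a::comm_monoid_add) \<Rightarrow> nat list \<Rightarrow> 'a" where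
  "list_wt t is = sum_list (map t is)"

lemma list_wt_simps [simp]: "list_wt t [] = 0" "list_wt t (i # is) = t i + list_wt t is"
  by (simp_all add: list_wt_def)

lemma list_wt_mset: "mset is = mset js \<Longrightarrow> list_wt t is = list_wt t js"
  unfolding list_wt_def by (metis mset_map sum_mset_sum_list)

lemma list_wt_count:
  assumes "set is \<subseteq> {..<n}" "vector_space sc"
  shows "list_wt t is = (\<Sum>i<n. sc (of_nat (count_list is i) :: complex) (t i))"
  using assms(1)
proof (induction "is")
  case Nil
  interpret vector_space sc by (rule assms(2))
  show ?case by simp
next
  case (Cons j "is")
  interpret vector_space sc by (rule assms(2))
  have "(\<Sum>i<n. sc (of_nat (count_list (j # is) i)) (t i)) =
      (\<Sum>i<n. (if i = j then t i else 0) + sc (of_nat (count_list is i)) (t i))"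
    by (intro sum.cong) (auto simp: scale_left_distrib)
  also have "\<dots> = t j + (\<Sum>i<n. sc (of_nat (count_list is i)) (t i))"
    using Cons.prems by (simp add: sum.distrib)
  finally show ?case using Cons by simp
qed

text \<open>Nonisotropic weights are assumed nondegenerate (\<open>real_e\<close>, \<open>real_f\<close>); \<open>imag\<close> says that
  \<open>2 (\<rho>, \<sigma>)\<close> does not vanish for isotropic weights \<open>\<sigma>\<close>.\<close>
locale chevalley = lie_form sc E br B
  for sc :: "complex \<Rightarrow> 'a::ab_group_add \<Rightarrow> 'a" (infixr "*s" 75) and E br B +
  fixes K :: "'a set" and n :: nat and e f t :: "nat \<Rightarrow> 'a" and s :: "nat \<Rightarrow> complex" and d :: 'a
  assumes K_subspace: "subspace K" and K_E: "K \<subseteq> E"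
    and K_abelian: "h \<in> K \<Longrightarrow> h' \<in> K \<Longrightarrow> br h h' = 0"
    and K_nondeg: "h \<in> K \<Longrightarrow> (\<And>h'. h' \<in> K \<Longrightarrow> B h h' = 0) \<Longrightarrow> h = 0"
    and e_E: "i < n \<Longrightarrow> e i \<in> E" and f_E: "i < n \<Longrightarrow> f i \<in> E" and t_K: "i < n \<Longrightarrow> t i \<in> K"
    and K_e: "h \<in> K \<Longrightarrow> i < n \<Longrightarrow> br h (e i) = B h (t i) *s e i"
    and K_f: "h \<in> K \<Longrightarrow> i < n \<Longrightarrow> br h (f i) = (- B h (t i)) *s f i"
    and e_f: "i < n \<Longrightarrow> j < n \<Longrightarrow> br (e i) (f j) = (if i = j then s i *s t i else 0)"
    and s_nz: "i < n \<Longrightarrow> s i \<noteq> 0"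
    and d_K: "d \<in> K" and d_t: "i < n \<Longrightarrow> B d (t i) = 1"
    and wt_inj: "set is \<subseteq> {..<n} \<Longrightarrow> set js \<subseteq> {..<n} \<Longrightarrow> list_wt t is = list_wt t js \<Longrightarrow> mset is = mset js"
    and real_e: "set is \<subseteq> {..<n} \<Longrightarrow> B (list_wt t is) (list_wt t is) \<noteq> 0 \<Longrightarrow>
       x \<in> span {monom br e js |js. mset js = mset is} \<Longrightarrow>
       (\<And>y. y \<in> gen_subalgebra sc E br (e ` {..<n} \<union> f ` {..<n}) \<Longrightarrow> B x y = 0) \<Longrightarrow> x = 0"
    and real_f: "set is \<subseteq> {..<n} \<Longrightarrow> B (list_wt t is) (list_wt t is) \<noteq> 0 \<Longrightarrow>
       x \<in> span {monom br f js |js. mset js = mset is} \<Longrightarrow>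
       (\<And>y. y \<in> gen_subalgebra sc E br (e ` {..<n} \<union> f ` {..<n}) \<Longrightarrow> B x y = 0) \<Longrightarrow> x = 0"
    and imag: "set is \<subseteq> {..<n} \<Longrightarrow> is \<noteq> [] \<Longrightarrow> B (list_wt t is) (list_wt t is) = 0 \<Longrightarrow>
       list_wt (\<lambda>i. B (t i) (t i)) is \<noteq> 0"
begin

abbreviation wt where "wt \<equiv> list_wt t"
abbreviation L where "L k \<equiv> {is. length is = k \<and> set is \<subseteq> {..<n}}"
definition ns where "ns g k = span (monom br g ` L k)"

lemma KE [simp]: "h \<in> K \<Longrightarrow> h \<in> E" using K_E by blast
lemma eE [simp]: "i < n \<Longrightarrow> e i \<in> E" "i < n \<Longrightarrow> f i \<in> E" "i < n \<Longrightarrow> t i \<in> K" by (simp_all add: e_E f_E t_K)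
lemma dE [simp]: "d \<in> E" using d_K by simp

lemma K_closed: "0 \<in> K" "x \<in> K \<Longrightarrow> y \<in> K \<Longrightarrow> x + y \<in> K" "x \<in> K \<Longrightarrow> c *s x \<in> K" "x \<in> K \<Longrightarrow> - x \<in> K"
  using K_subspace by (auto intro: subspace_0 subspace_add subspace_scale subspace_neg)

lemma finite_L: "finite (L k)"
  using finite_lists_length_eq[of "{..<n}" k] by (simp add: conj_commute)

lemma wt_K: "set is \<subseteq> {..<n} \<Longrightarrow> wt is \<in> K"
  by (induction "is") (auto simp: K_closed)

lemma wt_E [simp]: "set is \<subseteq> {..<n} \<Longrightarrow> wt is \<in> E"
  by (simp add: wt_K)

lemma monom_E: "set is \<subseteq> {..<n} \<Longrightarrow> monom br e is \<in> E \<and> monom br f is \<in> E"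
  by (induction "is" rule: induct_list012) auto

lemma monom_weight:
  "h \<in> K \<Longrightarrow> set is \<subseteq> {..<n} \<Longrightarrow> br h (monom br e is) = B h (wt is) *s monom br e is"
proof (induction "is" rule: induct_list012)
  case (3 i j "is")
  let ?m = "monom br e (j # is)"
  have [simp]: "?m \<in> E" using 3(4) monom_E[of "j # is"] by auto
  have "br h (br (e i) ?m) = br (br h (e i)) ?m + br (e i) (br h ?m)"
    using 3 by (intro jacobi) auto
  also have "\<dots> = (B h (t i) + B h (wt (j # is))) *s br (e i) ?m"
    using 3 by (simp add: K_e br_scale scale_left_distrib)
  also have "B h (t i) + B h (wt (j # is)) = B h (wt (i # j # is))" using 3 by (simp add: B_add)
  finally show ?case by simp
qed (auto simp: K_e)

text \<open>The symmetry of the Chevalley involution. It turns each statement about the positive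
  half into its mirror image; the scalars s stay the same because the sign of [f, e] is absorbed by
  -t.\<close>

lemma swap: "chevalley sc E br B K n f e (\<lambda>i. - t i) s (- d)"
proof -
  have wn: "list_wt (\<lambda>i. - t i) is = - wt is" for "is" by (induction "is") auto
  have Bn: "B (- wt is) (- wt is) = B (wt is) (wt is)" if "set is \<subseteq> {..<n}" for "is"
    using that by (simp add: B_neg)
  have ci: "list_wt (\<lambda>i. B (- t i) (- t i)) is = list_wt (\<lambda>i. B (t i) (t i)) is" if "set is \<subseteq> {..<n}" for "is"
    using that by (induction "is") (auto simp: B_neg)
  show ?thesis
  proof (unfold_locales, goal_cases)
    case (10 i j)
    then show ?case using e_f[of j i] br_anti[of "e j" "f i"] by auto
  next
    case (14 "is" js) then show ?case using wt_inj[of "is" js] by (simp add: wn)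
  next
    case (15 "is" x)
    show ?case
    proof (rule real_f[OF 15(1) _ 15(3)])
      show "B (wt is) (wt is) \<noteq> 0" using 15(1,2) by (simp add: wn Bn)
      fix y assume "y \<in> gen_subalgebra sc E br (e ` {..<n} \<union> f ` {..<n})"
      then show "B x y = 0" by (intro 15(4)) (simp only: Un_commute)
    qed
  next
    case (16 "is" x)
    show ?case
    proof (rule real_e[OF 16(1) _ 16(3)])
      show "B (wt is) (wt is) \<noteq> 0" using 16(1,2) by (simp add: wn Bn)
      fix y assume "y \<in> gen_subalgebra sc E br (e ` {..<n} \<union> f ` {..<n})"
      then show "B x y = 0" by (intro 16(4)) (simp only: Un_commute)
    qed
  next
    case (17 "is") then show ?case using imag[of "is"] by (simp add: wn Bn ci)
  qed (auto simp: K_subspace K_E K_abelian K_e K_f s_nz d_K d_t K_closed B_neg intro: K_nondeg)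
qed

section \<open>The grading by height\<close>

definition gr :: "int \<Rightarrow> 'a set" where
  "gr k = (if k > 0 then ns e (nat k) else if k < 0 then ns f (nat (- k)) else K)"

lemma ns_subspace: "subspace (ns g k)" by (simp add: ns_def subspace_span)
lemma gr_subspace: "subspace (gr k)" by (simp add: gr_def ns_subspace K_subspace)

lemma ns_E: "x \<in> ns e k \<Longrightarrow> x \<in> E" "x \<in> ns f k \<Longrightarrow> x \<in> E"
  using E_span[of "monom br e ` L k"] E_span[of "monom br f ` L k"] monom_E by (auto simp: ns_def)

lemma gr_E [simp]: "x \<in> gr k \<Longrightarrow> x \<in> E"
  by (auto simp: gr_def ns_E split: if_splits)

lemma monom_ns: "set is \<subseteq> {..<n} \<Longrightarrow> length is = k \<Longrightarrow> monom br g is \<in> ns g k"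
  by (auto simp: ns_def intro!: span_base)

lemma monomL_E: "monom br e ` L k \<subseteq> E" "monom br f ` L k \<subseteq> E" using monom_E by auto

lemma e_ns: assumes "i < n" "x \<in> ns e k" "k > 0" shows "br (e i) x \<in> ns e (Suc k)"
proof (rule linear_map_span[OF ns_subspace monomL_E(1) _ _ assms(2)[unfolded ns_def]])
  fix y assume "y \<in> monom br e ` L k"
  then obtain "is" where i: "y = monom br e is" "is \<in> L k" by blast
  hence "is \<noteq> []" using assms by auto
  hence "br (e i) y = monom br e (i # is)" using i by (simp add: monom_Cons)
  then show "br (e i) y \<in> ns e (Suc k)" using i assms(1) by (auto intro!: monom_ns)
qed (use assms in auto)

lemma K_ns: assumes "h \<in> K" "x \<in> ns e k" shows "br h x \<in> ns e k"
proof (rule linear_map_span[OF ns_subspace monomL_E(1) _ _ assms(2)[unfolded ns_def]])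
  fix y assume "y \<in> monom br e ` L k"
  then show "br h y \<in> ns e k" using assms(1)
    by (auto simp: monom_weight intro!: subspace_scale ns_subspace monom_ns)
qed (use assms in auto)

text \<open>The Jacobi identity moves f i past the leading e j. The bracket of the two is in
  \<open>K\<close> and acts on the tail by a scalar, while the other term has f i acting on a
  shorter monomial.\<close>

lemma f_monom:
  assumes "i < n" "set is \<subseteq> {..<n}" "is \<noteq> []"
  shows "br (f i) (monom br e is) \<in> gr (int (length is) - 1)"
  using assms(2,3)
proof (induction "is")
  case (Cons j "is")
  have fe: "br (f i) (e j) \<in> K"
    using Cons e_f[of j i] br_anti[of "e j" "f i"] assms(1) by (auto simp: K_closed)
  show ?case
  proof (cases "is = []")
    case True
    then show ?thesis using fe by (simp add: gr_def)
  next
    case False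
    let ?m = "monom br e is"
    have m: "?m \<in> E" "?m \<in> ns e (length is)" using Cons monom_E monom_ns by auto
    have IH: "br (f i) ?m \<in> gr (int (length is) - 1)" using Cons False by auto
    have eq: "br (f i) (monom br e (j # is)) = br (br (f i) (e j)) ?m + br (e j) (br (f i) ?m)"
      unfolding monom_Cons[OF False] using Cons m assms(1) by (intro jacobi) auto
    have "br (br (f i) (e j)) ?m \<in> ns e (length is)" using K_ns fe m by blast
    moreover have "br (e j) (br (f i) ?m) \<in> ns e (length is)"
    \<comment> \<open>For a tail of length one, [f i, tail] has degree 0 and lies in
      \<open>K\<close>, where \<open>e_ns\<close> does not apply.\<close>
    proof (cases "length is = 1")
      case True
      hence "br (f i) ?m \<in> K" using IH by (simp add: gr_def)
      hence "br (e j) (br (f i) ?m) = - (B (br (f i) ?m) (t j) *s e j)"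
        using Cons br_anti[of "br (f i) ?m" "e j"] by (simp add: K_e)
      moreover have "e j \<in> ns e 1" using monom_ns[of "[j]" 1 e] Cons by simp
      ultimately show ?thesis using True ns_subspace by (metis subspace_neg subspace_scale)
    next
      case c: False
      hence 2: "length is \<ge> 2" using False by (cases "length is") auto
      hence "br (f i) ?m \<in> ns e (length is - 1)" using IH by (simp add: gr_def nat_diff_distrib)
      then show ?thesis using e_ns[of j "br (f i) ?m" "length is - 1"] Cons.prems 2
        by (cases "length is") auto
    qed
    ultimately have "br (f i) (monom br e (j # is)) \<in> ns e (length is)"
      unfolding eq using ns_subspace by (rule subspace_add[rotated])
    then show ?thesis using False by (simp add: gr_def)
  qed
qed simp

lemma f_ns: assumes "i < n" "x \<in> ns e k" "k > 0" shows "br (f i) x \<in> gr (int k - 1)"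
proof (rule linear_map_span[OF gr_subspace monomL_E(1) _ _ assms(2)[unfolded ns_def]])
  fix y assume "y \<in> monom br e ` L k"
  then show "br (f i) y \<in> gr (int k - 1)" using f_monom assms by fastforce
qed (use assms in auto)

end

context chevalley
begin

interpretation sw: chevalley sc E br B K n f e "\<lambda>i. - t i" s "- d" by (rule swap)

lemma sw_gr: "sw.gr k = gr (- k)"
  by (cases "k > 0"; cases "k < 0"; simp add: gr_def sw.gr_def)

lemma e_gr: assumes "i < n" "x \<in> gr k" shows "br (e i) x \<in> gr (k + 1)"
proof -
  consider "k > 0" | "k = 0" | "k < 0" by linarith
  then show ?thesis
  proof cases
    case 1
    have "nat (k + 1) = Suc (nat k)" using 1 by simp
    then show ?thesis using e_ns[of i x "nat k"] assms 1 by (simp add: gr_def)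
  next
    case 2
    hence x: "x \<in> K" using assms by (simp add: gr_def)
    hence "br (e i) x = (- B x (t i)) *s e i" using br_anti[of x "e i"] assms by (simp add: K_e)
    moreover have "e i \<in> ns e 1" using monom_ns[of "[i]" 1 e] assms by simp
    ultimately show ?thesis using 2 ns_subspace by (simp add: gr_def subspace_neg subspace_scale)
  next
    case 3
    have "br (e i) x \<in> gr (- (int (nat (- k)) - 1))"
      using sw.f_ns[of i x "nat (- k)"] assms 3 by (simp add: gr_def[of k] sw_gr)
    then show ?thesis using 3 by (simp add: add.commute)
  qed
qed

lemma K_gr: assumes "h \<in> K" "x \<in> gr k" shows "br h x \<in> gr k"
proof -
  consider "k > 0" | "k = 0" | "k < 0" by linarith
  then show ?thesis
  proof cases
    case 1 then show ?thesis using assms K_ns[of h x "nat k"] by (simp add: gr_def)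
  next
    case 2 then show ?thesis using assms K_abelian[of h x] K_closed(1) by (simp add: gr_def)
  next
    case 3 then show ?thesis using assms sw.K_ns[of h x "nat (- k)"] by (simp add: gr_def)
  qed
qed

text \<open>The adjoint action of a nested bracket is a commutator of ad e i with the adjoint action
  of the tail. The tail is also applied to [e i, x], hence the induction over all x and k.\<close>

lemma monom_gr:
  assumes "set is \<subseteq> {..<n}" "is \<noteq> []" "x \<in> gr k"
  shows "br (monom br e is) x \<in> gr (k + int (length is))"
  using assms
proof (induction "is" arbitrary: x k rule: induct_list012)
  case (2 i) then show ?case by (auto intro: e_gr)
next
  case (3 i j "is")
  let ?m = "monom br e (j # is)"
  have m: "?m \<in> E" using monom_E[of "j # is"] 3(3) by auto
  have x: "x \<in> E" using 3(5) by simp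
  have eq: "br (monom br e (i # j # is)) x = br (e i) (br ?m x) - br ?m (br (e i) x)"
    using 3(3) m x jacobi[of "e i" ?m x] by simp
  have "br (e i) (br ?m x) \<in> gr (k + int (length (j # is)) + 1)"
    using 3 by (intro e_gr) auto
  moreover have "br ?m (br (e i) x) \<in> gr (k + 1 + int (length (j # is)))"
    using 3(3,5) by (intro 3(2) e_gr) auto
  ultimately show ?case unfolding eq using subspace_diff[OF gr_subspace] by (simp add: add_ac)
qed auto

end

context chevalley
begin

interpretation sw: chevalley sc E br B K n f e "\<lambda>i. - t i" s "- d" by (rule swap)

lemma gr_br: assumes "x \<in> gr j" "y \<in> gr k" shows "br x y \<in> gr (j + k)"
proof -
  consider "j > 0" | "j = 0" | "j < 0" by linarith
  then show ?thesis
  proof cases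
    case 1
    show ?thesis
    proof (rule linear_map_span_left[OF gr_subspace monomL_E(1)])
      show "x \<in> span (monom br e ` L (nat j))" using assms(1) 1 by (simp add: gr_def ns_def)
      fix z assume "z \<in> monom br e ` L (nat j)"
      then obtain "is" where z: "z = monom br e is" "length is = nat j" "set is \<subseteq> {..<n}" by blast
      moreover have "is \<noteq> []" using z 1 by auto
      ultimately have "br z y \<in> gr (k + int (length is))" unfolding z(1) by (intro monom_gr assms)
      then show "br z y \<in> gr (j + k)" using z(2) 1 by (simp add: add.commute)
    qed (use assms in auto)
  next
    case 2
    then show ?thesis using K_gr assms by (simp add: gr_def)
  next
    case 3
    have "br x y \<in> sw.gr (- k + - j)"
    proof (rule linear_map_span_left[OF sw.gr_subspace monomL_E(2)])
      show "x \<in> span (monom br f ` L (nat (- j)))" using assms(1) 3 by (simp add: gr_def ns_def)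
      fix z assume "z \<in> monom br f ` L (nat (- j))"
      then obtain "is" where z: "z = monom br f is" "length is = nat (- j)" "set is \<subseteq> {..<n}" by blast
      have "y \<in> sw.gr (- k)" using assms(2) by (simp add: sw_gr)
      moreover have "is \<noteq> []" using z 3 by auto
      ultimately have "br z y \<in> sw.gr (- k + int (length is))" unfolding z(1) by (intro sw.monom_gr z)
      then show "br z y \<in> sw.gr (- k + - j)" using z(2) 3 by simp
    qed (use assms in auto)
    then show ?thesis by (simp add: sw_gr add.commute)
  qed
qed

end

section \<open>The truncated Casimir operator\<close>

context chevalley
begin

text \<open>By invariance both sides pair equally with every h in \<open>K\<close>, and
  \<open>K\<close> is nondegenerate. The minus sign comes from the order: z carries the weight
  \<tau>, but stands second in the bracket.\<close>

lemma br_pair: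
  assumes "w \<in> E" "z \<in> E" "\<tau> \<in> K" "\<And>h. h \<in> K \<Longrightarrow> br h z = B h \<tau> *s z" "br w z \<in> K"
  shows "br w z = (- B w z) *s \<tau>"
proof -
  have "br w z + B w z *s \<tau> = 0"
  proof (rule K_nondeg)
    show "br w z + B w z *s \<tau> \<in> K" using assms by (simp add: K_closed)
    fix h assume h: "h \<in> K"
    have "B (br w z) h = B w (br z h)" using assms h by (simp add: B_invariant)
    also have "br z h = - (B h \<tau> *s z)" using assms(4)[OF h] br_anti[of h z] assms(2) h by simp
    also have "B w \<dots> = - (B h \<tau> * B w z)" using assms(1,2) by (simp add: B_neg B_scale)
    finally show "B (br w z + B w z *s \<tau>) h = 0"
      using assms h B_sym[of h \<tau>] by (simp add: B_add B_scale)
  qed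
  then show ?thesis by (simp add: eq_neg_iff_add_eq_0)
qed

lemma gr_ns: "k > 0 \<Longrightarrow> gr (int k) = ns e k" "k > 0 \<Longrightarrow> gr (- int k) = ns f k"
  by (simp_all add: gr_def)

lemma gr_zero: "gr 0 = K" by (simp add: gr_def)

text \<open>The first summand is 2 (\<rho>, \<beta>) and the second is (\<beta>, \<beta>), so the
  value depends only on the multiset of the list. On a one-element list it is 0, matching the empty
  Casimir sum in degree 1.\<close>

definition cas where
  "cas is = list_wt (\<lambda>i. B (t i) (t i)) is - B (wt is) (wt is)"

text \<open>The part of the Casimir operator below degree \<open>k\<close> acts on degree \<open>k\<close> by the scalar
  \<open>2 (\<rho>, \<beta>) - (\<beta>, \<beta>)\<close>; in the recursion over \<open>br (e j) z\<close> all terms telescope except those of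
  lowest and highest degree.\<close>
lemma partial_casimir:
  fixes u w :: "nat \<Rightarrow> nat \<Rightarrow> 'a" and m :: "nat \<Rightarrow> nat"
  assumes u: "\<And>l i. 0 < l \<Longrightarrow> l < k \<Longrightarrow> i < m l \<Longrightarrow> u l i \<in> ns e l"
    and w: "\<And>l i. 0 < l \<Longrightarrow> l < k \<Longrightarrow> i < m l \<Longrightarrow> w l i \<in> ns f l"
    and dual_e: "\<And>l x. 0 < l \<Longrightarrow> l < k \<Longrightarrow> x \<in> ns e l \<Longrightarrow> (\<Sum>i<m l. B x (w l i) *s u l i) = x"
    and dual_f: "\<And>l y. 0 < l \<Longrightarrow> l < k \<Longrightarrow> y \<in> ns f l \<Longrightarrow> (\<Sum>i<m l. B (u l i) y *s w l i) = y"
    and "is \<noteq> []" "set is \<subseteq> {..<n}" "length is \<le> k"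
  shows "(\<Sum>l\<in>{1..<length is}. \<Sum>i<m l. br (u l i) (br (w l i) (monom br e is))) = cas is *s monom br e is"
  using assms(5-7)
proof (induction "is")
  case Nil then show ?case by simp
next
  case (Cons j "is")
  show ?case
  proof (cases "is = []")
    case True
    then show ?thesis using Cons.prems by (simp add: cas_def)
  next
    case ne: False
    define r where "r = length is"
    define z where "z = monom br e is"
    define \<tau> where "\<tau> = wt is"
    define y where "y = br (e j) z"
    have r: "0 < r" "r < k" and j: "j < n" and iss: "set is \<subseteq> {..<n}"
      using Cons.prems ne by (auto simp: r_def)
    have y: "monom br e (j # is) = y" using ne by (simp add: y_def z_def monom_Cons)
    have zE [simp]: "z \<in> E" using monom_E iss by (simp add: z_def)
    have eE' [simp]: "e j \<in> E" "t j \<in> E" "t j \<in> K" using j by auto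
    have \<tau>K [simp]: "\<tau> \<in> K" "\<tau> \<in> E" using wt_K[OF iss] by (auto simp: \<tau>_def)
    have yE [simp]: "y \<in> E" by (simp add: y_def)
    have zw: "br h z = B h \<tau> *s z" if "h \<in> K" for h
      using monom_weight[OF that iss] by (simp add: z_def \<tau>_def)
    have yw: "br h y = B h (t j + \<tau>) *s y" if "h \<in> K" for h
      using monom_weight[of h "j # is"] that Cons.prems unfolding y by (simp add: \<tau>_def)
    have zr: "z \<in> ns e r" unfolding z_def by (rule monom_ns) (auto simp: r_def iss)
    have uE [simp]: "u l i \<in> E" if "0 < l" "l < k" "i < m l" for l i
      using u[OF that] ns_E by blast
    have wE [simp]: "w l i \<in> E" if "0 < l" "l < k" "i < m l" for l i
      using w[OF that] ns_E by blast
    \<comment> \<open>Two uses of the Jacobi identity move e j out of u (w [e j, z]): in X it is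
      caught by w, in Y by u, and in Z it gets to the front, where the induction hypothesis
      applies.\<close>
    define X where "X l = (\<Sum>i<m l. br (u l i) (br (br (w l i) (e j)) z))" for l
    define Y where "Y l = (\<Sum>i<m l. br (br (u l i) (e j)) (br (w l i) z))" for l
    define Z where "Z l = (\<Sum>i<m l. br (e j) (br (u l i) (br (w l i) z)))" for l
    have split: "(\<Sum>i<m l. br (u l i) (br (w l i) y)) = X l + Y l + Z l" if l: "0 < l" "l < k" for l
    proof -
      have "br (u l i) (br (w l i) y) = br (u l i) (br (br (w l i) (e j)) z) +
          br (br (u l i) (e j)) (br (w l i) z) + br (e j) (br (u l i) (br (w l i) z))" if i: "i < m l" for i
      proof -
        have "br (w l i) y = br (br (w l i) (e j)) z + br (e j) (br (w l i) z)"
          unfolding y_def using l i by (intro jacobi) auto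
        moreover have "br (u l i) (br (e j) (br (w l i) z)) =
          br (br (u l i) (e j)) (br (w l i) z) + br (e j) (br (u l i) (br (w l i) z))"
          using l i by (intro jacobi) auto
        ultimately show ?thesis using l i by (simp add: br_add add.assoc)
      qed
      then show ?thesis by (simp add: X_def Y_def Z_def sum.distrib)
    qed
    \<comment> \<open>Lowest degree: here [w, e j] lies in \<open>K\<close>, so it acts on z by a
      scalar and duality in degree 1 reassembles e j.\<close>
    have X1: "X 1 = (- B (t j) \<tau>) *s y"
    proof -
      have l: "0 < (1::nat)" "1 < k" using r by auto
      have ej: "e j \<in> ns e 1" using monom_ns[of "[j]" 1 e] j by simp
      have "br (u 1 i) (br (br (w 1 i) (e j)) z) = (- B (t j) \<tau>) *s br (B (e j) (w 1 i) *s u 1 i) z" if i: "i < m 1" for i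
      proof -
        have "br (w 1 i) (e j) \<in> gr (- int 1 + int 1)"
          using w[OF l i] ej by (intro gr_br) (simp_all add: gr_ns(1)[of 1, simplified] gr_ns(2)[of 1, simplified])
        hence "br (w 1 i) (e j) = (- B (w 1 i) (e j)) *s t j"
          using l i j by (intro br_pair) (auto simp: gr_zero K_e)
        then show ?thesis using l i zw[of "t j"] B_sym[of "w 1 i" "e j"] by (simp add: br_scale br_neg mult.commute)
      qed
      hence "X 1 = (\<Sum>i<m 1. (- B (t j) \<tau>) *s br (B (e j) (w 1 i) *s u 1 i) z)"
        by (simp add: X_def)
      also have "\<dots> = (- B (t j) \<tau>) *s br (\<Sum>i<m 1. B (e j) (w 1 i) *s u 1 i) z"
        unfolding scale_sum_right[symmetric] using l by (subst br_sum) auto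
      also have "(\<Sum>i<m 1. B (e j) (w 1 i) *s u 1 i) = e j" using dual_e[OF l ej] .
      finally show ?thesis by (simp add: y_def)
    qed
    \<comment> \<open>By invariance, expanding [w, e j] for w of degree -(l+1) in the dual basis of
      degree -l and expanding [e j, u] for u of degree l in the basis of degree l+1 use the same
      coefficients. Exchanging the sums turns X (l+1) into -Y l.\<close>
    have XY: "X (Suc l) = - Y l" if l: "0 < l" "Suc l < k" for l
    proof -
      have l': "l < k" "0 < Suc l" using l by auto
      have inner: "br (w (Suc l) i) (e j) = (\<Sum>a<m l. B (w (Suc l) i) (br (e j) (u l a)) *s w l a)" if i: "i < m (Suc l)" for i
      proof -
        have ej: "e j \<in> gr (int 1)" using monom_ns[of "[j]" 1 e] j by (simp add: gr_def)
        have "w (Suc l) i \<in> gr (- int (Suc l))" using w[OF l'(2) l(2) i] gr_ns(2)[of "Suc l"] by simp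
        from gr_br[OF this ej] have "br (w (Suc l) i) (e j) \<in> gr (- int l)" by simp
        hence "br (w (Suc l) i) (e j) \<in> ns f l" using l gr_ns(2) by simp
        from dual_f[OF l(1) l'(1) this] have "br (w (Suc l) i) (e j) = (\<Sum>a<m l. B (u l a) (br (w (Suc l) i) (e j)) *s w l a)" by simp
        also have "\<dots> = (\<Sum>a<m l. B (w (Suc l) i) (br (e j) (u l a)) *s w l a)"
        proof (rule sum.cong[OF refl])
          fix a assume a: "a \<in> {..<m l}"
          have "B (u l a) (br (w (Suc l) i) (e j)) = B (br (w (Suc l) i) (e j)) (u l a)"
            using l l' i a by (intro B_sym) auto
          also have "\<dots> = B (w (Suc l) i) (br (e j) (u l a))"
            using l l' i a by (intro B_invariant) auto
          finally show "B (u l a) (br (w (Suc l) i) (e j)) *s w l a = B (w (Suc l) i) (br (e j) (u l a)) *s w l a" by simp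
        qed
        finally show ?thesis .
      qed
      have "X (Suc l) = (\<Sum>i<m (Suc l). \<Sum>a<m l. br (B (br (e j) (u l a)) (w (Suc l) i) *s u (Suc l) i) (br (w l a) z))"
        unfolding X_def
      proof (rule sum.cong[OF refl])
        fix i assume "i \<in> {..<m (Suc l)}"
        hence i: "i < m (Suc l)" by simp
        have "br (br (w (Suc l) i) (e j)) z = (\<Sum>a<m l. B (w (Suc l) i) (br (e j) (u l a)) *s br (w l a) z)"
          unfolding inner[OF i] using l l' i by (subst br_sum) (auto simp: br_scale intro!: sum.cong)
        hence "br (u (Suc l) i) (br (br (w (Suc l) i) (e j)) z) =
          (\<Sum>a<m l. B (w (Suc l) i) (br (e j) (u l a)) *s br (u (Suc l) i) (br (w l a) z))"
          using l l' i by (simp only:) (subst br_sum_right, auto simp: br_scale intro!: sum.cong)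
        also have "\<dots> = (\<Sum>a<m l. br (B (br (e j) (u l a)) (w (Suc l) i) *s u (Suc l) i) (br (w l a) z))"
          using l l' i by (intro sum.cong refl) (simp add: br_scale B_sym[of "w (Suc l) i"])
        finally show "br (u (Suc l) i) (br (br (w (Suc l) i) (e j)) z) =
          (\<Sum>a<m l. br (B (br (e j) (u l a)) (w (Suc l) i) *s u (Suc l) i) (br (w l a) z))" .
      qed
      also have "\<dots> = (\<Sum>a<m l. \<Sum>i<m (Suc l). br (B (br (e j) (u l a)) (w (Suc l) i) *s u (Suc l) i) (br (w l a) z))"
        by (rule sum.swap)
      also have "\<dots> = (\<Sum>a<m l. - br (br (u l a) (e j)) (br (w l a) z))"
      proof (rule sum.cong[OF refl])
        fix a assume "a \<in> {..<m l}"
        hence a: "a < m l" by simp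
        have "br (e j) (u l a) \<in> ns e (Suc l)" using e_ns[OF j u[OF l(1) l'(1) a] l(1)] .
        from dual_e[OF l'(2) l(2) this]
        have "(\<Sum>i<m (Suc l). B (br (e j) (u l a)) (w (Suc l) i) *s u (Suc l) i) = br (e j) (u l a)" .
        hence "(\<Sum>i<m (Suc l). br (B (br (e j) (u l a)) (w (Suc l) i) *s u (Suc l) i) (br (w l a) z)) = br (br (e j) (u l a)) (br (w l a) z)"
          using l l' a by (subst br_sum[symmetric]) auto
        also have "br (br (e j) (u l a)) (br (w l a) z) = - br (br (u l a) (e j)) (br (w l a) z)"
          using l l' a br_anti[of "u l a" "e j"] by (simp add: br_neg)
        finally show "(\<Sum>i<m (Suc l). br (B (br (e j) (u l a)) (w (Suc l) i) *s u (Suc l) i) (br (w l a) z)) = - br (br (u l a) (e j)) (br (w l a) z)" .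
      qed
      finally show ?thesis by (simp add: Y_def sum_negf)
    qed
    \<comment> \<open>Highest degree r, that of z: w r i lowers z into \<open>K\<close>, so Y r and
      Z r become explicit. The coefficients B z (w r i) then reassemble z by duality.\<close>
    have wz: "br (w r i) z = (- B z (w r i)) *s \<tau>" if i: "i < m r" for i
    proof -
      have "w r i \<in> gr (- int r)" "z \<in> gr (int r)" using w[OF r i] zr r by (simp_all add: gr_ns)
      from gr_br[OF this] have "br (w r i) z \<in> K" by (simp add: gr_zero)
      then have "br (w r i) z = (- B (w r i) z) *s \<tau>" using r i zw by (intro br_pair) auto
      then show ?thesis using B_sym[of "w r i" z] r i by simp
    qed
    have zdual: "(\<Sum>i<m r. B z (w r i) *s u r i) = z" using dual_e[OF r zr] .
    have S: "B z (w r i) *s u r i \<in> E" if "i \<in> {..<m r}" for i using r that by auto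
    have Yr: "Y r = (- B \<tau> (t j + \<tau>)) *s y"
    proof -
      have "Y r = (\<Sum>i<m r. - br (br (B z (w r i) *s u r i) (e j)) \<tau>)"
        unfolding Y_def using r by (intro sum.cong) (auto simp: wz br_scale br_neg)
      also have "\<dots> = - br (br (\<Sum>i<m r. B z (w r i) *s u r i) (e j)) \<tau>"
      proof -
        have "br (\<Sum>i<m r. br (B z (w r i) *s u r i) (e j)) \<tau> = (\<Sum>i<m r. br (br (B z (w r i) *s u r i) (e j)) \<tau>)"
          by (rule br_sum) (use S in auto)
        then show ?thesis by (simp only: sum_negf br_sum[OF S eE'(1)])
      qed
      also have "\<dots> = - br (br z (e j)) \<tau>" by (simp add: zdual)
      also have "br z (e j) = - y" unfolding y_def by (intro br_anti) auto
      also have "- br (- y) \<tau> = br y \<tau>" by (simp add: br_neg)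
      also have "\<dots> = - br \<tau> y" by (intro br_anti) auto
      finally show ?thesis using yw[of \<tau>] by simp
    qed
    have Zr: "Z r = B \<tau> \<tau> *s y"
    proof -
      have "Z r = (\<Sum>i<m r. - br (e j) (br (B z (w r i) *s u r i) \<tau>))"
        unfolding Z_def using r by (intro sum.cong) (auto simp: wz br_scale br_neg)
      also have "\<dots> = - br (e j) (br (\<Sum>i<m r. B z (w r i) *s u r i) \<tau>)"
      proof -
        have "br (e j) (\<Sum>i<m r. br (B z (w r i) *s u r i) \<tau>) = (\<Sum>i<m r. br (e j) (br (B z (w r i) *s u r i) \<tau>))"
          by (rule br_sum_right) (use S in auto)
        then show ?thesis by (simp only: sum_negf br_sum[OF S \<tau>K(2)])
      qed
      also have "\<dots> = - br (e j) (br z \<tau>)" by (simp add: zdual)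
      also have "br z \<tau> = - br \<tau> z" by (intro br_anti) auto
      also have "- br (e j) (- br \<tau> z) = br (e j) (br \<tau> z)" by (simp add: br_neg)
      finally show ?thesis using zw[of \<tau>] by (simp add: br_scale y_def)
    qed
    have Zsum: "(\<Sum>l\<in>{1..<r}. Z l) = cas is *s y"
    proof -
      have "(\<Sum>l\<in>{1..<r}. Z l) = br (e j) (\<Sum>l\<in>{1..<r}. \<Sum>i<m l. br (u l i) (br (w l i) z))"
      proof -
        have "br (e j) (\<Sum>l\<in>{1..<r}. \<Sum>i<m l. br (u l i) (br (w l i) z)) =
            (\<Sum>l\<in>{1..<r}. br (e j) (\<Sum>i<m l. br (u l i) (br (w l i) z)))"
          by (rule br_sum_right) (use r in \<open>auto intro!: E_sum\<close>)
        also have "\<dots> = (\<Sum>l\<in>{1..<r}. Z l)" unfolding Z_def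
          by (intro sum.cong refl br_sum_right) (use r in auto)
        finally show ?thesis by simp
      qed
      also have "(\<Sum>l\<in>{1..<r}. \<Sum>i<m l. br (u l i) (br (w l i) z)) = cas is *s z"
        using Cons.IH[OF ne iss] Cons.prems unfolding z_def r_def by simp
      finally show ?thesis by (simp add: br_scale y_def)
    qed
    have Xsum: "(\<Sum>l\<in>{1..<Suc r}. X l) = X 1 - (\<Sum>l\<in>{1..<r}. Y l)"
    proof -
      have "(\<Sum>l\<in>{1..<Suc r}. X l) = X 1 + (\<Sum>l\<in>{Suc 1..<Suc r}. X l)"
        using r by (intro sum.atLeast_Suc_lessThan) auto
      also have "(\<Sum>l\<in>{Suc 1..<Suc r}. X l) = (\<Sum>l\<in>{1..<r}. X (Suc l))"
        by (rule sum.shift_bounds_Suc_ivl)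
      also have "\<dots> = (\<Sum>l\<in>{1..<r}. - Y l)" using r by (intro sum.cong XY) auto
      finally show ?thesis by (simp add: sum_negf)
    qed
    have last: "(\<Sum>l\<in>{1..<Suc r}. g l) = (\<Sum>l\<in>{1..<r}. g l) + g r" for g :: "nat \<Rightarrow> 'a"
      using r by (intro sum.atLeastLessThan_Suc) auto
    have "(\<Sum>l\<in>{1..<length (j # is)}. \<Sum>i<m l. br (u l i) (br (w l i) y)) =
        (\<Sum>l\<in>{1..<Suc r}. X l + Y l + Z l)"
      using r by (intro sum.cong split) (auto simp: r_def)
    also have "\<dots> = (\<Sum>l\<in>{1..<Suc r}. X l) + (\<Sum>l\<in>{1..<Suc r}. Y l) + (\<Sum>l\<in>{1..<Suc r}. Z l)"
      by (simp add: sum.distrib del: sum.op_ivl_Suc)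
    also have "\<dots> = X 1 + Y r + Z r + cas is *s y"
      unfolding Xsum last[of Y] last[of Z] Zsum by (simp add: algebra_simps)
    \<comment> \<open>What survives is X 1, Y r, Z r and the induction hypothesis. The scalars of
      the first three add up to -2 (t j, \<tau>), which is exactly the change of \<open>cas\<close>
      when j is prepended.\<close>
    also have "\<dots> = (- B (t j) \<tau> - B \<tau> (t j + \<tau>) + B \<tau> \<tau> + cas is) *s y"
      unfolding X1 Yr Zr by (simp add: scale_left_distrib scale_left_diff_distrib)
    also have "- B (t j) \<tau> - B \<tau> (t j + \<tau>) + B \<tau> \<tau> + cas is = cas (j # is)"
      using B_sym[of \<tau> "t j"] by (simp add: cas_def B_add \<tau>_def[symmetric])
    finally show ?thesis unfolding y .
  qed
qed

lemma monom_orthogonal: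
  assumes "set is \<subseteq> {..<n}" "set js \<subseteq> {..<n}" "mset is \<noteq> mset js"
  shows "B (monom br e is) (monom br f js) = 0"
proof -
  interpret sw: chevalley sc E br B K n f e "\<lambda>i. - t i" s "- d" by (rule swap)
  have wn: "list_wt (\<lambda>i. - t i) js = - wt js" by (induction js) auto
  let ?x = "monom br e is" and ?y = "monom br f js"
  have E [simp]: "?x \<in> E" "?y \<in> E" using monom_E assms by auto
  have "wt is - wt js \<noteq> 0" using wt_inj[OF assms(1,2)] assms(3) by auto
  moreover have "wt is - wt js \<in> K" using wt_K assms K_subspace by (auto intro: subspace_diff)
  ultimately obtain h where h: "h \<in> K" "B (wt is - wt js) h \<noteq> 0" using K_nondeg by blast
  have h': "B h (wt is) \<noteq> B h (wt js)" using h assms B_sym[of h "wt is"] B_sym[of h "wt js"] by (simp add: B_diff)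
  have 1: "br h ?x = B h (wt is) *s ?x" using monom_weight h assms by blast
  have 2: "br h ?y = (- B h (wt js)) *s ?y"
    using sw.monom_weight[of h js] h assms by (simp add: wn B_neg)
  have "B (br ?x h) ?y = B ?x (br h ?y)" using h by (simp add: B_invariant)
  moreover have "br ?x h = - (B h (wt is) *s ?x)" using br_anti[of h ?x] h by (simp add: 1)
  ultimately have "- (B h (wt is) * B ?x ?y) = - (B h (wt js) * B ?x ?y)" by (simp add: 2 B_neg B_scale)
  then show ?thesis using h' by simp
qed

lemma gr_degree: assumes "x \<in> gr k" shows "br d x = of_int k *s x"
proof -
  interpret sw: chevalley sc E br B K n f e "\<lambda>i. - t i" s "- d" by (rule swap)
  have wd: "B d (wt is) = of_nat (length is)" if "set is \<subseteq> {..<n}" for "is"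
    using that by (induction "is") (auto simp: B_add d_t)
  have wn: "list_wt (\<lambda>i. - t i) js = - wt js" for js by (induction js) auto
  have span: "br d y = c *s y" if "y \<in> span S" "S \<subseteq> E" "\<And>z. z \<in> S \<Longrightarrow> br d z = c *s z" for y c S
  proof -
    have "y \<in> E \<and> br d y = c *s y" using that(1)
    proof (induction rule: span_induct_alt)
      case (step a z y)
      then show ?case using that(2,3) by (auto simp: br_add br_scale subset_iff scale_right_distrib mult.commute)
    qed simp
    then show ?thesis by simp
  qed
  consider "k > 0" | "k = 0" | "k < 0" by linarith
  then show ?thesis
  proof cases
    case 1
    then show ?thesis using assms monomL_E wd d_K
      by (intro span[of x "monom br e ` L (nat k)"]) (auto simp: gr_def ns_def monom_weight)
  next
    case 2
    then show ?thesis using assms d_K K_abelian by (simp add: gr_def)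
  next
    case 3
    have "br d (monom br f is) = of_int k *s monom br f is" if "is \<in> L (nat (- k))" for "is"
      using sw.monom_weight[OF d_K, of "is"] that 3 by (simp add: wn B_neg wd)
    then show ?thesis using assms monomL_E 3
      by (intro span[of x "monom br f ` L (nat (- k))"]) (auto simp: gr_def ns_def)
  qed
qed

lemma gr_orthogonal:
  assumes "x \<in> gr j" "y \<in> gr k" "j + k \<noteq> 0"
  shows "B x y = 0"
proof -
  have E [simp]: "x \<in> E" "y \<in> E" using assms by auto
  have "B (br x d) y = B x (br d y)" by (simp add: B_invariant)
  moreover have "br x d = - (of_int j *s x)" using br_anti[of d x] gr_degree[OF assms(1)] by simp
  ultimately have "- (of_int j * B x y) = of_int k * B x y" using gr_degree[OF assms(2)] by (simp add: B_neg B_scale)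
  hence "of_int (j + k) * B x y = 0" by (simp only: of_int_add distrib_right) (metis add.right_inverse)
  then show ?thesis using assms(3) by (metis mult_eq_0_iff of_int_eq_0_iff)
qed

section \<open>The algebra spanned by \<open>K\<close> and the two halves\<close>

abbreviation G where "G \<equiv> gen_subalgebra sc E br (e ` {..<n} \<union> f ` {..<n})"

definition total where "total = span (\<Union>k. gr k)"

lemma total_E: "total \<subseteq> E" unfolding total_def by (rule E_span) auto

lemma total_subalgebra: "lie_subalgebra sc E br total"
  unfolding lie_subalgebra_def
proof (intro conjI ballI)
  show "subspace total" by (simp add: total_def)
  show "total \<subseteq> E" by (rule total_E)
  fix x y assume x: "x \<in> total" and y: "y \<in> total"
  have U: "(\<Union>k. gr k) \<subseteq> E" by auto
  show "br x y \<in> total"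
  proof (rule linear_map_span_left[OF _ U _ _ x[unfolded total_def]])
    fix a assume "a \<in> (\<Union>k. gr k)"
    then obtain j where a: "a \<in> gr j" by blast
    show "br a y \<in> total"
    proof (rule linear_map_span[OF _ U _ _ y[unfolded total_def]])
      fix b assume "b \<in> (\<Union>k. gr k)"
      then obtain k where "b \<in> gr k" by blast
      then have "br a b \<in> gr (j + k)" using a gr_br by blast
      then show "br a b \<in> total" unfolding total_def by (blast intro: span_base)
    qed (use a in \<open>auto simp: total_def\<close>)
  qed (use y total_E in \<open>auto simp: total_def\<close>)
qed

lemma G_total: "G \<subseteq> total"
proof -
  have "e ` {..<n} \<union> f ` {..<n} \<subseteq> total"
  proof
    fix x assume "x \<in> e ` {..<n} \<union> f ` {..<n}"
    then obtain i where i: "i < n" "x = e i \<or> x = f i" by auto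
    hence "x \<in> gr 1 \<or> x \<in> gr (- 1)"
      using monom_ns[of "[i]" 1 e] monom_ns[of "[i]" 1 f] by (auto simp: gr_def)
    then show "x \<in> total" unfolding total_def by (blast intro: span_base)
  qed
  then show ?thesis using total_subalgebra by (auto simp: gen_subalgebra_def)
qed

lemma G_subalgebra: "lie_subalgebra sc E br G"
  by (rule gen_subalgebra_subalgebra) auto

lemma gens_G: "i < n \<Longrightarrow> e i \<in> G" "i < n \<Longrightarrow> f i \<in> G"
  using gen_subalgebra_superset[of "e ` {..<n} \<union> f ` {..<n}"] by blast+

lemma gr_G: assumes "k \<noteq> 0" "x \<in> gr k" shows "x \<in> G"
proof -
  have sub: "subspace G" "\<And>x y. x \<in> G \<Longrightarrow> y \<in> G \<Longrightarrow> br x y \<in> G"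
    using G_subalgebra by (auto simp: lie_subalgebra_def)
  have m: "monom br e is \<in> G \<and> monom br f is \<in> G" if "set is \<subseteq> {..<n}" for "is"
    using that
  proof (induction "is" rule: induct_list012)
    case 1 then show ?case using sub(1) subspace_0 by auto
  qed (auto simp: gens_G intro: sub(2))
  have "ns e j \<subseteq> G" "ns f j \<subseteq> G" for j
    unfolding ns_def by (rule span_minimal[OF _ sub(1)]; use m in auto)+
  then show ?thesis using assms by (auto simp: gr_def split: if_splits)
qed

lemma total_eq: "total = set_sum K G"
proof
  have subG: "subspace G" using G_subalgebra by (simp add: lie_subalgebra_def)
  have sub: "subspace (set_sum K G)"
    unfolding set_sum_def by (rule subspace_sums[OF K_subspace subG])
  have "gr k \<subseteq> set_sum K G" for k
  proof
    fix x assume x: "x \<in> gr k"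
    show "x \<in> set_sum K G"
    proof (cases "k = 0")
      case True
      then have "x \<in> K" "0 \<in> G" using x subG subspace_0 by (auto simp: gr_def)
      then show ?thesis unfolding set_sum_def by force
    next
      case False
      then have "x \<in> G" "0 \<in> K" using x gr_G K_closed by auto
      then show ?thesis unfolding set_sum_def by force
    qed
  qed
  then show "total \<subseteq> set_sum K G" unfolding total_def by (intro span_minimal sub) blast
  have "K \<subseteq> total" unfolding total_def using gr_zero by (metis UNIV_I UN_upper span_superset subset_trans)
  moreover have "subspace total" by (simp add: total_def)
  ultimately show "set_sum K G \<subseteq> total" using G_total by (auto simp: set_sum_def intro: subspace_add)
qed

lemma total_sum: "x \<in> total \<Longrightarrow> \<exists>F y. finite F \<and> (\<forall>k. y k \<in> gr k) \<and> x = (\<Sum>k\<in>F. y k)"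
  unfolding total_def by (rule span_Union_sum[OF gr_subspace])

lemma gr_total_orthogonal:
  assumes "x \<in> gr k" "\<And>y. y \<in> gr (- k) \<Longrightarrow> B x y = 0" "y \<in> total"
  shows "B x y = 0"
proof -
  obtain F z where z: "\<forall>k. z k \<in> gr k" "y = (\<Sum>k\<in>F. z k)" using total_sum[OF assms(3)] by blast
  have "B x y = (\<Sum>l\<in>F. B x (z l))" unfolding z(2) using z(1) assms(1) gr_E by (intro B_sum_right) blast+
  also have "\<dots> = 0"
  proof (intro sum.neutral ballI)
    fix l show "B x (z l) = 0"
      using assms(2)[of "z l"] gr_orthogonal[OF assms(1), of "z l" l] z(1) by (cases "l = - k") auto
  qed
  finally show ?thesis .
qed

text \<open>A radical x is split into weight components, each of which is again radical. A
  nonisotropic component vanishes by \<open>real_e\<close>. On an isotropic one the Casimir sum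
  below degree k is the nonzero scalar \<open>cas\<close>; but every lowered vector [w, x] is
  radical in a smaller degree, hence zero by hypothesis, so the sum is also zero.\<close>

lemma nondegenerate_step:
  assumes IH: "\<And>l x. 0 < l \<Longrightarrow> l < k \<Longrightarrow> x \<in> ns e l \<Longrightarrow> (\<And>y. y \<in> ns f l \<Longrightarrow> B x y = 0) \<Longrightarrow> x = 0"
    and IH': "\<And>l y. 0 < l \<Longrightarrow> l < k \<Longrightarrow> y \<in> ns f l \<Longrightarrow> (\<And>x. x \<in> ns e l \<Longrightarrow> B y x = 0) \<Longrightarrow> y = 0"
    and k: "0 < k" and x: "x \<in> ns e k" and orth: "\<And>y. y \<in> ns f k \<Longrightarrow> B x y = 0"
  shows "x = 0"
proof -
  \<comment> \<open>Both expansion formulas are required by \<open>partial_casimir\<close>: the one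
    for the e side comes from \<open>dual_pairs\<close>, the one for the f side then follows from
    nondegeneracy \<open>IH'\<close>.\<close>
  define dual where "dual l m u w \<longleftrightarrow> (\<forall>i<m. u i \<in> ns e l \<and> w i \<in> ns f l) \<and>
      (\<forall>x\<in>ns e l. (\<Sum>i<m. B x (w i) *s u i) = x) \<and> (\<forall>y\<in>ns f l. (\<Sum>i<m. B (u i) y *s w i) = y)"
    for l and m :: nat and u w
  have "\<exists>m u w. dual l m u w" if l: "0 < l" "l < k" for l
  proof -
    have "\<exists>(m::nat) u w. (\<forall>i<m. u i \<in> span (monom br e ` L l) \<and> w i \<in> ns f l) \<and>
        (\<forall>x\<in>span (monom br e ` L l). x = (\<Sum>i<m. B x (w i) *s u i))"
    proof (rule dual_pairs)
      show "finite (monom br e ` L l)" using finite_L by blast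
      show "monom br e ` L l \<subseteq> E" by (rule monomL_E)
      show "ns f l \<subseteq> E" using ns_E by blast
    qed (use IH l in \<open>simp add: ns_def\<close>)
    then obtain m :: nat and u w where uw: "\<forall>i<m. u i \<in> ns e l \<and> w i \<in> ns f l"
        "\<forall>x\<in>ns e l. x = (\<Sum>i<m. B x (w i) *s u i)"
      unfolding ns_def by blast
    have uE [simp]: "u i \<in> E" "w i \<in> E" if "i < m" for i using uw(1) that ns_E by blast+
    have "(\<Sum>i<m. B (u i) y *s w i) = y" if y: "y \<in> ns f l" for y
    proof -
      have yE [simp]: "y \<in> E" using y ns_E by blast
      have "(\<Sum>i<m. B (u i) y *s w i) - y = 0"
      proof (rule IH'[OF l])
        show "(\<Sum>i<m. B (u i) y *s w i) - y \<in> ns f l"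
          using uw(1) y by (intro subspace_diff subspace_sum subspace_scale ns_subspace) auto
        fix x assume x: "x \<in> ns e l"
        have xE [simp]: "x \<in> E" using x ns_E by blast
        have "B y x = B y (\<Sum>i<m. B x (w i) *s u i)" using uw(2) x by simp
        also have "\<dots> = (\<Sum>i<m. B x (w i) * B y (u i))" by (subst B_sum_right) (auto simp: B_scale)
        finally have "B y x = (\<Sum>i<m. B x (w i) * B y (u i))" .
        moreover have "B (\<Sum>i<m. B (u i) y *s w i) x = (\<Sum>i<m. B x (w i) * B y (u i))"
          by (subst B_sum) (auto simp: B_scale B_sym[of _ x] B_sym[of _ y] mult.commute intro!: sum.cong)
        moreover have "(\<Sum>i<m. B (u i) y *s w i) \<in> E" by (rule E_sum) auto
        ultimately show "B ((\<Sum>i<m. B (u i) y *s w i) - y) x = 0" by (simp add: B_diff)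
      qed
      then show ?thesis by simp
    qed
    hence "dual l m u w" using uw unfolding dual_def by (metis (no_types, lifting))
    then show ?thesis by blast
  qed
  hence "\<forall>l. \<exists>m u w. 0 < l \<longrightarrow> l < k \<longrightarrow> dual l m u w" by blast
  from choice[OF this] obtain m where "\<forall>l. \<exists>u w. 0 < l \<longrightarrow> l < k \<longrightarrow> dual l (m l) u w" ..
  from choice[OF this] obtain u where "\<forall>l. \<exists>w. 0 < l \<longrightarrow> l < k \<longrightarrow> dual l (m l) (u l) w" ..
  from choice[OF this] obtain w where "\<forall>l. 0 < l \<longrightarrow> l < k \<longrightarrow> dual l (m l) (u l) (w l)" ..
  then have uw: "\<And>l. 0 < l \<Longrightarrow> l < k \<Longrightarrow> (\<forall>i<m l. u l i \<in> ns e l \<and> w l i \<in> ns f l) \<and>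
      (\<forall>x\<in>ns e l. (\<Sum>i<m l. B x (w l i) *s u l i) = x) \<and> (\<forall>y\<in>ns f l. (\<Sum>i<m l. B (u l i) y *s w l i) = y)"
    unfolding dual_def by blast
  have casimir: "(\<Sum>l\<in>{1..<k}. \<Sum>i<m l. br (u l i) (br (w l i) (monom br e is))) = cas is *s monom br e is"
    if i: "is \<in> L k" for "is"
  proof -
    have len: "length is = k" "set is \<subseteq> {..<n}" "is \<noteq> []" using i k by auto
    have "(\<Sum>l\<in>{1..<length is}. \<Sum>i<m l. br (u l i) (br (w l i) (monom br e is))) = cas is *s monom br e is"
    proof (rule partial_casimir[of k])
      fix l assume l: "0 < l" "l < k"
      show "\<And>i. i < m l \<Longrightarrow> u l i \<in> ns e l" using uw[OF l] by blast
      show "\<And>i. i < m l \<Longrightarrow> w l i \<in> ns f l" using uw[OF l] by blast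
      show "\<And>x. x \<in> ns e l \<Longrightarrow> (\<Sum>i<m l. B x (w l i) *s u l i) = x" using uw[OF l] by blast
      show "\<And>y. y \<in> ns f l \<Longrightarrow> (\<Sum>i<m l. B (u l i) y *s w l i) = y" using uw[OF l] by blast
    qed (use len in auto)
    then show ?thesis using len by simp
  qed
  obtain a where a: "x = (\<Sum>is\<in>L k. a is *s monom br e is)"
    using span_image_sum[OF finite_L] x unfolding ns_def by blast
  \<comment> \<open>Components are indexed by multisets, because by \<open>wt_inj\<close> the weight
    of a monomial determines its multiset of indices.\<close>
  define xm where "xm M = (\<Sum>is\<in>{is \<in> L k. mset is = M}. a is *s monom br e is)" for M
  have "x = (\<Sum>M\<in>mset ` L k. xm M)"
    unfolding a xm_def by (rule sum.image_gen[OF finite_L])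
  moreover have "xm (mset js) = 0" if js: "js \<in> L k" for js
  proof -
    let ?I = "{is \<in> L k. mset is = mset js}"
    have fin: "finite ?I" using finite_subset[OF _ finite_L, of ?I k] by blast
    have mE: "monom br e is \<in> E" if "is \<in> L k" for "is" using monom_E[of "is"] that by auto
    have xmn: "xm (mset js) \<in> ns e k" unfolding xm_def
      by (intro subspace_sum subspace_scale ns_subspace monom_ns) auto
    have xmE [simp]: "xm (mset js) \<in> E" using xmn ns_E by blast
    have orth_m: "B (xm (mset js)) (monom br f is) = 0" if i: "is \<in> L k" for "is"
    proof -
      have fE [simp]: "monom br f is \<in> E" using monom_E i by auto
      have xB: "B (xm (mset js)) (monom br f is) = (\<Sum>l\<in>?I. a l * B (monom br e l) (monom br f is))"
        unfolding xm_def using mE by (subst B_sum) (auto simp: B_scale)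
      show ?thesis
      proof (cases "mset is = mset js")
        \<comment> \<open>Monomials of other weights are orthogonal to this f monomial, so pairing
          it with x or with the component of x gives the same value.\<close>
        case True
        have "0 = B x (monom br f is)" using orth monom_ns[of "is" k f] i by simp
        also have "\<dots> = (\<Sum>l\<in>L k. a l * B (monom br e l) (monom br f is))"
          unfolding a using mE by (subst B_sum) (auto simp: B_scale)
        also have "\<dots> = (\<Sum>l\<in>?I. a l * B (monom br e l) (monom br f is))"
          using finite_L monom_orthogonal[of _ "is"] i True by (intro sum.mono_neutral_right) auto
        finally show ?thesis using xB by simp
      next
        case False
        have "B (monom br e l) (monom br f is) = 0" if "l \<in> ?I" for l
          using that False i by (intro monom_orthogonal) auto
        then show ?thesis using xB by simp
      qed
    qed
    have orth_f: "B (xm (mset js)) y = 0" if "y \<in> ns f k" for y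
      using B_span_zero[OF monomL_E(2) xmE _ that[unfolded ns_def]] orth_m by blast
    show ?thesis
    proof (cases "B (wt js) (wt js) = 0")
      case False
      show ?thesis
      proof (rule real_e[OF _ False])
        show "set js \<subseteq> {..<n}" using js by simp
        show "xm (mset js) \<in> span {monom br e is |is. mset is = mset js}"
          unfolding xm_def by (intro span_sum span_scale span_base) auto
        fix y assume "y \<in> G"
        hence "y \<in> total" using G_total by blast
        moreover have "xm (mset js) \<in> gr (int k)" using xmn k by (simp add: gr_ns)
        moreover have "B (xm (mset js)) z = 0" if "z \<in> gr (- int k)" for z
          using orth_f that gr_ns(2)[OF k] by simp
        ultimately show "B (xm (mset js)) y = 0" by (metis gr_total_orthogonal)
      qed
    next
      case True
      have c: "cas is = cas js" if "is \<in> ?I" for "is"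
      proof -
        have "mset is = mset js" using that by simp
        then show ?thesis unfolding cas_def
          using list_wt_mset[of "is" js t] list_wt_mset[of "is" js "\<lambda>i. B (t i) (t i)"] by simp
      qed
      \<comment> \<open>For an isotropic weight only 2 (\<rho>, \<sigma>) is left in
        \<open>cas\<close>.\<close>
      have "cas js \<noteq> 0" using True imag[of js] js k by (auto simp: cas_def)
      \<comment> \<open>By invariance, pairing [w, x] with y of degree -(k - l) is pairing x with
        [y, w] of degree -k, where x is orthogonal to everything.\<close>
      have wx: "br (w l i) (xm (mset js)) = 0" if l: "0 < l" "l < k" and i: "i < m l" for l i
      proof (rule IH[of "k - l"])
        have w: "w l i \<in> ns f l" "w l i \<in> E" using uw[OF l] i ns_E(2) by blast+
        have "br (w l i) (xm (mset js)) \<in> gr (- int l + int k)"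
          using w xmn l k by (intro gr_br) (auto simp: gr_ns)
        moreover have "- int l + int k = int (k - l)" using l by simp
        ultimately show "br (w l i) (xm (mset js)) \<in> ns e (k - l)" using gr_ns(1)[of "k - l"] l by simp
        fix y assume y: "y \<in> ns f (k - l)"
        have yE [simp]: "y \<in> E" using y ns_E by blast
        have "br y (w l i) \<in> gr (- int (k - l) + - int l)"
          using w y l by (intro gr_br) (auto simp: gr_ns simp del: of_nat_diff)
        moreover have "- int (k - l) + - int l = - int k" using l by simp
        ultimately have "br y (w l i) \<in> ns f k" using gr_ns(2)[of k] k by simp
        have "B (br (w l i) (xm (mset js))) y = B y (br (w l i) (xm (mset js)))"
          using w by (intro B_sym) auto
        also have "\<dots> = B (br y (w l i)) (xm (mset js))" using w by (simp add: B_invariant)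
        also have "\<dots> = B (xm (mset js)) (br y (w l i))" using w by (intro B_sym) auto
        also have "\<dots> = 0" using orth_f \<open>br y (w l i) \<in> ns f k\<close> by blast
        finally show "B (br (w l i) (xm (mset js))) y = 0" .
      qed (use l in auto)
      have uE: "u l i \<in> E" "w l i \<in> E" if "0 < l" "l < k" "i < m l" for l i
        using uw[OF that(1,2)] that(3) ns_E by blast+
      have "(\<Sum>l\<in>{1..<k}. \<Sum>i<m l. br (u l i) (br (w l i) (xm (mset js)))) = 
          (\<Sum>l\<in>{1..<k}. \<Sum>i<m l. \<Sum>is\<in>?I. a is *s br (u l i) (br (w l i) (monom br e is)))"
      proof (intro sum.cong refl)
        fix l i assume "l \<in> {1..<k}" "i \<in> {..<m l}"
        then have [simp]: "u l i \<in> E" "w l i \<in> E" using uE by auto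
        show "br (u l i) (br (w l i) (xm (mset js))) = (\<Sum>is\<in>?I. a is *s br (u l i) (br (w l i) (monom br e is)))"
        proof -
          have "br (w l i) (xm (mset js)) = (\<Sum>is\<in>?I. a is *s br (w l i) (monom br e is))"
            unfolding xm_def using mE by (subst br_sum_right) (auto simp: br_scale intro!: sum.cong)
          then show ?thesis
            using mE by (simp only:) (subst br_sum_right, auto simp: br_scale intro!: sum.cong)
        qed
      qed
      also have "\<dots> = (\<Sum>is\<in>?I. a is *s (\<Sum>l\<in>{1..<k}. \<Sum>i<m l. br (u l i) (br (w l i) (monom br e is))))"
        unfolding scale_sum_right by (simp only: sum.swap[where B="?I"])
      also have "\<dots> = (\<Sum>is\<in>?I. a is *s (cas js *s monom br e is))"
      proof (intro sum.cong refl)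
        fix "is" assume "is \<in> ?I"
        then show "a is *s (\<Sum>l\<in>{1..<k}. \<Sum>i<m l. br (u l i) (br (w l i) (monom br e is))) = a is *s (cas js *s monom br e is)"
          using casimir[of "is"] c by auto
      qed
      also have "\<dots> = cas js *s xm (mset js)"
        unfolding xm_def scale_sum_right by (simp add: mult.commute)
      finally have "cas js *s xm (mset js) = (\<Sum>l\<in>{1..<k}. \<Sum>i<m l. br (u l i) (br (w l i) (xm (mset js))))" by simp
      also have "\<dots> = 0" using wx uE by (intro sum.neutral ballI) auto
      finally show ?thesis using \<open>cas js \<noteq> 0\<close> by simp
    qed
  qed
  ultimately show ?thesis by (simp add: sum.neutral)
qed

text \<open>The two halves go through one induction, because the dual bases in lower degrees require
  nondegeneracy from both sides. The negative half is the mirror image under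
  \<open>swap\<close>.\<close>

lemma ns_nondegenerate:
  "0 < k \<Longrightarrow> (\<forall>x\<in>ns e k. (\<forall>y\<in>ns f k. B x y = 0) \<longrightarrow> x = 0) \<and> (\<forall>x\<in>ns f k. (\<forall>y\<in>ns e k. B x y = 0) \<longrightarrow> x = 0)"
proof (induction k rule: less_induct)
  case (less k)
  interpret sw: chevalley sc E br B K n f e "\<lambda>i. - t i" s "- d" by (rule swap)
  have IH: "x = 0" if "0 < l" "l < k" "x \<in> ns e l" "\<And>y. y \<in> ns f l \<Longrightarrow> B x y = 0" for l x
    using less.IH[of l] that by blast
  have IH': "x = 0" if "0 < l" "l < k" "x \<in> ns f l" "\<And>y. y \<in> ns e l \<Longrightarrow> B x y = 0" for l x
    using less.IH[of l] that by blast
  show ?case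
  proof (intro conjI ballI impI)
    fix x assume x: "x \<in> ns e k" "\<forall>y\<in>ns f k. B x y = 0"
    show "x = 0"
    proof (rule nondegenerate_step[of k x])
      fix l z assume l: "0 < l" "l < k"
      show "z \<in> ns e l \<Longrightarrow> (\<And>y. y \<in> ns f l \<Longrightarrow> B z y = 0) \<Longrightarrow> z = 0" by (rule IH[OF l])
      show "z \<in> ns f l \<Longrightarrow> (\<And>y. y \<in> ns e l \<Longrightarrow> B z y = 0) \<Longrightarrow> z = 0" by (rule IH'[OF l])
    qed (use x less.prems in auto)
  next
    fix x assume x: "x \<in> ns f k" "\<forall>y\<in>ns e k. B x y = 0"
    show "x = 0"
    proof (rule sw.nondegenerate_step[of k x])
      fix l z assume l: "0 < l" "l < k"
      show "z \<in> ns f l \<Longrightarrow> (\<And>y. y \<in> ns e l \<Longrightarrow> B z y = 0) \<Longrightarrow> z = 0" by (rule IH'[OF l])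
      show "z \<in> ns e l \<Longrightarrow> (\<And>y. y \<in> ns f l \<Longrightarrow> B z y = 0) \<Longrightarrow> z = 0" by (rule IH[OF l])
    qed (use x less.prems in auto)
  qed
qed

lemma gr_nondegenerate:
  assumes "x \<in> gr k" "\<And>y. y \<in> gr (- k) \<Longrightarrow> B x y = 0"
  shows "x = 0"
proof -
  consider "k > 0" | "k = 0" | "k < 0" by linarith
  then show ?thesis
  proof cases
    case 1 then show ?thesis using assms ns_nondegenerate[of "nat k"] by (simp add: gr_def)
  next
    case 2 then show ?thesis using assms K_nondeg by (simp add: gr_def)
  next
    case 3 then show ?thesis using assms ns_nondegenerate[of "nat (- k)"] by (simp add: gr_def)
  qed
qed

lemma total_nondegenerate:
  assumes "x \<in> total" "\<And>y. y \<in> total \<Longrightarrow> B x y = 0"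
  shows "x = 0"
proof -
  obtain F z where z: "finite F" "\<forall>k. z k \<in> gr k" "x = (\<Sum>k\<in>F. z k)" using total_sum[OF assms(1)] by blast
  have zE [simp]: "z k \<in> E" for k using z(2) gr_E by blast
  have "z k = 0" if k: "k \<in> F" for k
  proof (rule gr_nondegenerate)
    show "z k \<in> gr k" using z by blast
    fix y assume y: "y \<in> gr (- k)"
    have "y \<in> total" using y unfolding total_def by (blast intro: span_base)
    hence "0 = B x y" using assms by simp
    also have "\<dots> = (\<Sum>l\<in>F. B (z l) y)" unfolding z(3) using y by (intro B_sum) auto
    also have "\<dots> = (\<Sum>l\<in>F. if l = k then B (z l) y else 0)"
    proof (intro sum.cong refl)
      fix l show "B (z l) y = (if l = k then B (z l) y else 0)"
        using gr_orthogonal[of "z l" l y "- k"] z(2) y by auto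
    qed
    also have "\<dots> = B (z k) y" using z(1) k by simp
    finally show "B (z k) y = 0" by simp
  qed
  then show ?thesis using z(3) by simp
qed

text \<open>An ideal contains the homogeneous components of its elements, as \<open>d\<close> lies
  in the algebra. For a component z of degree k \<noteq> 0 and y of degree -k, the bracket [y, z]
  lies in the ideal and in \<open>K\<close>, hence is zero; pairing it with \<open>d\<close> gives
  -k (y, z) = 0, and nondegeneracy forces z = 0.\<close>

lemma no_ideal:
  assumes I: "lie_ideal sc total br I" and IK: "I \<inter> K = {0}"
  shows "I = {0}"
proof -
  have sub: "subspace I" "I \<subseteq> total" and ad: "\<And>x y. x \<in> total \<Longrightarrow> y \<in> I \<Longrightarrow> br x y \<in> I"
    using I by (auto simp: lie_ideal_def)
  have grt: "gr k \<subseteq> total" for k unfolding total_def by (blast intro: span_base)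
  have d: "d \<in> total" using grt[of 0] d_K by (auto simp: gr_zero)
  have "x = 0" if x: "x \<in> I" for x
  proof -
    obtain F z where z: "finite F" "\<forall>k. z k \<in> gr k" "x = (\<Sum>k\<in>F. z k)" using total_sum x sub by blast
    have zE [simp]: "z k \<in> E" for k using z(2) gr_E by blast
    have zI: "\<forall>k\<in>F. z k \<in> I"
      using z x ad[OF d] gr_degree by (intro eigen_components[OF sub(1) _ dE]) auto
    have "z k = 0" if k: "k \<in> F" for k
    proof (cases "k = 0")
      case True
      then show ?thesis using zI k z(2) IK gr_zero by auto
    next
      case False
      show ?thesis
      proof (rule gr_nondegenerate)
        show "z k \<in> gr k" using z by blast
        fix y assume y: "y \<in> gr (- k)"
        have yE [simp]: "y \<in> E" using y by simp
        have "br y (z k) \<in> I" using ad y grt zI k by blast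
        moreover have "br y (z k) \<in> K" using gr_br[OF y, of "z k" k] z(2) by (simp add: gr_zero)
        ultimately have "br y (z k) = 0" using IK by blast
        hence "0 = B d (br y (z k))" by simp
        also have "\<dots> = B (br d y) (z k)" by (simp add: B_invariant)
        also have "\<dots> = - of_int k * B y (z k)" using gr_degree[OF y] by (simp add: B_scale B_neg)
        finally show "B (z k) y = 0" using False B_sym[of y "z k"] by simp
      qed
    qed
    then show ?thesis using z(3) by simp
  qed
  then show ?thesis using subspace_0[OF sub(1)] by blast
qed

end

section \<open>Root spaces of extended affine Lie algebras\<close>

text \<open>Local nilpotency of x and y takes the place of finite-dimensionality of the
  representation on \<open>E\<close>.\<close>

locale sl2 = lie_form sc E br B
  for sc :: "complex \<Rightarrow> 'a::ab_group_add \<Rightarrow> 'a" (infixr "*s" 75) and E br B +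
  fixes x y h :: 'a
  assumes xE [simp]: "x \<in> E" and yE [simp]: "y \<in> E"
    and xy: "br x y = h" and hx: "br h x = 2 *s x" and hy: "br h y = (- 2) *s y"
    and nilpotent_x: "v \<in> E \<Longrightarrow> \<exists>n. (br x ^^ n) v = 0"
    and nilpotent_y: "v \<in> E \<Longrightarrow> \<exists>n. (br y ^^ n) v = 0"
begin

lemma hE [simp]: "h \<in> E" using xy E_br[OF xE yE] by simp

lemma swap: "sl2 sc E br B y x (- h)"
  using nilpotent_x nilpotent_y br_anti[OF xE yE]
  by unfold_locales (simp_all add: xy hx hy br_neg)

lemma funpow_E [simp]: "v \<in> E \<Longrightarrow> (br x ^^ n) v \<in> E" "v \<in> E \<Longrightarrow> (br y ^^ n) v \<in> E"
  by (induction n) auto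

lemma weight_x: "v \<in> E \<Longrightarrow> br h v = c *s v \<Longrightarrow> br h (br x v) = (c + 2) *s br x v"
  using jacobi[of h x v] by (simp add: hx br_scale scale_left_distrib add.commute)

lemma weight_y: "v \<in> E \<Longrightarrow> br h v = c *s v \<Longrightarrow> br h (br y v) = (c - 2) *s br y v"
  using jacobi[of h y v] by (simp add: hy br_scale br_neg scale_left_diff_distrib)

lemma weight_x_pow: "v \<in> E \<Longrightarrow> br h v = c *s v \<Longrightarrow> br h ((br x ^^ n) v) = (c + 2 * of_nat n) *s (br x ^^ n) v"
proof (induction n)
  case (Suc n)
  then show ?case using weight_x[of "(br x ^^ n) v" "c + 2 * of_nat n"] by (simp add: algebra_simps)
qed simp

lemma weight_y_pow: "v \<in> E \<Longrightarrow> br h v = c *s v \<Longrightarrow> br h ((br y ^^ n) v) = (c - 2 * of_nat n) *s (br y ^^ n) v"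
proof (induction n)
  case (Suc n)
  then show ?case using weight_y[of "(br y ^^ n) v" "c - 2 * of_nat n"] by (simp add: algebra_simps)
qed simp

text \<open>The usual sl2 commutation formula, with the term in [x, v] kept: in
  \<open>y_pow_inj\<close> the weight vector is not known to be a highest one.\<close>

lemma x_y_pow:
  assumes "v \<in> E" "br h v = c *s v"
  shows "br x ((br y ^^ Suc n) v) = (br y ^^ Suc n) (br x v) + (of_nat (Suc n) * (c - of_nat n)) *s (br y ^^ n) v"
proof (induction n)
  case 0
  then show ?case using jacobi[of x y v] assms by (simp add: xy add.commute)
next
  case (Suc n)
  let ?w = "(br y ^^ Suc n) v"
  have "br x (br y ?w) = br h ?w + br y (br x ?w)" using jacobi[of x y ?w] assms(1) by (simp add: xy)
  also have "br h ?w = (c - 2 * of_nat (Suc n)) *s ?w" using weight_y_pow assms by blast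
  also have "br y (br x ?w) = (br y ^^ Suc (Suc n)) (br x v) + (of_nat (Suc n) * (c - of_nat n)) *s ?w"
    unfolding Suc using assms(1) by (simp add: br_add br_scale)
  finally have "br x (br y ?w) = (br y ^^ Suc (Suc n)) (br x v) +
      ((c - 2 * of_nat (Suc n)) + of_nat (Suc n) * (c - of_nat n)) *s ?w"
    by (simp add: scale_left_distrib add_ac)
  also have "(c - 2 * of_nat (Suc n)) + of_nat (Suc n) * (c - of_nat n) = of_nat (Suc (Suc n)) * (c - of_nat (Suc n))"
    by (simp add: algebra_simps)
  finally show ?case by simp
qed

text \<open>At the last nonzero power k of y on v the commutation formula reads 0 = (k + 1)(c - k)
  times a nonzero vector.\<close>

lemma highest_weight:
  assumes "v \<in> E" "v \<noteq> 0" "br x v = 0" "br h v = c *s v"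
  shows "\<exists>k. c = of_nat k"
proof -
  define n where "n = (LEAST n. (br y ^^ n) v = 0)"
  have n: "(br y ^^ n) v = 0" unfolding n_def using nilpotent_y[OF assms(1)] by (rule LeastI_ex)
  then obtain k where k: "n = Suc k" using assms(2) by (cases n) auto
  have nz: "(br y ^^ k) v \<noteq> 0" using not_less_Least[of k "\<lambda>n. (br y ^^ n) v = 0"] k n_def by auto
  have y0: "(br y ^^ j) 0 = 0" for j by (induction j) auto
  have "0 = br x ((br y ^^ Suc k) v)" using n k by simp
  also have "\<dots> = (of_nat (Suc k) * (c - of_nat k)) *s (br y ^^ k) v"
    using x_y_pow[OF assms(1,4), of k] assms(3) y0[of "Suc k"] by simp
  finally have "of_nat (Suc k) * (c - of_nat k) = 0" using nz by (metis scale_eq_0_iff)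
  hence "c = of_nat k" by (metis eq_iff_diff_eq_0 mult_eq_0_iff of_nat_eq_0_iff nat.distinct(1))
  then show ?thesis by blast
qed

lemma weight_integral:
  assumes "v \<in> E" "v \<noteq> 0" "br h v = c *s v"
  shows "\<exists>k::int. c = of_int k"
proof -
  define n where "n = (LEAST n. (br x ^^ n) v = 0)"
  have n: "(br x ^^ n) v = 0" unfolding n_def using nilpotent_x[OF assms(1)] by (rule LeastI_ex)
  then obtain m where m: "n = Suc m" using assms(2) by (cases n) auto
  have nz: "(br x ^^ m) v \<noteq> 0" using not_less_Least[of m "\<lambda>n. (br x ^^ n) v = 0"] m n_def by auto
  obtain k where "c + 2 * of_nat m = of_nat k"
    using highest_weight[of "(br x ^^ m) v" "c + 2 * of_nat m"] nz n m assms weight_x_pow by auto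
  hence "c = of_int (int k - 2 * int m)" by (simp add: algebra_simps)
  then show ?thesis by blast
qed

text \<open>Induction on a power N of x that kills v. The vector u = [x, v] has weight k + 2, and
  the commutation formula shows that the power k + 2 of y kills it, so u = 0 by induction. Then v is
  a highest weight vector, and the coefficients (i + 1)(k - i) are nonzero for i < k, so vanishing
  descends from the power k of y to the power 0.\<close>

lemma y_pow_inj:
  assumes "v \<in> E" "br h v = of_nat k *s v" "(br y ^^ k) v = 0"
  shows "v = 0"
proof -
  have *: "\<And>v k. v \<in> E \<Longrightarrow> br h v = of_nat k *s v \<Longrightarrow> (br y ^^ k) v = 0 \<Longrightarrow> (br x ^^ N) v = 0 \<Longrightarrow> v = 0" for N
  proof (induction N)
    case (Suc N)
    have y0: "(br y ^^ j) 0 = 0" for j by (induction j) auto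
    have up: "(br y ^^ (k + j)) v = 0" for j using Suc.prems(3) y0[of j]
      by (metis add.commute comp_apply funpow_add)
    let ?u = "br x v"
    have "?u = 0"
    proof (rule Suc.IH[of ?u "k + 2"])
      show "?u \<in> E" using Suc.prems(1) by simp
      show "br h ?u = of_nat (k + 2) *s ?u" using weight_x[OF Suc.prems(1,2)] by simp
      show "(br x ^^ N) ?u = 0" using Suc.prems(4) by (simp add: funpow_swap1)
      have "br x ((br y ^^ Suc (k + 1)) v) = (br y ^^ Suc (k + 1)) ?u +
          (of_nat (Suc (k + 1)) * (of_nat k - of_nat (k + 1))) *s (br y ^^ (k + 1)) v"
        using x_y_pow[OF Suc.prems(1,2)] .
      then show "(br y ^^ (k + 2)) ?u = 0" using up[of 1] up[of 2] by simp
    qed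
    have "(br y ^^ (k - j)) v = 0" if "j \<le> k" for j
      using that
    proof (induction j)
      case 0 then show ?case using Suc.prems(3) by simp
    next
      case (Suc j)
      let ?i = "k - Suc j"
      have i: "k - j = Suc ?i" using Suc.prems by simp
      have "br x ((br y ^^ Suc ?i) v) = (br y ^^ Suc ?i) ?u + (of_nat (Suc ?i) * (of_nat k - of_nat ?i)) *s (br y ^^ ?i) v"
        using x_y_pow[OF \<open>v \<in> E\<close> \<open>br h v = of_nat k *s v\<close>] .
      hence "(of_nat (Suc ?i) * (of_nat k - of_nat ?i)) *s (br y ^^ ?i) v = 0"
        using Suc i \<open>?u = 0\<close> y0[of "Suc ?i"] by simp
      moreover have "of_nat (Suc ?i) * (of_nat k - of_nat ?i) \<noteq> (0::complex)"
      proof -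
        have "of_nat (Suc ?i) * (of_nat k - of_nat ?i) = (of_nat (Suc ?i * Suc j) :: complex)"
        proof -
          have "of_nat k - of_nat ?i = (of_nat (Suc j) :: complex)" using Suc.prems by (simp add: of_nat_diff)
          then show ?thesis by (simp only: of_nat_mult)
        qed
        then show ?thesis by (metis mult_eq_0_iff nat.distinct(1) of_nat_eq_0_iff)
      qed
      ultimately show ?case by (metis scale_eq_0_iff)
    qed
    from this[of k] show ?case by simp
  qed simp
  obtain N where "(br x ^^ N) v = 0" using nilpotent_x assms(1) by blast
  then show ?thesis using * assms by blast
qed

end

lemma (in sl2) x_pow_inj:
  assumes "v \<in> E" "br h v = (- of_nat k) *s v" "(br x ^^ k) v = 0"
  shows "v = 0"
proof -
  interpret s: sl2 sc E br B y x "- h" by (rule swap)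
  show ?thesis using s.y_pow_inj[of v k] assms by (simp add: br_neg)
qed

section \<open>Root spaces, duality and real roots\<close>

locale eala_form = lie_form sc E br B
  for sc :: "complex \<Rightarrow> 'a::ab_group_add \<Rightarrow> 'a" (infixr "*s" 75) and E br B +
  fixes H :: "'a set"
  assumes eala: "eala sc E br B H"
begin

abbreviation dual where "dual \<equiv> dual_space sc H"
abbreviation rsp where "rsp \<equiv> root_space sc E br H"
abbreviation R where "R \<equiv> roots sc E br H"
abbreviation Rx where "Rx \<equiv> roots_x sc E br B H"
abbreviation R0 where "R0 \<equiv> roots_0 sc E br B H"
abbreviation tv where "tv \<equiv> tvec B H"
abbreviation df where "df \<equiv> dform B H"

lemma H_subspace: "subspace H" and H_subset: "H \<subseteq> E"
  using eala by (auto simp: eala_def lie_subalgebra_def)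

lemma HE [simp]: "h \<in> H \<Longrightarrow> h \<in> E" using H_subset by blast

lemma H_closed: "0 \<in> H" "x \<in> H \<Longrightarrow> y \<in> H \<Longrightarrow> x + y \<in> H" "x \<in> H \<Longrightarrow> c *s x \<in> H" "x \<in> H \<Longrightarrow> - x \<in> H"
  using H_subspace by (auto intro: subspace_0 subspace_add subspace_scale subspace_neg)

lemma H_finite: "\<exists>S. finite S \<and> S \<subseteq> H \<and> span S = H"
  using eala by (auto simp: eala_def fin_dim_def)

lemma E_roots: "E = span (\<Union>\<alpha>\<in>dual. rsp \<alpha>)"
  using eala by (simp add: eala_def)

lemma rsp_0: "rsp 0 = H" using eala by (simp add: eala_def)

lemma rsp_E [simp]: "x \<in> rsp \<alpha> \<Longrightarrow> x \<in> E" by (simp add: root_space_def)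

lemma rsp_br: "x \<in> rsp \<alpha> \<Longrightarrow> h \<in> H \<Longrightarrow> br h x = \<alpha> h *s x" unfolding root_space_def by blast

lemma H_abelian: "h \<in> H \<Longrightarrow> h' \<in> H \<Longrightarrow> br h h' = 0"
  using rsp_br[of h' 0 h] rsp_0 by simp

lemma rsp_subspace: "subspace (rsp \<alpha>)"
  unfolding subspace_def root_space_def
  by (auto simp: br_add br_scale scale_right_distrib mult.commute)

lemma rsp_bracket: assumes "x \<in> rsp \<alpha>" "y \<in> rsp \<beta>" shows "br x y \<in> rsp (\<alpha> + \<beta>)"
proof -
  have E: "x \<in> E" "y \<in> E" using assms by simp_all
  have "br h (br x y) = (\<alpha> + \<beta>) h *s br x y" if h: "h \<in> H" for h
  proof -
    have "br h (br x y) = br (br h x) y + br x (br h y)" using E h by (intro jacobi) auto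
    also have "\<dots> = (\<alpha> + \<beta>) h *s br x y"
      unfolding rsp_br[OF assms(1) h] rsp_br[OF assms(2) h] using E by (simp add: br_scale scale_left_distrib)
    finally show ?thesis .
  qed
  then show ?thesis using E_br[OF E] unfolding root_space_def by blast
qed

lemma dual_0: "0 \<in> dual" by (simp add: dual_space_def)
lemma dual_add: "\<alpha> \<in> dual \<Longrightarrow> \<beta> \<in> dual \<Longrightarrow> \<alpha> + \<beta> \<in> dual"
  by (auto simp: dual_space_def distrib_left)
lemma dual_neg: "\<alpha> \<in> dual \<Longrightarrow> - \<alpha> \<in> dual" by (auto simp: dual_space_def)
lemma dual_diff: "\<alpha> \<in> dual \<Longrightarrow> \<beta> \<in> dual \<Longrightarrow> \<alpha> - \<beta> \<in> dual"
  using dual_add[of \<alpha> "- \<beta>"] dual_neg[of \<beta>] by simp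
lemma dual_rscale: "\<alpha> \<in> dual \<Longrightarrow> rscale r \<alpha> \<in> dual"
  by (auto simp: dual_space_def rscale_def distrib_left)

lemma dual_linear:
  assumes "\<alpha> \<in> dual"
  shows "x \<in> H \<Longrightarrow> y \<in> H \<Longrightarrow> \<alpha> (x + y) = \<alpha> x + \<alpha> y" "x \<in> H \<Longrightarrow> \<alpha> (c *s x) = c * \<alpha> x"
    "x \<notin> H \<Longrightarrow> \<alpha> x = 0" "\<alpha> 0 = 0"
proof -
  show 1: "x \<in> H \<Longrightarrow> y \<in> H \<Longrightarrow> \<alpha> (x + y) = \<alpha> x + \<alpha> y" "x \<in> H \<Longrightarrow> \<alpha> (c *s x) = c * \<alpha> x"
    "x \<notin> H \<Longrightarrow> \<alpha> x = 0" for x y c using assms by (auto simp: dual_space_def)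
  show "\<alpha> 0 = 0" using 1(2)[of 0 0] H_closed by simp
qed

lemma dual_sum: "\<alpha> \<in> dual \<Longrightarrow> (\<And>i. i \<in> I \<Longrightarrow> g i \<in> H) \<Longrightarrow> \<alpha> (\<Sum>i\<in>I. g i) = (\<Sum>i\<in>I. \<alpha> (g i))"
proof (induction I rule: infinite_finite_induct)
  case (insert i I)
  have "(\<Sum>i\<in>I. g i) \<in> H" using insert.prems(2) by (intro subspace_sum[OF H_subspace]) auto
  then show ?case using insert by (simp add: dual_linear(1))
qed (auto simp: dual_linear(4))

lemma dual_eqI: "\<alpha> \<in> dual \<Longrightarrow> \<beta> \<in> dual \<Longrightarrow> (\<And>h. h \<in> H \<Longrightarrow> \<alpha> h = \<beta> h) \<Longrightarrow> \<alpha> = \<beta>"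
  by (intro ext) (metis dual_linear(3))

lemma R_dual: "\<alpha> \<in> R \<Longrightarrow> \<alpha> \<in> dual" by (simp add: roots_def)

lemma R_I: "\<alpha> \<in> dual \<Longrightarrow> x \<in> rsp \<alpha> \<Longrightarrow> x \<noteq> 0 \<Longrightarrow> \<alpha> \<in> R" by (auto simp: roots_def)

lemma R_E: assumes "\<alpha> \<in> R" obtains x where "x \<in> rsp \<alpha>" "x \<noteq> 0"
  using assms subspace_0[OF rsp_subspace] by (auto simp: roots_def)

lemma rsp_orthogonal:
  assumes "\<alpha> \<in> dual" "\<beta> \<in> dual" "\<alpha> + \<beta> \<noteq> 0" "x \<in> rsp \<alpha>" "y \<in> rsp \<beta>"
  shows "B x y = 0"
proof -
  obtain h where h: "h \<in> H" "(\<alpha> + \<beta>) h \<noteq> 0"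
    using dual_eqI[OF dual_add[OF assms(1,2)] dual_0] assms(3) by auto
  have E: "x \<in> E" "y \<in> E" using assms by simp_all
  have "B (br x h) y = B x (br h y)" using E h by (simp add: B_invariant)
  moreover have "br x h = - (\<alpha> h *s x)" using br_anti[of h x] rsp_br[OF assms(4) h(1)] E h by simp
  ultimately have "- (\<alpha> h * B x y) = \<beta> h * B x y"
    using rsp_br[OF assms(5) h(1)] E by (simp add: B_neg B_scale)
  hence "(\<alpha> + \<beta>) h * B x y = 0" by (simp add: distrib_right) (metis add.right_inverse)
  then show ?thesis using h by simp
qed

text \<open>Root spaces whose weights do not add up to zero are orthogonal and root spaces span
  \<open>E\<close>, so nondegeneracy of \<open>E\<close> restricts to each opposite pair.\<close>

lemma rsp_pairing:
  assumes "\<alpha> \<in> dual" "x \<in> rsp \<alpha>" "x \<noteq> 0"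
  shows "\<exists>y\<in>rsp (- \<alpha>). B x y \<noteq> 0"
proof (rule ccontr)
  assume n: "\<not> ?thesis"
  have "B x y = 0" if "y \<in> E" for y
  proof (rule B_span_zero[of "\<Union>\<alpha>\<in>dual. rsp \<alpha>"])
    show "y \<in> span (\<Union>\<alpha>\<in>dual. rsp \<alpha>)" using that E_roots by simp
    fix z assume "z \<in> (\<Union>\<alpha>\<in>dual. rsp \<alpha>)"
    then obtain \<beta> where b: "\<beta> \<in> dual" "z \<in> rsp \<beta>" by blast
    show "B x z = 0"
    proof (cases "\<alpha> + \<beta> = 0")
      case True
      hence "\<beta> = - \<alpha>" by (simp add: add_eq_0_iff)
      then show ?thesis using n b by blast
    next
      case False
      then show ?thesis using rsp_orthogonal[OF assms(1) b(1)] assms(2) b(2) by blast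
    qed
  qed (use assms in auto)
  then show False using B_nondegenerate[of x] assms by auto
qed

lemma R_neg: assumes "\<alpha> \<in> R" shows "- \<alpha> \<in> R"
proof -
  obtain x where x: "x \<in> rsp \<alpha>" "x \<noteq> 0" using R_E[OF assms] by blast
  obtain y where y: "y \<in> rsp (- \<alpha>)" "B x y \<noteq> 0" using rsp_pairing[OF R_dual[OF assms] x] by blast
  hence "y \<noteq> 0" using x by auto
  then show ?thesis using R_I[OF dual_neg[OF R_dual[OF assms]] y(1)] by blast
qed

lemma H_nondegenerate: assumes "h \<in> H" "\<And>h'. h' \<in> H \<Longrightarrow> B h h' = 0" shows "h = 0"
proof (rule ccontr)
  assume "h \<noteq> 0"
  then show False using rsp_pairing[OF dual_0, of h] assms rsp_0 by auto
qed

lemma tv_exists: assumes "\<alpha> \<in> dual" shows "\<exists>t\<in>H. \<forall>h\<in>H. \<alpha> h = B h t"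
proof -
  obtain S where S: "finite S" "S \<subseteq> H" "span S = H" using H_finite by blast
  have "\<exists>(m::nat) u w. (\<forall>i<m. u i \<in> span S \<and> w i \<in> H) \<and> (\<forall>x\<in>span S. x = (\<Sum>i<m. B x (w i) *s u i))"
    using S H_subset by (intro dual_pairs) (auto intro: H_nondegenerate)
  then obtain m :: nat and u w where uw: "\<forall>i<m. u i \<in> H \<and> w i \<in> H" "\<forall>x\<in>H. x = (\<Sum>i<m. B x (w i) *s u i)"
    unfolding S(3) by blast
  define t where "t = (\<Sum>i<m. \<alpha> (u i) *s w i)"
  have "\<alpha> h = B h t" if h: "h \<in> H" for h
  proof -
    have "\<alpha> h = \<alpha> (\<Sum>i<m. B h (w i) *s u i)" using uw h by simp
    also have "\<dots> = (\<Sum>i<m. \<alpha> (B h (w i) *s u i))" using uw(1) assms H_closed by (intro dual_sum) auto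
    also have "\<dots> = (\<Sum>i<m. B h (w i) * \<alpha> (u i))" using uw(1) assms by (intro sum.cong) (auto simp: dual_linear)
    also have "\<dots> = (\<Sum>i<m. B h (\<alpha> (u i) *s w i))" using uw(1) h by (intro sum.cong) (auto simp: B_scale)
    also have "\<dots> = B h t" unfolding t_def using uw(1) h by (subst B_sum_right) auto
    finally show ?thesis .
  qed
  moreover have "t \<in> H" unfolding t_def using uw(1) H_subspace by (intro subspace_sum subspace_scale) auto
  ultimately show ?thesis by blast
qed

lemma tv_unique: assumes "t \<in> H" "\<And>h. h \<in> H \<Longrightarrow> \<alpha> h = B h t" shows "tv \<alpha> = t"
  unfolding tvec_def
proof (rule the_equality)
  show "t \<in> H \<and> (\<forall>h\<in>H. \<alpha> h = B h t)" using assms by simp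
  fix u assume u: "u \<in> H \<and> (\<forall>h\<in>H. \<alpha> h = B h u)"
  have "u - t = 0"
  proof (rule H_nondegenerate)
    show "u - t \<in> H" using u assms H_subspace by (auto intro: subspace_diff)
    fix h assume h: "h \<in> H"
    have "B h u = B h t" using u assms(2)[OF h] h by simp
    then have "B h (u - t) = 0" using u assms(1) h by (simp add: B_diff)
    then show "B (u - t) h = 0" using u assms(1) h B_sym[of h "u - t"] by simp
  qed
  then show "u = t" by simp
qed

lemma tv: assumes "\<alpha> \<in> dual" shows "tv \<alpha> \<in> H" "h \<in> H \<Longrightarrow> \<alpha> h = B h (tv \<alpha>)"
proof -
  obtain t where t: "t \<in> H" "\<And>h. h \<in> H \<Longrightarrow> \<alpha> h = B h t" using tv_exists[OF assms] by blast
  have "tv \<alpha> = t" using t by (rule tv_unique)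
  then show "tv \<alpha> \<in> H" "h \<in> H \<Longrightarrow> \<alpha> h = B h (tv \<alpha>)" using t by auto
qed

lemma tv_E [simp]: "\<alpha> \<in> dual \<Longrightarrow> tv \<alpha> \<in> E" using tv(1) by simp

lemma tv_add: assumes "\<alpha> \<in> dual" "\<beta> \<in> dual" shows "tv (\<alpha> + \<beta>) = tv \<alpha> + tv \<beta>"
proof (rule tv_unique)
  show "tv \<alpha> + tv \<beta> \<in> H" using assms by (simp add: H_closed tv(1))
  fix h assume "h \<in> H"
  then show "(\<alpha> + \<beta>) h = B h (tv \<alpha> + tv \<beta>)" using tv(2)[OF assms(1), of h] tv(2)[OF assms(2), of h] assms
    by (simp add: B_add)
qed

lemma tv_neg: assumes "\<alpha> \<in> dual" shows "tv (- \<alpha>) = - tv \<alpha>"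
proof (rule tv_unique)
  show "- tv \<alpha> \<in> H" using assms by (simp add: H_closed tv(1))
  fix h assume "h \<in> H"
  then show "(- \<alpha>) h = B h (- tv \<alpha>)" using tv(2)[OF assms, of h] assms by (simp add: B_neg)
qed

lemma tv_diff: "\<alpha> \<in> dual \<Longrightarrow> \<beta> \<in> dual \<Longrightarrow> tv (\<alpha> - \<beta>) = tv \<alpha> - tv \<beta>"
  using tv_add[of \<alpha> "- \<beta>"] by (simp add: dual_neg tv_neg)

lemma tv_rscale: assumes "\<alpha> \<in> dual" shows "tv (rscale r \<alpha>) = of_real r *s tv \<alpha>"
proof (rule tv_unique)
  show "of_real r *s tv \<alpha> \<in> H" using assms by (simp add: H_closed tv(1))
  fix h assume "h \<in> H"
  then show "rscale r \<alpha> h = B h (of_real r *s tv \<alpha>)" using tv(2)[OF assms, of h] assms by (simp add: B_scale rscale_def)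
qed

lemma tv_0: "tv 0 = 0" by (rule tv_unique) (auto simp: H_closed)

lemma df_eq: "\<alpha> \<in> dual \<Longrightarrow> \<beta> \<in> dual \<Longrightarrow> df \<alpha> \<beta> = \<alpha> (tv \<beta>)"
  unfolding dform_def using tv(2)[of \<alpha> "tv \<beta>"] tv(1)[of \<beta>] B_sym[of "tv \<beta>" "tv \<alpha>"] by simp

lemma df_sym: "\<alpha> \<in> dual \<Longrightarrow> \<beta> \<in> dual \<Longrightarrow> df \<alpha> \<beta> = df \<beta> \<alpha>"
  unfolding dform_def by (rule B_sym) auto

lemma df_add: assumes "\<alpha> \<in> dual" "\<beta> \<in> dual" "\<gamma> \<in> dual"
  shows "df (\<alpha> + \<beta>) \<gamma> = df \<alpha> \<gamma> + df \<beta> \<gamma>" "df \<gamma> (\<alpha> + \<beta>) = df \<gamma> \<alpha> + df \<gamma> \<beta>"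
  unfolding dform_def using assms by (simp_all add: tv_add B_add)

lemma df_diff: assumes "\<alpha> \<in> dual" "\<beta> \<in> dual" "\<gamma> \<in> dual"
  shows "df (\<alpha> - \<beta>) \<gamma> = df \<alpha> \<gamma> - df \<beta> \<gamma>" "df \<gamma> (\<alpha> - \<beta>) = df \<gamma> \<alpha> - df \<gamma> \<beta>"
  unfolding dform_def using assms by (simp_all add: tv_diff B_diff)

lemma df_neg: assumes "\<alpha> \<in> dual" "\<gamma> \<in> dual"
  shows "df (- \<alpha>) \<gamma> = - df \<alpha> \<gamma>" "df \<gamma> (- \<alpha>) = - df \<gamma> \<alpha>"
  unfolding dform_def using assms by (simp_all add: tv_neg B_neg)

lemma df_rscale: assumes "\<alpha> \<in> dual" "\<gamma> \<in> dual"
  shows "df (rscale r \<alpha>) \<gamma> = of_real r * df \<alpha> \<gamma>" "df \<gamma> (rscale r \<alpha>) = of_real r * df \<gamma> \<alpha>"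
  unfolding dform_def using assms by (simp_all add: tv_rscale B_scale)

lemma rsp_br_pair:
  assumes "\<alpha> \<in> dual" "x \<in> rsp \<alpha>" "y \<in> rsp (- \<alpha>)"
  shows "br x y = B x y *s tv \<alpha>"
proof -
  have E [simp]: "x \<in> E" "y \<in> E" using assms by simp_all
  have xyH: "br x y \<in> H" using rsp_bracket[OF assms(2,3)] rsp_0 by simp
  have "br x y - B x y *s tv \<alpha> = 0"
  proof (rule H_nondegenerate)
    show "br x y - B x y *s tv \<alpha> \<in> H" using xyH tv(1)[OF assms(1)] H_subspace
      by (intro subspace_diff subspace_scale) auto
    fix h assume h: "h \<in> H"
    have "B (br x y) h = B h (br x y)" using h by (intro B_sym) auto
    also have "\<dots> = B (br h x) y" using h by (simp add: B_invariant)
    also have "\<dots> = \<alpha> h * B x y" using rsp_br[OF assms(2) h] by (simp add: B_scale)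
    also have "\<alpha> h = B (tv \<alpha>) h" using tv[OF assms(1)] h B_sym[of h "tv \<alpha>"] assms(1) by simp
    finally show "B (br x y - B x y *s tv \<alpha>) h = 0" using h assms(1) by (simp add: B_diff B_scale)
  qed
  then show ?thesis by simp
qed

lemma Rx_R: "\<alpha> \<in> Rx \<Longrightarrow> \<alpha> \<in> R" and Rx_nz: "\<alpha> \<in> Rx \<Longrightarrow> df \<alpha> \<alpha> \<noteq> 0"
  by (auto simp: roots_x_def)

lemma Rx_dual: "\<alpha> \<in> Rx \<Longrightarrow> \<alpha> \<in> dual" by (simp add: Rx_R R_dual)

lemma Rx_I: "\<alpha> \<in> R \<Longrightarrow> df \<alpha> \<alpha> \<noteq> 0 \<Longrightarrow> \<alpha> \<in> Rx" by (simp add: roots_x_def)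

lemma Rx_neg: "\<alpha> \<in> Rx \<Longrightarrow> - \<alpha> \<in> Rx"
  by (auto simp: Rx_R R_neg df_neg Rx_dual dual_neg Rx_nz intro!: Rx_I)

text \<open>The coroot of \<alpha>, placed in \<open>H\<close> by means of the form.\<close>

definition cr where "cr \<alpha> = (2 / df \<alpha> \<alpha>) *s tv \<alpha>"

lemma cr_H: "\<alpha> \<in> dual \<Longrightarrow> cr \<alpha> \<in> H" by (simp add: cr_def H_closed tv(1))

lemma cr_eval: "\<alpha> \<in> dual \<Longrightarrow> \<beta> \<in> dual \<Longrightarrow> \<beta> (cr \<alpha>) = 2 * df \<beta> \<alpha> / df \<alpha> \<alpha>"
  by (simp add: cr_def dual_linear(2) tv(1) df_eq)

lemma sl2_triple:
  assumes "\<alpha> \<in> Rx" "x \<in> rsp \<alpha>" "x \<noteq> 0"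
  shows "\<exists>y\<in>rsp (- \<alpha>). sl2 sc E br B x y (cr \<alpha>)"
proof -
  have d: "\<alpha> \<in> dual" using assms(1) Rx_dual by blast
  obtain y where y: "y \<in> rsp (- \<alpha>)" "B x y \<noteq> 0" using rsp_pairing[OF d assms(2,3)] by blast
  \<comment> \<open>Since [x, y] = (x, y) \<open>tv \<alpha>\<close>, this factor makes [x, y']
    equal to the coroot.\<close>
  define y' where "y' = (2 / (df \<alpha> \<alpha> * B x y)) *s y"
  have y': "y' \<in> rsp (- \<alpha>)" unfolding y'_def using y(1) rsp_subspace by (simp add: subspace_scale)
  have nil: "\<forall>\<alpha>\<in>Rx. \<forall>x\<in>rsp \<alpha>. \<forall>y\<in>E. \<exists>n. (br x ^^ n) y = 0"
    using eala by (simp add: eala_def)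
  have h: "\<alpha> (cr \<alpha>) = 2" using cr_eval[OF d d] Rx_nz[OF assms(1)] by simp
  have "sl2 sc E br B x y' (cr \<alpha>)"
  proof unfold_locales
    show "x \<in> E" "y' \<in> E" using assms y' by simp_all
    have "br x y' = (2 / (df \<alpha> \<alpha> * B x y)) *s br x y" unfolding y'_def using assms(2) y by (simp add: br_scale)
    then show "br x y' = cr \<alpha>" using rsp_br_pair[OF d assms(2) y(1)] y(2) by (simp add: cr_def)
    show "br (cr \<alpha>) x = 2 *s x" using rsp_br[OF assms(2) cr_H[OF d]] h by simp
    show "br (cr \<alpha>) y' = (- 2) *s y'" using rsp_br[OF y' cr_H[OF d]] h by simp
    show "\<And>v. v \<in> E \<Longrightarrow> \<exists>n. (br x ^^ n) v = 0" using nil assms by blast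
    show "\<And>v. v \<in> E \<Longrightarrow> \<exists>n. (br y' ^^ n) v = 0" using nil y' Rx_neg[OF assms(1)] by blast
  qed
  then show ?thesis using y' by blast
qed

lemma rsp_pow: "x \<in> rsp \<alpha> \<Longrightarrow> v \<in> rsp \<beta> \<Longrightarrow> (br x ^^ k) v \<in> rsp (\<beta> + rscale (of_nat k) \<alpha>)"
proof (induction k)
  case 0
  have "\<beta> + rscale (of_nat 0) \<alpha> = \<beta>" by (simp add: rscale_def fun_eq_iff)
  then show ?case using 0 by simp
next
  case (Suc k)
  have "br x ((br x ^^ k) v) \<in> rsp (\<alpha> + (\<beta> + rscale (of_nat k) \<alpha>))" 
    by (rule rsp_bracket[OF Suc.prems(1) Suc.IH[OF Suc.prems]])
  moreover have "\<alpha> + (\<beta> + rscale (of_nat k) \<alpha>) = \<beta> + rscale (of_nat (Suc k)) \<alpha>"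
    by (auto simp: rscale_def fun_eq_iff algebra_simps)
  ultimately show ?case by (simp only: funpow.simps comp_apply)
qed

text \<open>Subtracting a multiple of x from z makes it orthogonal to y, hence commuting with y. For
  the triple with x and y exchanged the difference would be a highest weight vector of weight -2, so
  it is zero.\<close>

lemma rsp_one_dim:
  assumes "\<alpha> \<in> Rx" "x \<in> rsp \<alpha>" "x \<noteq> 0" "z \<in> rsp \<alpha>"
  shows "\<exists>c. z = c *s x"
proof -
  have d: "\<alpha> \<in> dual" using assms(1) Rx_dual by blast
  obtain y where y: "y \<in> rsp (- \<alpha>)" "sl2 sc E br B x y (cr \<alpha>)" using sl2_triple[OF assms(1-3)] by blast
  interpret sl2 sc E br B x y "cr \<alpha>" by (rule y(2))
  interpret s: sl2 sc E br B y x "- cr \<alpha>" by (rule swap)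
  have h: "\<alpha> (cr \<alpha>) = 2" using cr_eval[OF d d] Rx_nz[OF assms(1)] by simp
  have "B x y \<noteq> 0"
  proof
    assume "B x y = 0"
    hence "cr \<alpha> = 0" using rsp_br_pair[OF d assms(2) y(1)] xy by simp
    then show False using h dual_linear(4)[OF d] by simp
  qed
  define w where "w = z - (B z y / B x y) *s x"
  have w: "w \<in> rsp \<alpha>" unfolding w_def using assms rsp_subspace by (intro subspace_diff subspace_scale) auto
  have wE [simp]: "w \<in> E" using w by simp
  have "B w y = 0" unfolding w_def using assms \<open>B x y \<noteq> 0\<close> by (simp add: B_diff B_scale)
  hence "br w y = 0" using rsp_br_pair[OF d w y(1)] by simp
  hence yw: "br y w = 0" using br_anti[of w y] by simp
  have "w = 0"
  proof (rule ccontr)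
    assume "w \<noteq> 0"
    have "br (- cr \<alpha>) w = (- 2) *s w" using rsp_br[OF w cr_H[OF d]] h by (simp add: br_neg)
    from s.highest_weight[OF wE \<open>w \<noteq> 0\<close> yw this] obtain k where "- 2 = (of_nat k :: complex)" by blast
    hence "Re (- 2) = Re (of_nat k)" by presburger
    then show False by simp
  qed
  then show ?thesis unfolding w_def by (metis eq_iff_diff_eq_0)
qed

text \<open>The k-th power of ad x is injective from weight -k to weight k. It realises the
  reflection in \<alpha> on root vectors, which is how reflected roots are shown to be roots and how
  root spaces are later reached inside the core.\<close>

lemma weight_string:
  assumes "\<alpha> \<in> Rx" "x \<in> rsp \<alpha>" "x \<noteq> 0" "\<beta> \<in> dual" "v \<in> rsp \<beta>" "v \<noteq> 0" "\<beta> (cr \<alpha>) = - of_nat k"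
  shows "(br x ^^ k) v \<in> rsp (\<beta> + rscale (of_nat k) \<alpha>)" "(br x ^^ k) v \<noteq> 0"
proof -
  show "(br x ^^ k) v \<in> rsp (\<beta> + rscale (of_nat k) \<alpha>)" by (rule rsp_pow[OF assms(2,5)])
  obtain y where y: "y \<in> rsp (- \<alpha>)" "sl2 sc E br B x y (cr \<alpha>)" using sl2_triple[OF assms(1-3)] by blast
  interpret sl2 sc E br B x y "cr \<alpha>" by (rule y(2))
  have "br (cr \<alpha>) v = (- of_nat k) *s v"
    using rsp_br[OF assms(5) cr_H[OF Rx_dual[OF assms(1)]]] assms(7) by simp
  then show "(br x ^^ k) v \<noteq> 0" using x_pow_inj[of v k] assms(5,6) by auto
qed

lemma reflection:
  assumes "\<alpha> \<in> Rx" "\<beta> \<in> R"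
  shows "\<exists>k::int. \<beta> (cr \<alpha>) = of_int k \<and> \<beta> - rscale (of_int k) \<alpha> \<in> R"
proof -
  have d: "\<alpha> \<in> dual" "\<beta> \<in> dual" using assms Rx_dual R_dual by blast+
  obtain v where v: "v \<in> rsp \<beta>" "v \<noteq> 0" using R_E[OF assms(2)] by blast
  obtain x where x: "x \<in> rsp \<alpha>" "x \<noteq> 0" using R_E[OF Rx_R[OF assms(1)]] by blast
  obtain x' where x': "x' \<in> rsp (- \<alpha>)" "x' \<noteq> 0" using R_E[OF R_neg[OF Rx_R[OF assms(1)]]] by blast
  obtain y where y: "sl2 sc E br B x y (cr \<alpha>)" using sl2_triple[OF assms(1) x] by blast
  interpret sl2 sc E br B x y "cr \<alpha>" by (rule y)
  obtain k :: int where k: "\<beta> (cr \<alpha>) = of_int k"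
    using weight_integral[of v "\<beta> (cr \<alpha>)"] v rsp_br[OF v(1) cr_H[OF d(1)]] by auto
  have dk: "\<beta> - rscale (of_int k) \<alpha> \<in> dual" using d by (simp add: dual_diff dual_rscale)
  show ?thesis
  proof (cases "k \<le> 0")
    case True
    then obtain m where m: "k = - int m" by (metis nonpos_int_cases)
    have eq: "\<beta> + rscale (of_nat m) \<alpha> = \<beta> - rscale (of_int k) \<alpha>" by (simp add: m rscale_def fun_eq_iff)
    have "\<beta> (cr \<alpha>) = - of_nat m" using k m by simp
    note w = weight_string[OF assms(1) x d(2) v this]
    show ?thesis using R_I[OF dk w(1)[unfolded eq] w(2)] k by blast
  next
    case False
    then obtain m where m: "k = int m" by (metis linear nonneg_int_cases)
    have "cr (- \<alpha>) = - cr \<alpha>" using d by (simp add: cr_def tv_neg df_neg dual_neg)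
    hence "\<beta> (cr (- \<alpha>)) = - of_nat m" using dual_linear(2)[OF d(2) cr_H[OF d(1)], of "- 1"] k m by simp
    note w = weight_string[OF Rx_neg[OF assms(1)] x' d(2) v this]
    have eq: "\<beta> + rscale (of_nat m) (- \<alpha>) = \<beta> - rscale (of_int k) \<alpha>" by (simp add: m rscale_def fun_eq_iff)
    show ?thesis using R_I[OF dk w(1)[unfolded eq] w(2)] k by blast
  qed
qed

end

section \<open>Nullity one\<close>

interpretation rs: vector_space "rscale :: real \<Rightarrow> ('a \<Rightarrow> complex) \<Rightarrow> 'a \<Rightarrow> complex"
  by unfold_locales (auto simp: rscale_def fun_eq_iff algebra_simps)

lemma finite_separated:
  fixes S :: "real set"
  assumes "\<eta> > 0" "\<And>r s. r \<in> S \<Longrightarrow> s \<in> S \<Longrightarrow> \<bar>r - s\<bar> < \<eta> \<Longrightarrow> r = s" "\<And>r. r \<in> S \<Longrightarrow> \<bar>r\<bar> \<le> c"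
  shows "finite S"
proof -
  define g where "g r = \<lfloor>r / \<eta>\<rfloor>" for r :: real
  have "inj_on g S"
  proof (rule inj_onI)
    fix r s assume rs: "r \<in> S" "s \<in> S" "g r = g s"
    have "\<bar>r / \<eta> - s / \<eta>\<bar> < 1" using rs(3) unfolding g_def by linarith
    hence "\<bar>r - s\<bar> / \<eta> < 1" using assms(1) by (simp add: diff_divide_distrib[symmetric])
    hence "\<bar>r - s\<bar> < \<eta>" using assms(1) by (simp add: divide_less_eq)
    then show "r = s" using assms(2) rs by blast
  qed
  moreover have "g ` S \<subseteq> {\<lfloor>- c / \<eta>\<rfloor> .. \<lfloor>c / \<eta>\<rfloor>}"
  proof
    fix k assume "k \<in> g ` S"
    then obtain r where r: "r \<in> S" "k = \<lfloor>r / \<eta>\<rfloor>" by (auto simp: g_def)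
    have "- c \<le> r" "r \<le> c" using assms(3)[OF r(1)] by auto
    hence "- c / \<eta> \<le> r / \<eta>" "r / \<eta> \<le> c / \<eta>" using assms(1) by (intro divide_right_mono; simp)+
    then show "k \<in> {\<lfloor>- c / \<eta>\<rfloor> .. \<lfloor>c / \<eta>\<rfloor>}" using r(2) floor_mono by auto
  qed
  ultimately show ?thesis by (meson finite_atLeastAtMost_int finite_imageD finite_subset)
qed

locale eala_null1 = eala_form sc E br B H
  for sc :: "complex \<Rightarrow> 'a::ab_group_add \<Rightarrow> 'a" (infixr "*s" 75) and E br B H +
  fixes Rd :: "('a \<Rightarrow> complex) set" and Hhat :: "'a set"
  assumes nullity: "nullity sc E br B H = 1"
    and reduced: "reduced_quotient sc E br B H"
    and Rdot: "Rdot_ok sc E br B H Rd"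
    and Hhat: "Hhat0_ok sc E br B H Rd Hhat"
begin

abbreviation VV where "VV \<equiv> V0 sc E br B H"

text \<open>The generator of the line is itself taken from \<open>R0\<close>, so that it can be
  reflected and the non-isolation axiom applies to it.\<close>

lemma delta_exists: "\<exists>\<delta>\<in>R0. \<delta> \<noteq> 0 \<and> VV = range (\<lambda>r. rscale r \<delta>)"
proof -
  obtain C where C: "C \<subseteq> VV" "rs.independent C" "VV \<subseteq> rs.span C" "card C = rs.dim VV"
    by (rule rs.basis_exists)
  have "card C = 1" using C(4) nullity by (simp add: nullity_def)
  then obtain b where b: "C = {b}" by (rule card_1_singletonE)
  have bnz: "b \<noteq> 0" using C(2) b by auto
  have VVb: "VV = rs.span {b}"
  proof
    show "VV \<subseteq> rs.span {b}" using C(3) b by simp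
    have "{b} \<subseteq> VV" using C(1) b by simp
    then show "rs.span {b} \<subseteq> VV" unfolding V0_def by (rule rs.span_minimal) (rule rs.subspace_span)
  qed
  have "\<not> R0 \<subseteq> {0}"
  proof
    assume "R0 \<subseteq> {0}"
    hence "VV \<subseteq> {0}" unfolding V0_def by (rule rs.span_minimal) (rule rs.subspace_single_0)
    then show False using C(1) b bnz by blast
  qed
  then obtain \<delta> where d: "\<delta> \<in> R0" "\<delta> \<noteq> 0" by blast
  have "\<delta> \<in> VV" using d unfolding V0_def by (rule_tac rs.span_base)
  then obtain k where k: "\<delta> = rscale k b" using VVb rs.span_singleton[of b] by blast
  have "k \<noteq> 0" using k d(2) by auto
  hence bd: "b = rscale (1 / k) \<delta>" using k by (simp add: rscale_def fun_eq_iff)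
  have "rs.span {b} = rs.span {\<delta>}"
  proof
    show "rs.span {b} \<subseteq> rs.span {\<delta>}" by (rule rs.span_minimal) (auto simp: bd rs.span_base rs.span_scale)
    show "rs.span {\<delta>} \<subseteq> rs.span {b}" by (rule rs.span_minimal) (auto simp: k rs.span_base rs.span_scale)
  qed
  then have "VV = range (\<lambda>r. rscale r \<delta>)" using VVb rs.span_singleton by simp
  then show ?thesis using d by blast
qed

definition del where "del = (SOME \<delta>. \<delta> \<in> R0 \<and> \<delta> \<noteq> 0 \<and> VV = range (\<lambda>r. rscale r \<delta>))"

lemma del: "del \<in> R0" "del \<noteq> 0" "VV = range (\<lambda>r. rscale r del)"
proof -
  have "\<exists>\<delta>. \<delta> \<in> R0 \<and> \<delta> \<noteq> 0 \<and> VV = range (\<lambda>r. rscale r \<delta>)" using delta_exists by blast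
  from someI_ex[OF this] show "del \<in> R0" "del \<noteq> 0" "VV = range (\<lambda>r. rscale r del)"
    unfolding del_def by blast+
qed

lemma R0_R: "\<sigma> \<in> R0 \<Longrightarrow> \<sigma> \<in> R" and R0_df: "\<sigma> \<in> R0 \<Longrightarrow> df \<sigma> \<sigma> = 0"
  by (auto simp: roots_0_def roots_x_def)

lemma R0_I: "\<sigma> \<in> R \<Longrightarrow> df \<sigma> \<sigma> = 0 \<Longrightarrow> \<sigma> \<in> R0" by (simp add: roots_0_def roots_x_def)

lemma del_dual [simp]: "del \<in> dual" using del(1) R0_R R_dual by blast

lemma del_df: "df del del = 0" using del(1) R0_df by blast

lemma R0_VV: "\<sigma> \<in> R0 \<Longrightarrow> \<exists>r. \<sigma> = rscale r del"
proof -
  assume "\<sigma> \<in> R0"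
  hence "\<sigma> \<in> VV" unfolding V0_def by (rule rs.span_base)
  then show ?thesis using del(3) by blast
qed

lemma Rx_not_VV: "\<alpha> \<in> Rx \<Longrightarrow> \<alpha> \<noteq> rscale r del"
  using Rx_nz[of \<alpha>] by (auto simp: df_rscale dual_rscale del_df)

text \<open>Were (\<delta>, \<alpha>) nonzero, reflecting \<delta> in \<alpha> would give an
  isotropic root \<delta> - k \<alpha> with k \<noteq> 0. In nullity one this is a multiple of
  \<delta>, and then so is \<alpha>, which is not isotropic.\<close>

lemma del_Rx: assumes "\<alpha> \<in> Rx" shows "df del \<alpha> = 0"
proof (rule ccontr)
  assume nz: "df del \<alpha> \<noteq> 0"
  have d: "\<alpha> \<in> dual" using assms Rx_dual by blast
  obtain k :: int where k: "del (cr \<alpha>) = of_int k" "del - rscale (of_int k) \<alpha> \<in> R"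
    using reflection[OF assms R0_R[OF del(1)]] by blast
  have k2: "2 * df del \<alpha> = of_int k * df \<alpha> \<alpha>" using k(1) Rx_nz[OF assms] by (simp add: cr_eval d field_simps)
  hence k0: "k \<noteq> 0" using nz by auto
  let ?\<sigma> = "del - rscale (of_int k) \<alpha>"
  have "df ?\<sigma> ?\<sigma> = of_int k * (of_int k * df \<alpha> \<alpha> - 2 * df del \<alpha>)"
    using d by (simp add: df_diff df_rscale dual_rscale dual_diff del_df df_sym[of \<alpha> del] algebra_simps)
  hence "?\<sigma> \<in> R0" using k(2) k2 by (intro R0_I) auto
  then obtain r where "?\<sigma> = rscale r del" using R0_VV by blast
  hence "\<alpha> = rscale ((1 - r) / of_int k) del"
    using k0 by (simp add: rscale_def fun_eq_iff field_simps)
  then show False using Rx_not_VV[OF assms] by blast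
qed

lemma del_R: assumes "\<alpha> \<in> R" shows "df del \<alpha> = 0"
proof (cases "\<alpha> \<in> Rx")
  case False
  hence "\<alpha> \<in> R0" using assms by (simp add: roots_0_def)
  then obtain r where "\<alpha> = rscale r del" using R0_VV by blast
  then show ?thesis by (simp add: df_rscale del_df)
qed (rule del_Rx)

definition D where "D = Rd - {0}"

lemma D: "finite D" "\<gamma> \<in> D \<Longrightarrow> \<gamma> \<in> Rx" "\<gamma> \<in> D \<Longrightarrow> \<gamma> \<in> dual"
    "\<gamma>0 \<in> D \<Longrightarrow> \<gamma> \<in> D \<Longrightarrow> \<exists>k::int. \<gamma> (cr \<gamma>0) = of_int k \<and> \<gamma> - rscale (of_int k) \<gamma>0 \<in> D"
proof -
  have rd: "fin_root_system B H Rd" "Rd \<subseteq> R" using Rdot by (auto simp: Rdot_ok_def)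
  show "finite D" using rd by (simp add: fin_root_system_def D_def)
  show x: "\<gamma> \<in> D \<Longrightarrow> \<gamma> \<in> Rx" for \<gamma> using rd by (auto simp: fin_root_system_def D_def intro!: Rx_I)
  then show d: "\<gamma> \<in> D \<Longrightarrow> \<gamma> \<in> dual" for \<gamma> using Rx_dual by blast
  show "\<exists>k::int. \<gamma> (cr \<gamma>0) = of_int k \<and> \<gamma> - rscale (of_int k) \<gamma>0 \<in> D" if g: "\<gamma>0 \<in> D" "\<gamma> \<in> D"
  proof -
    have "\<forall>\<beta>\<in>Rd. \<exists>k::int. 2 * df \<beta> \<gamma>0 / df \<gamma>0 \<gamma>0 = of_int k \<and> \<beta> - rscale (of_int k) \<gamma>0 \<in> Rd"
      using rd(1) g(1) by (simp add: fin_root_system_def D_def)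
    then obtain k :: int where k: "2 * df \<gamma> \<gamma>0 / df \<gamma>0 \<gamma>0 = of_int k" "\<gamma> - rscale (of_int k) \<gamma>0 \<in> Rd"
      using g(2) D_def by blast
    have gk: "\<gamma> (cr \<gamma>0) = of_int k" using k(1) g d by (simp add: cr_eval)
    have "\<gamma> - rscale (of_int k) \<gamma>0 \<noteq> 0"
    proof
      assume "\<gamma> - rscale (of_int k) \<gamma>0 = 0"
      hence eq: "\<gamma> = rscale (of_int k) \<gamma>0" by simp
      have "\<gamma>0 (cr \<gamma>0) = 2" using g d Rx_nz[OF x] by (simp add: cr_eval)
      hence "\<gamma> (cr \<gamma>0) = of_int k * 2" by (subst eq) (simp add: rscale_def)
      hence "k = 0" using gk by simp
      hence "\<gamma> = 0" using eq by simp
      then show False using g(2) by (simp add: D_def)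
    qed
    then show ?thesis using k gk by (auto simp: D_def)
  qed
qed

lemma R_split: assumes "\<alpha> \<in> R" shows "\<exists>\<gamma>\<in>Rd. \<exists>r. \<alpha> = \<gamma> + rscale r del"
proof -
  have "\<alpha> \<in> set_sum Rd VV" using Rdot assms by (auto simp: Rdot_ok_def)
  then show ?thesis using del(3) by (auto simp: set_sum_def)
qed

lemma Rx_split: assumes "\<alpha> \<in> Rx" shows "\<exists>\<gamma>\<in>D. \<exists>r. \<alpha> = \<gamma> + rscale r del"
proof -
  obtain \<gamma> r where g: "\<gamma> \<in> Rd" "\<alpha> = \<gamma> + rscale r del" using R_split[OF Rx_R[OF assms]] by blast
  have "\<gamma> \<noteq> 0" using Rx_not_VV[OF assms, of r] g by auto
  then show ?thesis using g by (auto simp: D_def)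
qed

lemma del_cr: "\<alpha> \<in> Rx \<Longrightarrow> del (cr \<alpha>) = 0"
  by (simp add: cr_eval Rx_dual del_Rx)

section \<open>A positive semidefinite real form proportional to the given form\<close>

definition bc where "bc \<phi> \<mu> = (\<Sum>\<gamma>\<in>D. \<phi> (cr \<gamma>) * \<mu> (cr \<gamma>))" for \<phi> \<mu> :: "'a \<Rightarrow> complex"

text \<open>On roots it agrees with \<open>bc\<close> because coroot values there are integers. Real
  parts make it real bilinear and semidefinite on all functions, as \<open>affine_roots\<close>
  demands.\<close>

definition q where "q \<phi> \<mu> = (\<Sum>\<gamma>\<in>D. Re (\<phi> (cr \<gamma>)) * Re (\<mu> (cr \<gamma>)))" for \<phi> \<mu> :: "'a \<Rightarrow> complex"

lemma bc_sym: "bc \<phi> \<mu> = bc \<mu> \<phi>" by (simp add: bc_def mult.commute)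

lemma R_cr_int: "\<alpha> \<in> Rx \<Longrightarrow> \<beta> \<in> R \<Longrightarrow> \<exists>k::int. \<beta> (cr \<alpha>) = of_int k"
  using reflection by blast

lemma R_cr_real: "\<gamma> \<in> D \<Longrightarrow> \<beta> \<in> R \<Longrightarrow> \<beta> (cr \<gamma>) = of_real (Re (\<beta> (cr \<gamma>)))"
  using R_cr_int[OF D(2)] by fastforce

lemma bc_q: assumes "\<alpha> \<in> R" "\<beta> \<in> R" shows "bc \<alpha> \<beta> = of_real (q \<alpha> \<beta>)"
proof -
  have "bc \<alpha> \<beta> = (\<Sum>\<gamma>\<in>D. of_real (Re (\<alpha> (cr \<gamma>)) * Re (\<beta> (cr \<gamma>))))"
    unfolding bc_def
  proof (rule sum.cong[OF refl])
    fix \<gamma> assume "\<gamma> \<in> D"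
    then show "\<alpha> (cr \<gamma>) * \<beta> (cr \<gamma>) = of_real (Re (\<alpha> (cr \<gamma>)) * Re (\<beta> (cr \<gamma>)))"
      using R_cr_real[of \<gamma> \<alpha>] R_cr_real[of \<gamma> \<beta>] assms by (metis of_real_mult)
  qed
  then show ?thesis by (simp add: q_def)
qed

text \<open>The reflection in \<gamma>0 with the coroot value as a complex coefficient, so that no
  integer has to be chosen.\<close>

definition sg where "sg \<gamma>0 \<gamma> = \<gamma> - (\<lambda>h. \<gamma> (cr \<gamma>0) * \<gamma>0 h)" for \<gamma>0 \<gamma> :: "'a \<Rightarrow> complex"

lemma sg_D: assumes "\<gamma>0 \<in> D" "\<gamma> \<in> D" shows "sg \<gamma>0 \<gamma> \<in> D"
proof -
  obtain k :: int where k: "\<gamma> (cr \<gamma>0) = of_int k" "\<gamma> - rscale (of_int k) \<gamma>0 \<in> D" using D(4)[OF assms] by blast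
  have "sg \<gamma>0 \<gamma> = \<gamma> - rscale (of_int k) \<gamma>0" by (simp add: sg_def k(1) rscale_def)
  then show ?thesis using k(2) by simp
qed

lemma cr_self: "\<alpha> \<in> Rx \<Longrightarrow> \<alpha> (cr \<alpha>) = 2" by (simp add: cr_eval Rx_dual Rx_nz)

lemma sg_sg: assumes "\<gamma>0 \<in> D" shows "sg \<gamma>0 (sg \<gamma>0 \<gamma>) = \<gamma>"
  using cr_self[OF D(2)[OF assms]] by (simp add: sg_def fun_eq_iff algebra_simps)

lemma sg_bij: "\<gamma>0 \<in> D \<Longrightarrow> bij_betw (sg \<gamma>0) D D"
  by (rule bij_betw_byWitness[where f'="sg \<gamma>0"]) (auto simp: sg_sg sg_D)

text \<open>Coroots are reflected along with roots: the reflection preserves (\<gamma>, \<gamma>),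
  so only the numerator of the coroot value changes.\<close>

lemma cr_sg: assumes "\<gamma>0 \<in> D" "\<gamma> \<in> D" "\<mu> \<in> dual"
  shows "\<mu> (cr (sg \<gamma>0 \<gamma>)) = \<mu> (cr \<gamma>) - \<gamma>0 (cr \<gamma>) * \<mu> (cr \<gamma>0)"
proof -
  note d = D(3)[OF assms(1)] D(3)[OF assms(2)]
  note nz = Rx_nz[OF D(2)[OF assms(1)]] Rx_nz[OF D(2)[OF assms(2)]]
  obtain k :: int where k: "\<gamma> (cr \<gamma>0) = of_int k" using D(4)[OF assms(1,2)] by blast
  have s: "sg \<gamma>0 \<gamma> = \<gamma> - rscale (of_int k) \<gamma>0" by (simp add: sg_def k rscale_def)
  have k2: "2 * df \<gamma> \<gamma>0 = of_int k * df \<gamma>0 \<gamma>0" using k nz by (simp add: cr_eval d field_simps)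
  have ss: "df (sg \<gamma>0 \<gamma>) (sg \<gamma>0 \<gamma>) = df \<gamma> \<gamma> + of_int k * (of_int k * df \<gamma>0 \<gamma>0 - 2 * df \<gamma> \<gamma>0)"
    unfolding s using d by (simp add: df_diff df_rscale dual_rscale dual_diff df_sym[of \<gamma>0 \<gamma>] algebra_simps)
  have m: "df \<mu> (sg \<gamma>0 \<gamma>) = df \<mu> \<gamma> - of_int k * df \<mu> \<gamma>0"
    unfolding s using d assms(3) by (simp add: df_diff df_rscale dual_rscale)
  have "\<mu> (cr (sg \<gamma>0 \<gamma>)) = 2 * (df \<mu> \<gamma> - of_int k * df \<mu> \<gamma>0) / df \<gamma> \<gamma>"
    using sg_D[OF assms(1,2)] D(3) assms(3) ss m k2 by (simp add: cr_eval)
  also have "\<dots> = 2 * df \<mu> \<gamma> / df \<gamma> \<gamma> - (of_int k * df \<gamma>0 \<gamma>0) * (2 * df \<mu> \<gamma>0 / df \<gamma>0 \<gamma>0) / df \<gamma> \<gamma>"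
    using nz by (simp add: field_simps)
  also have "\<dots> = 2 * df \<mu> \<gamma> / df \<gamma> \<gamma> - (2 * df \<gamma>0 \<gamma> / df \<gamma> \<gamma>) * (2 * df \<mu> \<gamma>0 / df \<gamma>0 \<gamma>0)"
    unfolding k2[symmetric] df_sym[OF d(1,2)] by simp
  finally show ?thesis using d assms(3) by (simp add: cr_eval)
qed

text \<open>Reindexing the sum over \<open>D\<close> by the reflection in \<gamma>0 gives
  \<mu>(coroot of \<gamma>0) times bc \<gamma>0 \<gamma>0, minus the original sum.\<close>

lemma bc_D: assumes "\<gamma>0 \<in> D" "\<mu> \<in> dual" shows "2 * bc \<gamma>0 \<mu> = \<mu> (cr \<gamma>0) * bc \<gamma>0 \<gamma>0"
proof -
  have 2: "\<gamma>0 (cr \<gamma>0) = 2" using cr_self D(2) assms(1) by blast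
  have "bc \<gamma>0 \<mu> = (\<Sum>\<gamma>\<in>D. \<gamma>0 (cr (sg \<gamma>0 \<gamma>)) * \<mu> (cr (sg \<gamma>0 \<gamma>)))"
    unfolding bc_def by (rule sum.reindex_bij_betw[OF sg_bij[OF assms(1)], symmetric])
  also have "\<dots> = (\<Sum>\<gamma>\<in>D. \<mu> (cr \<gamma>0) * (\<gamma>0 (cr \<gamma>) * \<gamma>0 (cr \<gamma>)) - \<gamma>0 (cr \<gamma>) * \<mu> (cr \<gamma>))"
  proof (intro sum.cong refl)
    fix \<gamma> assume "\<gamma> \<in> D"
    then show "\<gamma>0 (cr (sg \<gamma>0 \<gamma>)) * \<mu> (cr (sg \<gamma>0 \<gamma>)) = \<mu> (cr \<gamma>0) * (\<gamma>0 (cr \<gamma>) * \<gamma>0 (cr \<gamma>)) - \<gamma>0 (cr \<gamma>) * \<mu> (cr \<gamma>)"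
      unfolding cr_sg[OF assms(1) \<open>\<gamma> \<in> D\<close> assms(2)] cr_sg[OF assms(1) \<open>\<gamma> \<in> D\<close> D(3)[OF assms(1)]]
      by (simp add: 2 algebra_simps)
  qed
  also have "\<dots> = \<mu> (cr \<gamma>0) * bc \<gamma>0 \<gamma>0 - bc \<gamma>0 \<mu>"
    by (simp add: bc_def sum_subtractf sum_distrib_left)
  finally show ?thesis by (simp add: algebra_simps)
qed

lemma df_shift: assumes "\<gamma> \<in> dual" "\<beta> \<in> R" shows "df (\<gamma> + rscale r del) \<beta> = df \<gamma> \<beta>"
  using assms R_dual by (simp add: df_add df_rscale dual_rscale del_R)

lemma bc_shift: "bc (\<gamma> + rscale r del) \<beta> = bc \<gamma> \<beta>"
  unfolding bc_def by (intro sum.cong refl) (simp add: rscale_def del_cr[OF D(2)])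

text \<open>Both forms express the same coroot values at the representative of \<alpha> in
  \<open>D\<close>, and neither changes when a multiple of \<delta> is added.\<close>

lemma bc_df: assumes "\<alpha> \<in> Rx" "\<beta> \<in> R" shows "bc \<alpha> \<beta> * df \<alpha> \<alpha> = df \<alpha> \<beta> * bc \<alpha> \<alpha>"
proof -
  obtain \<gamma> r where g: "\<gamma> \<in> D" "\<alpha> = \<gamma> + rscale r del" using Rx_split[OF assms(1)] by blast
  have gd: "\<gamma> \<in> dual" "\<gamma> \<in> R" "df \<gamma> \<gamma> \<noteq> 0" using g D Rx_R Rx_nz by blast+
  have aR: "\<alpha> \<in> R" using assms Rx_R by blast
  have "df \<alpha> \<beta> = df \<gamma> \<beta>" using g(2) df_shift[OF gd(1) assms(2)] by simp
  moreover have "df \<alpha> \<alpha> = df \<gamma> \<gamma>"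
  proof -
    have "df \<alpha> \<alpha> = df \<gamma> \<alpha>" using df_shift[OF gd(1) aR] g(2) by simp
    also have "\<dots> = df \<alpha> \<gamma>" using gd aR R_dual by (intro df_sym) auto
    also have "\<dots> = df \<gamma> \<gamma>" using df_shift[OF gd(1,2)] g(2) by simp
    finally show ?thesis .
  qed
  moreover have "bc \<alpha> \<beta> = bc \<gamma> \<beta>" "bc \<alpha> \<alpha> = bc \<gamma> \<gamma>"
    using bc_shift bc_sym g(2) by metis+
  moreover have "2 * bc \<gamma> \<beta> * df \<gamma> \<gamma> = 2 * df \<gamma> \<beta> * bc \<gamma> \<gamma>"
    using bc_D[OF g(1), of \<beta>] gd assms(2) R_dual df_sym[of \<beta> \<gamma>] by (simp add: cr_eval field_simps)
  ultimately show ?thesis by simp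
qed

lemma q_self_pos: assumes "\<alpha> \<in> Rx" shows "q \<alpha> \<alpha> > 0"
proof -
  obtain \<gamma> r where g: "\<gamma> \<in> D" "\<alpha> = \<gamma> + rscale r del" using Rx_split[OF assms(1)] by blast
  have "\<alpha> (cr \<gamma>) = 2" using g cr_self[OF D(2)[OF g(1)]] del_cr[OF D(2)[OF g(1)]] by (simp add: rscale_def)
  then show ?thesis unfolding q_def using D(1) g(1)
    by (intro sum_pos2[of _ \<gamma>]) auto
qed

lemma Rx_nonempty: "Rx \<noteq> {}"
  using eala del(1) by (auto simp: eala_def)

lemma bc_nz: "\<alpha> \<in> Rx \<Longrightarrow> bc \<alpha> \<alpha> \<noteq> 0"
  using q_self_pos bc_q[OF Rx_R Rx_R, of \<alpha> \<alpha>] by force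

text \<open>By symmetry and \<open>bc_df\<close>, two nonorthogonal roots have the same ratio of the
  two forms. Roots with the ratio of \<alpha>0 are thus orthogonal to all others, and connectedness
  makes the ratio constant.\<close>

lemma kappa_exists: "\<exists>\<kappa>. \<kappa> \<noteq> 0 \<and> (\<forall>\<alpha>\<in>Rx. df \<alpha> \<alpha> = \<kappa> * bc \<alpha> \<alpha>)"
proof -
  obtain \<alpha>0 where a0: "\<alpha>0 \<in> Rx" using Rx_nonempty by blast
  define k where "k \<alpha> = df \<alpha> \<alpha> / bc \<alpha> \<alpha>" for \<alpha>
  define A where "A = {\<alpha> \<in> Rx. k \<alpha> = k \<alpha>0}"
  define C where "C = {\<alpha> \<in> Rx. k \<alpha> \<noteq> k \<alpha>0}"
  have "df a c = 0" if ac: "a \<in> A" "c \<in> C" for a c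
  proof (rule ccontr)
    assume nz: "df a c \<noteq> 0"
    have x: "a \<in> Rx" "c \<in> Rx" using ac by (auto simp: A_def C_def)
    have 1: "bc a c * k a = df a c" using bc_df[OF x(1) Rx_R[OF x(2)]] bc_nz[OF x(1)] by (simp add: k_def field_simps)
    have 2: "bc c a * k c = df c a" using bc_df[OF x(2) Rx_R[OF x(1)]] bc_nz[OF x(2)] by (simp add: k_def field_simps)
    have "bc a c * k a = bc a c * k c"
      using 1 2 bc_sym[of a c] df_sym[of a c] x Rx_dual by simp
    moreover have "bc a c \<noteq> 0" using 1 nz by auto
    ultimately have "k a = k c" by simp
    then show False using ac by (simp add: A_def C_def)
  qed
  moreover have "A \<noteq> {}" using a0 by (auto simp: A_def)
  moreover have "A \<union> C = Rx" by (auto simp: A_def C_def)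
  moreover have "\<not> (\<exists>A C. A \<noteq> {} \<and> C \<noteq> {} \<and> A \<union> C = Rx \<and> (\<forall>a\<in>A. \<forall>c\<in>C. df a c = 0))"
    using eala by (simp add: eala_def)
  ultimately have "C = {}" by blast
  hence all: "k \<alpha> = k \<alpha>0" if "\<alpha> \<in> Rx" for \<alpha> using that by (auto simp: C_def)
  have "k \<alpha>0 \<noteq> 0" using bc_nz[OF a0] Rx_nz[OF a0] by (simp add: k_def)
  moreover have "df \<alpha> \<alpha> = k \<alpha>0 * bc \<alpha> \<alpha>" if "\<alpha> \<in> Rx" for \<alpha>
    using all[OF that] bc_nz[OF that] by (simp add: k_def field_simps)
  ultimately show ?thesis by blast
qed

definition kap where "kap = (SOME \<kappa>. \<kappa> \<noteq> 0 \<and> (\<forall>\<alpha>\<in>Rx. df \<alpha> \<alpha> = \<kappa> * bc \<alpha> \<alpha>))"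

lemma kap: "kap \<noteq> 0" "\<alpha> \<in> Rx \<Longrightarrow> df \<alpha> \<alpha> = kap * bc \<alpha> \<alpha>"
  using someI_ex[OF kappa_exists] unfolding kap_def by blast+

lemma df_q: assumes "\<alpha> \<in> Rx" "\<beta> \<in> R" shows "df \<alpha> \<beta> = kap * of_real (q \<alpha> \<beta>)"
proof -
  have "bc \<alpha> \<beta> * kap = df \<alpha> \<beta>" using bc_df[OF assms] kap(2)[OF assms(1)] bc_nz[OF assms(1)] by (simp add: mult.assoc)
  then show ?thesis using bc_q[OF Rx_R[OF assms(1)] assms(2)] by (simp add: mult.commute)
qed

text \<open>The same reindexing as in \<open>bc_D\<close>, applied to roots instead of coroot
  values: each \<gamma>0 is an eigenvector of the operator sending \<gamma>0 to the sum of the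
  \<gamma> weighted by \<gamma>0(coroot of \<gamma>).\<close>

lemma sum_D_reflect:
  assumes "\<gamma>0 \<in> D"
  shows "2 * (\<Sum>\<gamma>\<in>D. \<gamma>0 (cr \<gamma>) * \<gamma> h) = (\<Sum>\<gamma>\<in>D. \<gamma>0 (cr \<gamma>) * \<gamma> (cr \<gamma>0)) * \<gamma>0 h"
proof -
  have 2: "\<gamma>0 (cr \<gamma>0) = 2" using cr_self D(2) assms(1) by blast
  let ?s = "\<Sum>\<gamma>\<in>D. \<gamma>0 (cr \<gamma>) * \<gamma> h"
  have "?s = (\<Sum>\<gamma>\<in>D. \<gamma>0 (cr (sg \<gamma>0 \<gamma>)) * sg \<gamma>0 \<gamma> h)"
    by (rule sum.reindex_bij_betw[OF sg_bij[OF assms(1)], symmetric])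
  also have "\<dots> = (\<Sum>\<gamma>\<in>D. (\<gamma>0 (cr \<gamma>) * \<gamma> (cr \<gamma>0)) * \<gamma>0 h - \<gamma>0 (cr \<gamma>) * \<gamma> h)"
  proof (intro sum.cong refl)
    fix \<gamma> assume g: "\<gamma> \<in> D"
    show "\<gamma>0 (cr (sg \<gamma>0 \<gamma>)) * sg \<gamma>0 \<gamma> h = (\<gamma>0 (cr \<gamma>) * \<gamma> (cr \<gamma>0)) * \<gamma>0 h - \<gamma>0 (cr \<gamma>) * \<gamma> h"
      unfolding cr_sg[OF assms(1) g D(3)[OF assms(1)]] by (simp add: 2 sg_def algebra_simps)
  qed
  also have "\<dots> = (\<Sum>\<gamma>\<in>D. \<gamma>0 (cr \<gamma>) * \<gamma> (cr \<gamma>0)) * \<gamma>0 h - ?s"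
    by (simp add: sum_subtractf sum_distrib_right)
  finally show ?thesis by (simp add: algebra_simps)
qed

lemma D_eval: assumes "\<gamma> \<in> D" "\<gamma>0 \<in> D" shows "\<gamma>0 (cr \<gamma>) * df \<gamma> \<gamma> = \<gamma> (cr \<gamma>0) * df \<gamma>0 \<gamma>0"
  using assms Rx_nz[OF D(2)[OF assms(1)]] Rx_nz[OF D(2)[OF assms(2)]]
  by (simp add: cr_eval D(3) df_sym[of \<gamma>0 \<gamma>])

text \<open>Each summand is 4 cos^2 of an angle measured by \<open>q\<close>, as \<open>kap\<close>
  cancels. Writing the sum as 2 c makes c the eigenvalue in \<open>sum_D_reflect\<close>.\<close>

lemma D_coeff_pos:
  assumes "\<gamma>0 \<in> D"
  shows "\<exists>c::real. c > 0 \<and> (\<Sum>\<gamma>\<in>D. \<gamma>0 (cr \<gamma>) * \<gamma> (cr \<gamma>0)) = 2 * of_real c"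
proof -
  define g where "g \<gamma> = 4 * (q \<gamma>0 \<gamma>)\<^sup>2 / (q \<gamma> \<gamma> * q \<gamma>0 \<gamma>0)" for \<gamma>
  note x0 = D(2)[OF assms]
  have "\<gamma>0 (cr \<gamma>) * \<gamma> (cr \<gamma>0) = of_real (g \<gamma>)" if "\<gamma> \<in> D" for \<gamma>
  proof -
    note x = D(2)[OF that]
    have "df \<gamma> \<gamma>0 = df \<gamma>0 \<gamma>" using D(3) that assms df_sym by blast
    then have "\<gamma>0 (cr \<gamma>) * \<gamma> (cr \<gamma>0) = (2 * df \<gamma>0 \<gamma> / df \<gamma> \<gamma>) * (2 * df \<gamma>0 \<gamma> / df \<gamma>0 \<gamma>0)"
      using D(3) that assms by (simp add: cr_eval)
    also have "\<dots> = of_real (g \<gamma>)"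
      unfolding df_q[OF x0 Rx_R[OF x]] df_q[OF x0 Rx_R[OF x0]] df_q[OF x Rx_R[OF x]] g_def
      using kap(1) by (simp add: power2_eq_square field_simps)
    finally show ?thesis .
  qed
  hence "(\<Sum>\<gamma>\<in>D. \<gamma>0 (cr \<gamma>) * \<gamma> (cr \<gamma>0)) = 2 * of_real ((\<Sum>\<gamma>\<in>D. g \<gamma>) / 2)" by simp
  moreover have "(\<Sum>\<gamma>\<in>D. g \<gamma>) > 0"
  proof (rule sum_pos2[OF D(1) assms])
    show "g \<gamma>0 > 0" using q_self_pos[OF x0] by (simp add: g_def)
    show "\<And>\<gamma>. \<gamma> \<in> D \<Longrightarrow> g \<gamma> \<ge> 0" using q_self_pos D(2) assms
      unfolding g_def by (intro divide_nonneg_nonneg mult_nonneg_nonneg) (auto intro: less_imp_le)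
  qed
  ultimately show ?thesis by (metis half_gt_zero)
qed

text \<open>On the span of the finite root system, the operator \<open>u \<mapsto> \<Sum>\<gamma>. u(\<gamma>\<^sup>\<or>) \<gamma>\<close> is diagonalised by
  the roots with positive eigenvalues, so \<open>y\<close> is the image of some \<open>u\<close>, and then \<open>(y, u)\<close> is a
  positive multiple of the sum of the squares \<open>u(\<gamma>\<^sup>\<or>)\<^sup>2\<close>.\<close>
lemma D_radical:
  assumes y: "\<And>h. y h = (\<Sum>\<gamma>\<in>D. of_real (a \<gamma>) * \<gamma> h)" and 0: "\<And>\<gamma>. \<gamma> \<in> D \<Longrightarrow> y (cr \<gamma>) = 0"
  shows "y h = 0"
proof -
  obtain c where c: "\<And>\<gamma>0. \<gamma>0 \<in> D \<Longrightarrow> (c \<gamma>0 :: real) > 0"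
      "\<And>\<gamma>0. \<gamma>0 \<in> D \<Longrightarrow> (\<Sum>\<gamma>\<in>D. \<gamma>0 (cr \<gamma>) * \<gamma> (cr \<gamma>0)) = 2 * of_real (c \<gamma>0)"
    using D_coeff_pos by metis
  define u where "u h = (\<Sum>\<gamma>\<in>D. of_real (a \<gamma> / c \<gamma>) * \<gamma> h)" for h
  have Tu: "(\<Sum>\<gamma>\<in>D. u (cr \<gamma>) * \<gamma> h) = y h" for h
  proof -
    have "(\<Sum>\<gamma>\<in>D. u (cr \<gamma>) * \<gamma> h) = (\<Sum>\<gamma>\<in>D. \<Sum>\<gamma>0\<in>D. of_real (a \<gamma>0 / c \<gamma>0) * (\<gamma>0 (cr \<gamma>) * \<gamma> h))"
      by (simp add: u_def sum_distrib_right mult.assoc)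
    also have "\<dots> = (\<Sum>\<gamma>0\<in>D. of_real (a \<gamma>0 / c \<gamma>0) * (\<Sum>\<gamma>\<in>D. \<gamma>0 (cr \<gamma>) * \<gamma> h))"
      by (subst sum.swap) (simp add: sum_distrib_left)
    also have "\<dots> = (\<Sum>\<gamma>0\<in>D. of_real (a \<gamma>0) * \<gamma>0 h)"
    proof (intro sum.cong refl)
      fix \<gamma>0 assume g: "\<gamma>0 \<in> D"
      have "(\<Sum>\<gamma>\<in>D. \<gamma>0 (cr \<gamma>) * \<gamma> h) = of_real (c \<gamma>0) * \<gamma>0 h"
        using sum_D_reflect[OF g, of h] c(2)[OF g] by simp
      then show "of_real (a \<gamma>0 / c \<gamma>0) * (\<Sum>\<gamma>\<in>D. \<gamma>0 (cr \<gamma>) * \<gamma> h) = of_real (a \<gamma>0) * \<gamma>0 h"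
        using c(1)[OF g] by simp
    qed
    finally show ?thesis by (simp add: y)
  qed
  have ur: "u (cr \<gamma>) = of_real (Re (u (cr \<gamma>)))" if "\<gamma> \<in> D" for \<gamma>
  proof -
    have "u (cr \<gamma>) = (\<Sum>\<gamma>0\<in>D. of_real (a \<gamma>0 / c \<gamma>0 * Re (\<gamma>0 (cr \<gamma>))))"
      unfolding u_def
    proof (intro sum.cong refl)
      fix \<gamma>0 assume "\<gamma>0 \<in> D"
      then show "of_real (a \<gamma>0 / c \<gamma>0) * \<gamma>0 (cr \<gamma>) = of_real (a \<gamma>0 / c \<gamma>0 * Re (\<gamma>0 (cr \<gamma>)))"
        using R_cr_real[OF that, of \<gamma>0] Rx_R[OF D(2), of \<gamma>0] by (metis of_real_mult)
    qed
    also have "\<dots> = of_real (\<Sum>\<gamma>0\<in>D. a \<gamma>0 / c \<gamma>0 * Re (\<gamma>0 (cr \<gamma>)))" by simp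
    finally show ?thesis by (metis Re_complex_of_real)
  qed
  \<comment> \<open>A coroot value times the squared length is twice a pairing, so this sum is 2 (y,
    u); it vanishes because y vanishes on all coroots. Expanding y through u instead turns it into
    \<open>kap\<close> times a sum of squares.\<close>
  have "0 = (\<Sum>\<gamma>0\<in>D. of_real (a \<gamma>0 / c \<gamma>0) * df \<gamma>0 \<gamma>0 * y (cr \<gamma>0))" using 0 by simp
  also have "\<dots> = (\<Sum>\<gamma>0\<in>D. \<Sum>\<gamma>\<in>D. u (cr \<gamma>) * df \<gamma> \<gamma> * (of_real (a \<gamma>0 / c \<gamma>0) * \<gamma>0 (cr \<gamma>)))"
  proof (intro sum.cong refl)
    fix \<gamma>0 assume g: "\<gamma>0 \<in> D"
    have "of_real (a \<gamma>0 / c \<gamma>0) * df \<gamma>0 \<gamma>0 * y (cr \<gamma>0) =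
        (\<Sum>\<gamma>\<in>D. of_real (a \<gamma>0 / c \<gamma>0) * u (cr \<gamma>) * (\<gamma> (cr \<gamma>0) * df \<gamma>0 \<gamma>0))"
      unfolding Tu[symmetric] sum_distrib_left by (simp add: mult_ac)
    also have "\<dots> = (\<Sum>\<gamma>\<in>D. of_real (a \<gamma>0 / c \<gamma>0) * u (cr \<gamma>) * (\<gamma>0 (cr \<gamma>) * df \<gamma> \<gamma>))"
      using D_eval[OF _ g] by (intro sum.cong) auto
    finally show "of_real (a \<gamma>0 / c \<gamma>0) * df \<gamma>0 \<gamma>0 * y (cr \<gamma>0) =
        (\<Sum>\<gamma>\<in>D. u (cr \<gamma>) * df \<gamma> \<gamma> * (of_real (a \<gamma>0 / c \<gamma>0) * \<gamma>0 (cr \<gamma>)))"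
      by (simp add: mult_ac)
  qed
  also have "\<dots> = (\<Sum>\<gamma>\<in>D. u (cr \<gamma>) * df \<gamma> \<gamma> * u (cr \<gamma>))"
    by (subst sum.swap) (simp add: u_def sum_distrib_left)
  also have "\<dots> = (\<Sum>\<gamma>\<in>D. kap * of_real ((Re (u (cr \<gamma>)))\<^sup>2 * q \<gamma> \<gamma>))"
  proof (intro sum.cong refl)
    fix \<gamma> assume g: "\<gamma> \<in> D"
    have "u (cr \<gamma>) * df \<gamma> \<gamma> * u (cr \<gamma>) = of_real (Re (u (cr \<gamma>))) * (kap * of_real (q \<gamma> \<gamma>)) * of_real (Re (u (cr \<gamma>)))"
      using ur[OF g] df_q[OF D(2)[OF g] Rx_R[OF D(2)[OF g]]] by simp
    then show "u (cr \<gamma>) * df \<gamma> \<gamma> * u (cr \<gamma>) = kap * of_real ((Re (u (cr \<gamma>)))\<^sup>2 * q \<gamma> \<gamma>)"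
      by (simp add: power2_eq_square mult_ac)
  qed
  also have "\<dots> = kap * of_real (\<Sum>\<gamma>\<in>D. (Re (u (cr \<gamma>)))\<^sup>2 * q \<gamma> \<gamma>)" by (simp add: sum_distrib_left)
  finally have "kap * of_real (\<Sum>\<gamma>\<in>D. (Re (u (cr \<gamma>)))\<^sup>2 * q \<gamma> \<gamma>) = 0" by (rule sym)
  hence "(\<Sum>\<gamma>\<in>D. (Re (u (cr \<gamma>)))\<^sup>2 * q \<gamma> \<gamma>) = 0" using kap(1) by (simp only: mult_eq_0_iff of_real_eq_0_iff) blast
  moreover have "\<And>\<gamma>. \<gamma> \<in> D \<Longrightarrow> (Re (u (cr \<gamma>)))\<^sup>2 * q \<gamma> \<gamma> \<ge> 0"
    using q_self_pos D(2) by (intro mult_nonneg_nonneg) (auto intro: less_imp_le)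
  ultimately have "\<forall>\<gamma>\<in>D. (Re (u (cr \<gamma>)))\<^sup>2 * q \<gamma> \<gamma> = 0" using D(1) by (simp add: sum_nonneg_eq_0_iff)
  hence "Re (u (cr \<gamma>)) = 0" if "\<gamma> \<in> D" for \<gamma>
    using that q_self_pos[OF D(2)[OF that]] by fastforce
  hence "u (cr \<gamma>) = 0" if "\<gamma> \<in> D" for \<gamma> using ur[OF that] that by simp
  then show ?thesis using Tu[of h] by simp
qed

lemma span_Rx_repr:
  assumes "x \<in> rs.span Rx"
  shows "\<exists>a r. \<forall>h. x h = (\<Sum>\<gamma>\<in>D. of_real (a \<gamma>) * \<gamma> h) + of_real r * del h"
  using assms
proof (induction rule: rs.span_induct_alt)
  case base
  show ?case by (rule exI[of _ "\<lambda>_. 0"], rule exI[of _ 0]) simp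
next
  case (step c \<alpha> x)
  then obtain a r where x: "\<And>h. x h = (\<Sum>\<gamma>\<in>D. of_real (a \<gamma>) * \<gamma> h) + of_real r * del h" by blast
  obtain \<gamma>0 r0 where g: "\<gamma>0 \<in> D" "\<alpha> = \<gamma>0 + rscale r0 del" using Rx_split[OF step(1)] by blast
  define a' where "a' \<gamma> = a \<gamma> + (if \<gamma> = \<gamma>0 then c else 0)" for \<gamma>
  have "(rscale c \<alpha> + x) h = (\<Sum>\<gamma>\<in>D. of_real (a' \<gamma>) * \<gamma> h) + of_real (c * r0 + r) * del h" for h
  proof -
    have "(\<Sum>\<gamma>\<in>D. of_real (a' \<gamma>) * \<gamma> h) = (\<Sum>\<gamma>\<in>D. of_real (a \<gamma>) * \<gamma> h + (if \<gamma> = \<gamma>0 then of_real c * \<gamma> h else 0))"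
      by (intro sum.cong) (auto simp: a'_def algebra_simps)
    also have "\<dots> = (\<Sum>\<gamma>\<in>D. of_real (a \<gamma>) * \<gamma> h) + of_real c * \<gamma>0 h"
      using D(1) g(1) by (simp add: sum.distrib)
    finally show ?thesis by (simp add: x g(2) rscale_def algebra_simps)
  qed
  then show ?case by blast
qed

text \<open>Modulo \<delta>, x is a real combination y of \<open>D\<close>. Vanishing of q x x kills
  the real parts of the coroot values of y, integrality kills the imaginary parts, and
  \<open>D_radical\<close> gives y = 0.\<close>

lemma radical_Rx:
  assumes "x \<in> rs.span Rx" "q x x = 0"
  shows "\<exists>r. x = rscale r del"
proof -
  obtain a r where x: "\<And>h. x h = (\<Sum>\<gamma>\<in>D. of_real (a \<gamma>) * \<gamma> h) + of_real r * del h"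
    using span_Rx_repr[OF assms(1)] by blast
  define y where "y h = (\<Sum>\<gamma>\<in>D. of_real (a \<gamma>) * \<gamma> h)" for h
  have xc: "x (cr \<gamma>) = y (cr \<gamma>)" if "\<gamma> \<in> D" for \<gamma> using del_cr[OF D(2)[OF that]] by (simp add: x y_def)
  have "(\<Sum>\<gamma>\<in>D. (Re (x (cr \<gamma>)))\<^sup>2) = 0" using assms(2) by (simp add: q_def power2_eq_square)
  hence re: "Re (x (cr \<gamma>)) = 0" if "\<gamma> \<in> D" for \<gamma>
    using that D(1) by (simp add: sum_nonneg_eq_0_iff)
  have "y (cr \<gamma>) = 0" if g: "\<gamma> \<in> D" for \<gamma>
  proof -
    have "Im (y (cr \<gamma>)) = (\<Sum>\<gamma>'\<in>D. a \<gamma>' * Im (\<gamma>' (cr \<gamma>)))" by (simp add: y_def)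
    also have "\<dots> = 0"
    proof (intro sum.neutral ballI)
      fix \<gamma>' assume "\<gamma>' \<in> D"
      hence "\<gamma>' (cr \<gamma>) = of_real (Re (\<gamma>' (cr \<gamma>)))" using R_cr_real[OF g] Rx_R D(2) by blast
      then have "Im (\<gamma>' (cr \<gamma>)) = 0" by (metis Im_complex_of_real)
      then show "a \<gamma>' * Im (\<gamma>' (cr \<gamma>)) = 0" by simp
    qed
    finally show ?thesis using re[OF g] xc[OF g] by (simp add: complex_eq_iff)
  qed
  hence "y h = 0" for h using D_radical[of y a h] by (simp add: y_def)
  hence "x = rscale r del" using x by (auto simp: y_def rscale_def fun_eq_iff)
  then show ?thesis by blast
qed

lemma Rx_shift: assumes "\<gamma> \<in> D" "\<gamma> + rscale r del \<in> R" shows "\<gamma> + rscale r del \<in> Rx"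
proof (rule Rx_I[OF assms(2)])
  have d: "\<gamma> \<in> dual" "\<gamma> \<in> Rx" using D assms by blast+
  show "df (\<gamma> + rscale r del) (\<gamma> + rscale r del) \<noteq> 0"
    using d Rx_nz[OF d(2)] del_Rx[OF d(2)] df_sym[of \<gamma> del]
    by (simp add: df_add df_rscale dual_add dual_rscale del_df)
qed

text \<open>The point reflection of \<open>delta_string\<close>, proved directly for
  \<open>R\<close>: local finiteness of the strings depends on it and is itself needed to
  instantiate \<open>affine_roots\<close>.\<close>

lemma string_refl:
  assumes "\<gamma> \<in> D" "\<gamma> + rscale r del \<in> R" "\<gamma> + rscale s del \<in> R"
  shows "\<gamma> + rscale (2 * r - s) del \<in> R"
proof -
  let ?\<alpha> = "\<gamma> + rscale r del" and ?\<beta> = "\<gamma> + rscale s del"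
  have x: "?\<alpha> \<in> Rx" using Rx_shift assms by blast
  obtain k :: int where k: "?\<beta> (cr ?\<alpha>) = of_int k" "?\<beta> - rscale (of_int k) ?\<alpha> \<in> R"
    using reflection[OF x assms(3)] by blast
  have "?\<beta> = ?\<alpha> + rscale (s - r) del" by (simp add: rscale_def fun_eq_iff algebra_simps)
  hence "?\<beta> (cr ?\<alpha>) = ?\<alpha> (cr ?\<alpha>) + of_real (s - r) * del (cr ?\<alpha>)" by (simp add: rscale_def algebra_simps)
  hence "?\<beta> (cr ?\<alpha>) = 2" using cr_self[OF x] del_cr[OF x] by simp
  hence "k = 2" using k(1) by simp
  hence "- (?\<beta> - rscale 2 ?\<alpha>) \<in> R" using R_neg[OF k(2)] by simp
  moreover have "- (?\<beta> - rscale 2 ?\<alpha>) = \<gamma> + rscale (2 * r - s) del"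
    by (simp add: rscale_def fun_eq_iff algebra_simps)
  ultimately show ?thesis by (simp only:)
qed

lemma string_isolated:
  assumes "\<gamma> \<in> D"
  shows "\<exists>\<eta>>0. \<forall>r. \<gamma> + rscale r del \<in> R \<longrightarrow> \<bar>r\<bar> < \<eta> \<longrightarrow> r = 0"
proof -
  have gR: "\<gamma> \<in> R" using D(2) Rx_R assms by blast
  have "discrete_in_dual sc H R" using eala by (simp add: eala_def)
  then obtain S where S: "finite S" "\<forall>\<alpha>\<in>R. \<exists>\<epsilon>>0. \<forall>\<beta>\<in>R. (\<forall>h\<in>S. cmod (\<beta> h - \<alpha> h) < \<epsilon>) \<longrightarrow> \<beta> = \<alpha>"
    unfolding discrete_in_dual_def by blast
  then obtain \<epsilon> where e: "\<epsilon> > 0" "\<And>\<beta>. \<beta> \<in> R \<Longrightarrow> (\<forall>h\<in>S. cmod (\<beta> h - \<gamma> h) < \<epsilon>) \<Longrightarrow> \<beta> = \<gamma>"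
    using gR by blast
  \<comment> \<open>Bounds \<delta> on the finite spanning set; the summand 1 keeps the divisor
    positive.\<close>
  define M where "M = 1 + (\<Sum>h\<in>S. cmod (del h))"
  have M0: "M > 0" unfolding M_def by (simp add: add_pos_nonneg sum_nonneg)
  have M: "cmod (del h) \<le> M" if "h \<in> S" for h
    using member_le_sum[of h S "\<lambda>h. cmod (del h)"] that S(1) by (simp add: M_def)
  have "r = 0" if r: "\<gamma> + rscale r del \<in> R" "\<bar>r\<bar> < \<epsilon> / M" for r
  proof -
    have "cmod ((\<gamma> + rscale r del) h - \<gamma> h) < \<epsilon>" if h: "h \<in> S" for h
    proof -
      have "cmod ((\<gamma> + rscale r del) h - \<gamma> h) = \<bar>r\<bar> * cmod (del h)" by (simp add: rscale_def norm_mult)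
      also have "\<dots> \<le> \<bar>r\<bar> * M" using M[OF h] by (simp add: mult_left_mono)
      also have "\<dots> < \<epsilon>" using r(2) M0 by (simp add: pos_less_divide_eq)
      finally show ?thesis .
    qed
    hence "\<gamma> + rscale r del = \<gamma>" using e(2)[OF r(1)] by blast
    hence z: "rscale r del = 0" by simp
    obtain h where "del h \<noteq> 0" using del(2) by (auto simp: fun_eq_iff)
    moreover have "of_real r * del h = 0" using fun_cong[OF z, of h] by (simp add: rscale_def)
    ultimately show ?thesis by simp
  qed
  then show ?thesis using e(1) M0 by (intro exI[of _ "\<epsilon> / M"]) auto
qed

lemma string_finite:
  assumes "\<gamma> \<in> D"
  shows "finite {r. \<gamma> + rscale r del \<in> R \<and> \<bar>r\<bar> \<le> c}"
proof -
  obtain \<eta> where e: "\<eta> > 0" "\<And>r. \<gamma> + rscale r del \<in> R \<Longrightarrow> \<bar>r\<bar> < \<eta> \<Longrightarrow> r = 0"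
    using string_isolated[OF assms] by blast
  have g0: "\<gamma> + rscale 0 del \<in> R" using assms D(2) Rx_R by (simp add: rs.scale_zero_left)
  show ?thesis
  proof (rule finite_separated[of "\<eta> / 2" _ c])
    fix r s assume rs: "r \<in> {r. \<gamma> + rscale r del \<in> R \<and> \<bar>r\<bar> \<le> c}" "s \<in> {r. \<gamma> + rscale r del \<in> R \<and> \<bar>r\<bar> \<le> c}"
      "\<bar>r - s\<bar> < \<eta> / 2"
    \<comment> \<open>Reflecting the coefficient 0 in s gives 2 s, and reflecting that in r gives 2
      r - 2 s. Isolation at 0 thus becomes a uniform gap of \<eta> / 2 along the whole
      string.\<close>
    have "\<gamma> + rscale (2 * s - 0) del \<in> R" using string_refl[OF assms _ g0] rs by blast
    hence "\<gamma> + rscale (2 * r - 2 * s) del \<in> R" using string_refl[OF assms, of r "2 * s"] rs by simp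
    hence "2 * r - 2 * s = 0" using rs(3) by (intro e(2)) (auto simp: abs_if split: if_splits)
    then show "r = s" by simp
  qed (use e in auto)
qed

text \<open>The point h is moved in a direction g on which the new functional is 1, by a real amount
  s avoiding finitely many values. Functionals with Re (\<beta> g) = 0 do not notice the move and
  are old ones.\<close>

lemma generic_element:
  assumes "finite F" "\<And>\<gamma>. \<gamma> \<in> F \<Longrightarrow> \<gamma> \<in> dual \<and> \<gamma> \<noteq> 0"
  shows "\<exists>h\<in>H. \<forall>\<gamma>\<in>F. Re (\<gamma> h) \<noteq> 0"
  using assms
proof (induction F rule: finite_induct)
  case empty
  then show ?case using H_closed(1) by blast
next
  case (insert \<gamma> F)
  then obtain h where h: "h \<in> H" "\<forall>\<gamma>\<in>F. Re (\<gamma> h) \<noteq> 0" by blast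
  have d: "\<gamma> \<in> dual" "\<gamma> \<noteq> 0" using insert.prems by blast+
  obtain g0 where g0: "g0 \<in> H" "\<gamma> g0 \<noteq> 0" using dual_eqI[OF d(1) dual_0] d(2) by auto
  define g where "g = (1 / \<gamma> g0) *s g0"
  have g: "g \<in> H" "\<gamma> g = 1" using g0 d by (simp_all add: g_def H_closed dual_linear(2))
  obtain s :: real where s: "s \<notin> (\<lambda>\<beta>. - Re (\<beta> h) / Re (\<beta> g)) ` insert \<gamma> F"
    using ex_new_if_finite[OF infinite_UNIV_char_0, of "(\<lambda>\<beta>. - Re (\<beta> h) / Re (\<beta> g)) ` insert \<gamma> F"] insert.hyps by blast
  have "Re (\<beta> (h + of_real s *s g)) \<noteq> 0" if b: "\<beta> \<in> insert \<gamma> F" for \<beta>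
  proof
    assume z: "Re (\<beta> (h + of_real s *s g)) = 0"
    have bd: "\<beta> \<in> dual" using b insert.prems by blast
    have "\<beta> (h + of_real s *s g) = \<beta> h + of_real s * \<beta> g"
      using bd h g H_closed by (simp add: dual_linear(1,2))
    hence z': "Re (\<beta> h) + s * Re (\<beta> g) = 0" using z by simp
    show False
    proof (cases "Re (\<beta> g) = 0")
      case True
      then have "\<beta> \<noteq> \<gamma>" using g(2) by auto
      then show False using True z' h(2) b by auto
    next
      case False
      hence "s = - Re (\<beta> h) / Re (\<beta> g)" using z' by (simp add: field_simps)
      then show False using s b by blast
    qed
  qed
  moreover have "h + of_real s *s g \<in> H" using h g H_closed by simp
  ultimately show ?case by blast
qed

lemma Hhat_facts: "subspace Hhat" "Hhat \<subseteq> H" "x \<in> Hhat \<Longrightarrow> y \<in> Hhat \<Longrightarrow> B x y = 0"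
    "dim Hhat = dim (H_0 sc E br B H)" "x \<in> Hhat \<Longrightarrow> \<gamma> \<in> Rd \<Longrightarrow> B x (tv \<gamma>) = 0"
    "x \<in> set_sum (H_0 sc E br B H) Hhat \<Longrightarrow> (\<And>y. y \<in> set_sum (H_0 sc E br B H) Hhat \<Longrightarrow> B x y = 0) \<Longrightarrow> x = 0"
proof -
  show "subspace Hhat" "Hhat \<subseteq> H" "dim Hhat = dim (H_0 sc E br B H)"
    "x \<in> Hhat \<Longrightarrow> y \<in> Hhat \<Longrightarrow> B x y = 0"
    "x \<in> set_sum (H_0 sc E br B H) Hhat \<Longrightarrow> (\<And>y. y \<in> set_sum (H_0 sc E br B H) Hhat \<Longrightarrow> B x y = 0) \<Longrightarrow> x = 0" for x y
    using Hhat unfolding Hhat0_ok_def by blast+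
  have "tv \<gamma> \<in> Hdot sc B H Rd" if "\<gamma> \<in> Rd" for \<gamma>
    using that unfolding Hdot_def by (intro span_base) blast
  then show "x \<in> Hhat \<Longrightarrow> \<gamma> \<in> Rd \<Longrightarrow> B x (tv \<gamma>) = 0"
    using Hhat unfolding Hhat0_ok_def by blast
qed

lemma tv_del_nz: "tv del \<noteq> 0"
proof
  assume z: "tv del = 0"
  have "del h = 0" if "h \<in> H" for h using tv(2)[OF del_dual that] z that by simp
  then have "del = 0" by (intro dual_eqI[OF del_dual dual_0]) simp
  then show False using del(2) by blast
qed

lemma H0_eq: "H_0 sc E br B H = span {tv del}"
proof
  have "tv \<sigma> \<in> span {tv del}" if s: "\<sigma> \<in> R0" for \<sigma>
  proof -
    obtain r where "\<sigma> = rscale r del" using R0_VV[OF s] by blast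
    then show ?thesis by (simp add: tv_rscale span_scale span_base)
  qed
  then show "H_0 sc E br B H \<subseteq> span {tv del}" unfolding H_0_def by (intro span_minimal) auto
  show "span {tv del} \<subseteq> H_0 sc E br B H" unfolding H_0_def using del(1) by (intro span_mono) auto
qed

text \<open>The isotropic vector \<open>tv del\<close> spans \<open>H_0\<close>, so nondegeneracy of
  \<open>H_0\<close> plus \<open>Hhat\<close> forces it to pair with \<open>Hhat\<close>. The vector
  found plays the role of the scaling element of an affine algebra.\<close>

lemma Hhat_del: "\<exists>h\<in>Hhat. del h = 1"
proof -
  have 0: "0 \<in> Hhat" using Hhat_facts(1) subspace_0 by blast
  have "tv del \<in> span {tv del}" by (simp add: span_base)
  hence "tv del \<in> set_sum (H_0 sc E br B H) Hhat" unfolding H0_eq set_sum_def using 0 by force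
  then obtain y where y: "y \<in> set_sum (H_0 sc E br B H) Hhat" "B (tv del) y \<noteq> 0"
    using Hhat_facts(6) tv_del_nz by blast
  then obtain c k where ck: "y = c *s tv del + k" "k \<in> Hhat"
    unfolding H0_eq set_sum_def span_singleton by blast
  have kH: "k \<in> H" using ck Hhat_facts(2) by blast
  have "B (tv del) (tv del) = 0" using del_df by (simp add: dform_def)
  hence "B (tv del) k \<noteq> 0" using y(2) ck kH by (simp add: B_add B_scale)
  hence nz: "del k \<noteq> 0" using tv(2)[OF del_dual kH] B_sym[of k "tv del"] kH by simp
  have "del ((1 / del k) *s k) = 1" using nz dual_linear(2)[OF del_dual kH] by simp
  moreover have "(1 / del k) *s k \<in> Hhat" using ck(2) Hhat_facts(1) subspace_scale by blast
  ultimately show ?thesis by blast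
qed

text \<open>The vector h1 is invisible to \<open>D\<close> but not to \<delta>, so \<delta>(h) can
  be made large independently. A root \<gamma> + r \<delta> with r \<noteq> 0 has \<bar>r\<bar> at
  least \<eta> \<gamma>, and the \<delta>-term then dominates its height; genericity of h0 handles r
  = 0.\<close>

lemma height_element:
  assumes "\<And>\<gamma>. \<gamma> \<in> D \<Longrightarrow> \<eta> \<gamma> > (0::real)"
  shows "\<exists>h\<in>H. Re (del h) > 0 \<and> (\<forall>\<gamma>\<in>D. Re (\<gamma> h) \<noteq> 0 \<and> \<bar>Re (\<gamma> h)\<bar> < \<eta> \<gamma> * Re (del h))"
proof -
  have "\<exists>h\<in>H. \<forall>\<gamma>\<in>D. Re (\<gamma> h) \<noteq> 0"
    by (rule generic_element[OF D(1)]) (use D(3) in \<open>auto simp: D_def\<close>)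
  then obtain h0 where h0: "h0 \<in> H" "\<forall>\<gamma>\<in>D. Re (\<gamma> h0) \<noteq> 0" by blast
  obtain h1 where h1: "h1 \<in> Hhat" "del h1 = 1" using Hhat_del by blast
  have h1H: "h1 \<in> H" using h1 Hhat_facts(2) by blast
  \<comment> \<open>Exceeds every quotient \<bar>Re (\<gamma> h0)\<bar> / \<eta> \<gamma>, strictly
    because of the summand 1.\<close>
  define N where "N = 1 + (\<Sum>\<gamma>\<in>D. \<bar>Re (\<gamma> h0)\<bar> / \<eta> \<gamma>)"
  define h where "h = h0 + of_real (N - Re (del h0)) *s h1"
  have nn: "\<And>\<gamma>. \<gamma> \<in> D \<Longrightarrow> \<bar>Re (\<gamma> h0)\<bar> / \<eta> \<gamma> \<ge> 0" using assms by (simp add: less_imp_le)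
  have ev: "\<beta> h = \<beta> h0 + of_real (N - Re (del h0)) * \<beta> h1" if "\<beta> \<in> dual" for \<beta>
    unfolding h_def using h0 h1H H_closed that by (simp add: dual_linear(1,2))
  have dh: "Re (del h) = N" using ev[OF del_dual] h1(2) by simp
  have gh: "\<gamma> h = \<gamma> h0" if g: "\<gamma> \<in> D" for \<gamma>
  proof -
    have "\<gamma> h1 = 0" using tv(2)[OF D(3)[OF g] h1H] Hhat_facts(5)[OF h1(1), of \<gamma>] g by (simp add: D_def)
    then show ?thesis using ev[OF D(3)[OF g]] by simp
  qed
  have N0: "N > 0" unfolding N_def using sum_nonneg[of D "\<lambda>\<gamma>. \<bar>Re (\<gamma> h0)\<bar> / \<eta> \<gamma>", OF nn] by simp
  have "\<bar>Re (\<gamma> h0)\<bar> < \<eta> \<gamma> * N" if g: "\<gamma> \<in> D" for \<gamma>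
  proof -
    have "\<bar>Re (\<gamma> h0)\<bar> / \<eta> \<gamma> \<le> (\<Sum>\<gamma>\<in>D. \<bar>Re (\<gamma> h0)\<bar> / \<eta> \<gamma>)"
      using g D(1) nn by (intro member_le_sum) auto
    hence "\<bar>Re (\<gamma> h0)\<bar> / \<eta> \<gamma> < N" by (simp add: N_def)
    then show ?thesis using assms[OF g] by (simp add: divide_less_eq mult.commute)
  qed
  moreover have "h \<in> H" unfolding h_def using h0 h1H H_closed by simp
  moreover have "Re (\<gamma> h) = Re (\<gamma> h0)" if "\<gamma> \<in> D" for \<gamma> using gh[OF that] by (rule arg_cong)
  ultimately show ?thesis using dh h0 N0 by (intro bexI[of _ h]) simp_all
qed

lemma Rx_refl:
  assumes "\<alpha> \<in> Rx" "\<beta> \<in> Rx"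
  shows "\<exists>k::int. \<beta> (cr \<alpha>) = of_int k \<and> 2 * q \<beta> \<alpha> = of_int k * q \<alpha> \<alpha> \<and> \<beta> - rscale (of_int k) \<alpha> \<in> Rx"
proof -
  have d: "\<alpha> \<in> dual" "\<beta> \<in> dual" using assms Rx_dual by blast+
  obtain k :: int where k: "\<beta> (cr \<alpha>) = of_int k" "\<beta> - rscale (of_int k) \<alpha> \<in> R"
    using reflection[OF assms(1) Rx_R[OF assms(2)]] by blast
  have k2: "2 * df \<beta> \<alpha> = of_int k * df \<alpha> \<alpha>" using k(1) Rx_nz[OF assms(1)] by (simp add: cr_eval d field_simps)
  have "2 * (kap * of_real (q \<beta> \<alpha>)) = of_int k * (kap * of_real (q \<alpha> \<alpha>))"
    using k2 df_q[OF assms(2) Rx_R[OF assms(1)]] df_q[OF assms(1) Rx_R[OF assms(1)]] by simp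
  hence "kap * of_real (2 * q \<beta> \<alpha>) = kap * of_real (of_int k * q \<alpha> \<alpha>)" by (simp add: mult_ac)
  hence "complex_of_real (2 * q \<beta> \<alpha>) = of_real (of_int k * q \<alpha> \<alpha>)" using kap(1) by (simp only: mult_cancel_left) blast
  hence q2: "2 * q \<beta> \<alpha> = of_int k * q \<alpha> \<alpha>" by (simp only: of_real_eq_iff)
  have "df (\<beta> - rscale (of_int k) \<alpha>) (\<beta> - rscale (of_int k) \<alpha>) = df \<beta> \<beta> + of_int k * (of_int k * df \<alpha> \<alpha> - 2 * df \<beta> \<alpha>)"
    using d by (simp add: df_diff df_rscale dual_rscale dual_diff df_sym[of \<alpha> \<beta>] algebra_simps)
  hence "\<beta> - rscale (of_int k) \<alpha> \<in> Rx" using k2 k(2) Rx_nz[OF assms(2)] by (intro Rx_I) auto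
  then show ?thesis using k q2 by blast
qed

lemma del_span: "\<exists>\<alpha>\<in>Rx. \<alpha> + del \<in> Rx"
proof -
  have "\<forall>\<sigma>\<in>R0. \<exists>\<alpha>\<in>Rx. \<alpha> + \<sigma> \<in> R" using eala by (simp add: eala_def)
  then obtain \<alpha> where a: "\<alpha> \<in> Rx" "\<alpha> + del \<in> R" using del(1) by blast
  have "df (\<alpha> + del) (\<alpha> + del) = df \<alpha> \<alpha>"
    using Rx_dual[OF a(1)] del_Rx[OF a(1)] df_sym[of \<alpha> del] by (simp add: df_add dual_add del_df)
  then have "\<alpha> + del \<in> Rx" using a(2) Rx_nz[OF a(1)] by (intro Rx_I) auto
  then show ?thesis using a(1) by blast
qed

lemma affine_roots_Rx: "\<exists>h\<in>H. affine_roots rscale q (\<lambda>\<phi>. Re (\<phi> h)) Rx del"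
proof -
  obtain \<eta> where eta: "\<And>\<gamma>. \<gamma> \<in> D \<Longrightarrow> \<eta> \<gamma> > (0::real)"
      "\<And>\<gamma> r. \<gamma> \<in> D \<Longrightarrow> \<gamma> + rscale r del \<in> R \<Longrightarrow> \<bar>r\<bar> < \<eta> \<gamma> \<Longrightarrow> r = 0"
    using string_isolated by metis
  obtain h where h: "h \<in> H" "Re (del h) > 0"
      "\<And>\<gamma>. \<gamma> \<in> D \<Longrightarrow> Re (\<gamma> h) \<noteq> 0 \<and> \<bar>Re (\<gamma> h)\<bar> < \<eta> \<gamma> * Re (del h)"
    using height_element[of \<eta>] eta(1) by blast
  let ?p = "\<lambda>\<phi>::'a \<Rightarrow> complex. Re (\<phi> h)"
  have pshift: "?p (\<gamma> + rscale r del) = ?p \<gamma> + r * ?p del" for \<gamma> r by (simp add: rscale_def)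
  have pnz: "?p \<alpha> \<noteq> 0" if a: "\<alpha> \<in> Rx" for \<alpha>
  proof -
    obtain \<gamma> r where g: "\<gamma> \<in> D" "\<alpha> = \<gamma> + rscale r del" using Rx_split[OF a] by blast
    show ?thesis
    proof (cases "r = 0")
      case True
      then show ?thesis using h(3)[OF g(1)] pshift[of \<gamma> r] g(2) by simp
    next
      case False
      hence "\<eta> \<gamma> \<le> \<bar>r\<bar>" using eta(2)[OF g(1), of r] Rx_R[OF a] g(2) by force
      hence "\<eta> \<gamma> * ?p del \<le> \<bar>r\<bar> * ?p del" using h(2) by (simp add: mult_right_mono)
      hence "\<bar>?p \<gamma>\<bar> < \<bar>r\<bar> * ?p del" using h(3)[OF g(1)] by linarith
      hence "\<bar>?p \<gamma>\<bar> < \<bar>r * ?p del\<bar>" using h(2) by (simp add: abs_mult)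
      then show ?thesis using pshift[of \<gamma> r] unfolding g(2)[symmetric] by linarith
    qed
  qed
  have fin: "finite {\<alpha> \<in> Rx. 0 < ?p \<alpha> \<and> ?p \<alpha> \<le> c}" for c
  proof -
    define S where "S \<gamma> = {r. \<gamma> + rscale r del \<in> R \<and> \<bar>r\<bar> \<le> (c + \<bar>?p \<gamma>\<bar>) / ?p del}" for \<gamma>
    have "finite (\<Union>\<gamma>\<in>D. (\<lambda>r. \<gamma> + rscale r del) ` S \<gamma>)"
      unfolding S_def using D(1) string_finite by blast
    moreover have "{\<alpha> \<in> Rx. 0 < ?p \<alpha> \<and> ?p \<alpha> \<le> c} \<subseteq> (\<Union>\<gamma>\<in>D. (\<lambda>r. \<gamma> + rscale r del) ` S \<gamma>)"
    proof
      fix \<alpha> assume "\<alpha> \<in> {\<alpha> \<in> Rx. 0 < ?p \<alpha> \<and> ?p \<alpha> \<le> c}"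
      hence a: "\<alpha> \<in> Rx" "0 < ?p \<alpha>" "?p \<alpha> \<le> c" by auto
      obtain \<gamma> r where g: "\<gamma> \<in> D" "\<alpha> = \<gamma> + rscale r del" using Rx_split[OF a(1)] by blast
      have "\<bar>r\<bar> * ?p del = \<bar>r * ?p del\<bar>" using h(2) by (simp add: abs_mult)
      also have "\<dots> \<le> c + \<bar>?p \<gamma>\<bar>" using pshift[of \<gamma> r] a(2,3) unfolding g(2)[symmetric] by linarith
      finally have "\<bar>r\<bar> \<le> (c + \<bar>?p \<gamma>\<bar>) / ?p del" using h(2) by (simp add: pos_le_divide_eq)
      hence "r \<in> S \<gamma>" using Rx_R[OF a(1)] g(2) by (simp add: S_def)
      then show "\<alpha> \<in> (\<Union>\<gamma>\<in>D. (\<lambda>r. \<gamma> + rscale r del) ` S \<gamma>)" using g by blast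
    qed
    ultimately show ?thesis by (rule rev_finite_subset)
  qed
  have "affine_roots rscale q ?p Rx del"
  proof (unfold_locales, goal_cases)
    case (1 x y) then show ?case by (simp add: q_def mult.commute)
  next
    case (2 x y z) then show ?case by (simp add: q_def sum.distrib distrib_right)
  next
    case (3 c x z) then show ?case by (simp add: q_def rscale_def sum_distrib_left mult.assoc)
  next
    case (4 x) then show ?case by (simp add: q_def sum_nonneg)
  next
    case (5 x y) then show ?case by simp
  next
    case (6 c x) then show ?case by (simp add: rscale_def)
  next
    case (7 x) then show ?case using del_cr[OF D(2)] by (simp add: q_def)
  next
    case 8 then show ?case by (rule h(2))
  next
    case (9 \<alpha>) then show ?case by (rule q_self_pos)
  next
    case (10 \<alpha>) then show ?case by (rule Rx_neg)
  next
    case (11 \<alpha> \<beta>) then show ?case using Rx_refl by blast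
  next
    case (12 \<alpha>)
    show ?case
    proof
      assume x: "rscale 2 \<alpha> \<in> Rx"
      have "rscale 2 \<alpha> - (\<alpha> + \<alpha>) = 0" by (simp add: rscale_def fun_eq_iff)
      moreover have "0 \<in> VV" unfolding V0_def by (rule rs.span_zero)
      ultimately show False using reduced 12 Rx_R[OF x] unfolding reduced_quotient_def by metis
    qed
  next
    case (13 \<alpha>) then show ?case by (rule pnz)
  next
    case (14 c) then show ?case by (rule fin)
  next
    case 15 then show ?case using D(1) Rx_split by (intro exI[of _ D]) blast
  next
    case (16 x) then show ?case by (rule radical_Rx)
  next
    case 17
    obtain \<alpha> where a: "\<alpha> \<in> Rx" "\<alpha> + del \<in> Rx" using del_span by blast
    have "(\<alpha> + del) - \<alpha> \<in> rs.span Rx" using a by (intro rs.span_diff rs.span_base)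
    then show ?case by (simp only: add_diff_cancel_left')
  next
    case 18
    have "\<not> (\<exists>A C. A \<noteq> {} \<and> C \<noteq> {} \<and> A \<union> C = Rx \<and> (\<forall>a\<in>A. \<forall>c\<in>C. df a c = 0))"
      using eala by (simp add: eala_def)
    moreover have "df a c = 0" if "a \<in> Rx" "c \<in> Rx" "q a c = 0" for a c
      using df_q[OF that(1) Rx_R[OF that(2)]] that(3) by simp
    ultimately show ?case by (metis (no_types, lifting) UnCI)
  qed
  then show ?thesis using h(1) by blast
qed

end

section \<open>Simple root vectors and the Cartan subalgebra\<close>

locale eala_based = eala_null1 sc E br B H Rd Hhat
  for sc :: "complex \<Rightarrow> 'a::ab_group_add \<Rightarrow> 'a" (infixr "*s" 75) and E br B H Rd Hhat +
  fixes h0 :: 'a and n :: nat and a :: "nat \<Rightarrow> 'a \<Rightarrow> complex" and e f :: "nat \<Rightarrow> 'a"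
  assumes affine: "affine_roots rscale q (\<lambda>\<phi>. Re (\<phi> h0)) Rx del"
    and a_bij: "bij_betw a {..<n} (affine_roots.simple (\<lambda>\<phi>. Re (\<phi> h0)) Rx)"
    and e_rsp: "i < n \<Longrightarrow> e i \<in> rsp (a i)" and f_rsp: "i < n \<Longrightarrow> f i \<in> rsp (- a i)"
    and ef_sl2: "i < n \<Longrightarrow> sl2 sc E br B (e i) (f i) (cr (a i))"
begin

sublocale A: affine_roots rscale q "\<lambda>\<phi>. Re (\<phi> h0)" Rx del by (rule affine)

definition t where "t i = tv (a i)"
abbreviation Hc where "Hc \<equiv> H_c sc E br B H"
definition K where "K = set_sum Hc Hhat"
abbreviation G where "G \<equiv> gen_subalgebra sc E br (e ` {..<n} \<union> f ` {..<n})"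

lemma a_simple: "i < n \<Longrightarrow> a i \<in> A.simple" using a_bij by (auto simp: bij_betw_def)

lemma a_Rx: "i < n \<Longrightarrow> a i \<in> Rx" using a_simple A.simple_Phi by blast

lemma a_dual: "i < n \<Longrightarrow> a i \<in> dual" using a_Rx Rx_dual by blast

lemma simple_a: "s \<in> A.simple \<Longrightarrow> \<exists>i<n. s = a i" using a_bij by (auto simp: bij_betw_def)

lemma a_inj: "i < n \<Longrightarrow> j < n \<Longrightarrow> a i = a j \<Longrightarrow> i = j" using a_bij by (auto simp: bij_betw_def inj_on_def)

lemma t_H: "i < n \<Longrightarrow> t i \<in> H" by (simp add: t_def tv(1) a_dual)

lemma t_E [simp]: "i < n \<Longrightarrow> t i \<in> E" by (simp add: t_H)

lemma sum_simple: "(\<Sum>s\<in>A.simple. g s) = (\<Sum>i<n. g (a i))"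
  by (rule sum.reindex_bij_betw[OF a_bij, symmetric])

lemma dual_sum_rscale: "finite I \<Longrightarrow> (\<And>i. i \<in> I \<Longrightarrow> b i \<in> dual) \<Longrightarrow>
    (\<Sum>i\<in>I. rscale (c i) (b i)) \<in> dual \<and> tv (\<Sum>i\<in>I. rscale (c i) (b i)) = (\<Sum>i\<in>I. of_real (c i) *s tv (b i))"
proof (induction I rule: finite_induct)
  case empty show ?case using dual_0 tv_0 by (simp only: sum.empty)
next
  case (insert i I)
  have "rscale (c i) (b i) \<in> dual" "(\<Sum>i\<in>I. rscale (c i) (b i)) \<in> dual" "b i \<in> dual"
    using insert by (auto simp: dual_rscale)
  note d = this
  have IH: "tv (\<Sum>i\<in>I. rscale (c i) (b i)) = (\<Sum>i\<in>I. of_real (c i) *s tv (b i))" using insert by blast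
  show ?case
    unfolding sum.insert[OF insert.hyps] tv_add[OF d(1,2)] tv_rscale[OF d(3)] IH
    using dual_add[OF d(1,2)] by blast
qed

lemma t_isotropic:
  assumes "\<And>j. j < n \<Longrightarrow> (\<Sum>i<n. c i * of_real (q (a i) (a j))) = 0"
  shows "\<exists>r. (\<Sum>i<n. rscale (Re (c i)) (a i)) = rscale r del"
proof -
  define X where "X = (\<Sum>i<n. rscale (Re (c i)) (a i))"
  have qX: "q X (a j) = 0" if "j < n" for j
  proof -
    have "q X (a j) = (\<Sum>i<n. Re (c i) * q (a i) (a j))" by (simp add: X_def A.q_sum A.q_scale)
    also have "\<dots> = Re (\<Sum>i<n. c i * of_real (q (a i) (a j)))" by simp
    finally show ?thesis using assms[OF that] by simp
  qed
  have "q X X = (\<Sum>i<n. Re (c i) * q X (a i))" by (subst (2) X_def) (simp add: A.q_sum_right A.q_scale_right)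
  also have "\<dots> = 0" using qX by simp
  finally have "q X X = 0" .
  moreover have "X \<in> rs.span Rx" unfolding X_def
    by (intro rs.span_sum rs.span_scale rs.span_base a_Rx) simp
  ultimately show ?thesis using radical_Rx unfolding X_def by blast
qed

text \<open>On the t i the form is \<open>kap\<close> times the real matrix of \<open>q\<close>, so
  a complex combination in its kernel splits into two real ones, each isotropic and hence a multiple
  of \<delta>.\<close>

lemma t_radical:
  assumes "\<And>j. j < n \<Longrightarrow> B (\<Sum>i<n. c i *s t i) (t j) = 0"
  shows "\<exists>r s. (\<Sum>i<n. rscale (Re (c i)) (a i)) = rscale r del \<and> (\<Sum>i<n. rscale (Im (c i)) (a i)) = rscale s del \<and>
     (\<Sum>i<n. c i *s t i) = (of_real r + \<i> * of_real s) *s tv del"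
proof -
  have z: "(\<Sum>i<n. c i * of_real (q (a i) (a j))) = 0" if j: "j < n" for j
  proof -
    have "0 = B (\<Sum>i<n. c i *s t i) (t j)" using assms[OF j] by simp
    also have "\<dots> = (\<Sum>i<n. c i * B (t i) (t j))" using j by (subst B_sum) (auto simp: B_scale)
    also have "\<dots> = (\<Sum>i<n. c i * (kap * of_real (q (a i) (a j))))"
    proof (intro sum.cong refl)
      fix i assume "i \<in> {..<n}"
      then have "B (t i) (t j) = kap * of_real (q (a i) (a j))"
        using df_q[OF a_Rx Rx_R[OF a_Rx[OF j]], of i] by (simp add: dform_def t_def)
      then show "c i * B (t i) (t j) = c i * (kap * of_real (q (a i) (a j)))" by simp
    qed
    also have "\<dots> = kap * (\<Sum>i<n. c i * of_real (q (a i) (a j)))" by (simp add: sum_distrib_left mult_ac)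
    finally show ?thesis using kap(1) by simp
  qed
  obtain r where r: "(\<Sum>i<n. rscale (Re (c i)) (a i)) = rscale r del" using t_isotropic[OF z] by blast
  \<comment> \<open>The factor -\<i> moves the imaginary part of c i to the real part.\<close>
  have z': "(\<Sum>i<n. (- \<i> * c i) * of_real (q (a i) (a j))) = 0" if "j < n" for j
    using z[OF that] by (simp add: mult.assoc sum_distrib_left[symmetric] del: mult_minus_left)
  obtain s where s: "(\<Sum>i<n. rscale (Im (c i)) (a i)) = rscale s del" using t_isotropic[OF z'] by auto
  have tr: "(\<Sum>i<n. of_real (g i) *s t i) = of_real x *s tv del" if "(\<Sum>i<n. rscale (g i) (a i)) = rscale x del" for g x
  proof -
    have "tv (\<Sum>i<n. rscale (g i) (a i)) = (\<Sum>i<n. of_real (g i) *s t i)"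
      using dual_sum_rscale[of "{..<n}" a g] a_dual by (simp add: t_def)
    then show ?thesis unfolding that by (simp add: tv_rscale)
  qed
  have "(\<Sum>i<n. c i *s t i) = (\<Sum>i<n. of_real (Re (c i)) *s t i + \<i> *s of_real (Im (c i)) *s t i)"
    by (intro sum.cong refl) (metis complex_eq scale_left_distrib scale_scale)
  also have "\<dots> = (\<Sum>i<n. of_real (Re (c i)) *s t i) + \<i> *s (\<Sum>i<n. of_real (Im (c i)) *s t i)"
    by (simp add: sum.distrib scale_sum_right)
  also have "\<dots> = (of_real r + \<i> * of_real s) *s tv del"
    unfolding tr[OF r] tr[OF s] by (simp add: scale_left_distrib)
  finally show ?thesis using r s by blast
qed

text \<open>A vanishing combination lies in the kernel of the form, so its real and imaginary parts
  represent multiples r \<delta> and s \<delta>. Since \<open>tv del\<close> is nonzero, r = s = 0,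
  and independence of the simple roots over the reals applies to each part.\<close>

lemma t_independent: assumes "(\<Sum>i<n. c i *s t i) = 0" "i < n" shows "c i = 0"
proof -
  have "B (\<Sum>i<n. c i *s t i) (t j) = 0" if "j < n" for j using that assms(1) by simp
  then obtain r s where rs: "(\<Sum>i<n. rscale (Re (c i)) (a i)) = rscale r del"
      "(\<Sum>i<n. rscale (Im (c i)) (a i)) = rscale s del" "(\<Sum>i<n. c i *s t i) = (of_real r + \<i> * of_real s) *s tv del"
    using t_radical by blast
  have "of_real r + \<i> * of_real s = 0" using rs(3) assms(1) tv_del_nz by simp
  hence rs0: "r = 0" "s = 0" by (simp_all add: complex_eq_iff)
  have *: "g i = 0" if "(\<Sum>i<n. rscale (g i) (a i)) = 0" for g
  proof -
    define g' where "g' s = g (inv_into {..<n} a s)" for s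
    have g': "g' (a j) = g j" if "j < n" for j
      using that a_bij by (simp add: g'_def bij_betw_def inv_into_f_f)
    have "(\<Sum>s\<in>A.simple. rscale (g' s) s) = 0" unfolding sum_simple using that g' by simp
    then show ?thesis using A.simple_independent[of g' "a i"] a_simple[OF assms(2)] g'[OF assms(2)] by simp
  qed
  have "Re (c i) = 0" using *[of "\<lambda>i. Re (c i)"] rs(1) rs0 by simp
  moreover have "Im (c i) = 0" using *[of "\<lambda>i. Im (c i)"] rs(2) rs0 by simp
  ultimately show ?thesis by (simp add: complex_eq_iff)
qed

lemma t_family: "inj_on t {..<n}" "independent (t ` {..<n})"
  by (rule independent_family[of "{..<n}" t]; use t_independent in blast)+

lemma Hc_eq: "Hc = span (t ` {..<n})"
proof
  have P: "tv \<alpha> \<in> span (t ` {..<n})" if al: "\<alpha> \<in> A.P" for \<alpha>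
  proof -
    obtain k :: "('a \<Rightarrow> complex) \<Rightarrow> nat" where "\<alpha> = (\<Sum>s\<in>A.simple. rscale (of_nat (k s)) s)"
      using A.P_repr[OF al] by blast
    hence "\<alpha> = (\<Sum>i<n. rscale (of_nat (k (a i))) (a i))" by (simp add: sum_simple)
    hence "tv \<alpha> = (\<Sum>i<n. of_real (of_nat (k (a i))) *s t i)"
      using dual_sum_rscale[of "{..<n}" a] a_dual by (simp add: t_def)
    then show ?thesis by (auto intro!: span_sum span_scale intro: span_base)
  qed
  have "tv \<alpha> \<in> span (t ` {..<n})" if "\<alpha> \<in> Rx" for \<alpha>
    using A.Phi_cases[OF that]
  proof
    assume "- \<alpha> \<in> A.P"
    from P[OF this] have "- tv \<alpha> \<in> span (t ` {..<n})" using tv_neg[OF Rx_dual[OF that]] by simp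
    then show ?thesis using span_neg by fastforce
  qed (rule P)
  then show "Hc \<subseteq> span (t ` {..<n})" unfolding H_c_def by (intro span_minimal) auto
  show "span (t ` {..<n}) \<subseteq> Hc" unfolding H_c_def by (rule span_mono) (auto simp: t_def a_Rx)
qed

lemma Hc_repr: "x \<in> Hc \<Longrightarrow> \<exists>c. x = (\<Sum>i<n. c i *s t i)"
  unfolding Hc_eq by (rule span_image_sum) simp

lemma Hc_H: "Hc \<subseteq> H" unfolding H_c_def by (rule span_minimal) (auto simp: tv(1) Rx_dual H_subspace)

lemma t_Hc: "i < n \<Longrightarrow> t i \<in> Hc" unfolding Hc_eq by (auto intro: span_base)

lemma del_Hc: "tv del \<in> Hc"
proof -
  obtain \<alpha> where a: "\<alpha> \<in> Rx" "\<alpha> + del \<in> Rx" using del_span by blast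
  have "tv (\<alpha> + del) - tv \<alpha> \<in> Hc" unfolding H_c_def using a by (intro span_diff span_base) auto
  then show ?thesis using tv_add[OF Rx_dual[OF a(1)] del_dual] by simp
qed

lemma Hc_del: assumes "x \<in> Hc" shows "B x (tv del) = 0"
proof -
  have "B (tv del) x = 0"
  proof (rule B_span_zero[OF _ _ _ assms[unfolded H_c_def]])
    show "tv ` Rx \<subseteq> E" using Rx_dual by auto
    fix y assume "y \<in> tv ` Rx"
    then show "B (tv del) y = 0" using del_Rx by (auto simp: dform_def)
  qed simp
  then show ?thesis using B_sym[of x "tv del"] assms Hc_H by auto
qed

lemma K_subspace: "subspace K" unfolding K_def set_sum_def
  by (rule subspace_sums) (simp_all add: H_c_def Hhat_facts(1))

lemma Hc_K: "Hc \<subseteq> K"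
proof
  fix x assume "x \<in> Hc"
  moreover have "0 \<in> Hhat" using Hhat_facts(1) subspace_0 by blast
  ultimately show "x \<in> K" unfolding K_def set_sum_def by force
qed

lemma Hhat_K: "Hhat \<subseteq> K"
proof
  fix x assume "x \<in> Hhat"
  moreover have "0 \<in> Hc" unfolding H_c_def by (rule span_zero)
  ultimately show "x \<in> K" unfolding K_def set_sum_def by force
qed

lemma K_H: "K \<subseteq> H"
  using Hc_H Hhat_facts(2) H_closed by (auto simp: K_def set_sum_def)

lemma Hhat_zero: assumes "x \<in> Hhat" "B x (tv del) = 0" shows "x = 0"
proof (rule Hhat_facts(6))
  have xE: "x \<in> E" using assms Hhat_facts(2) by auto
  show "x \<in> set_sum (H_0 sc E br B H) Hhat"
    unfolding H0_eq set_sum_def using assms span_zero by force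
  fix y assume "y \<in> set_sum (H_0 sc E br B H) Hhat"
  then obtain c k where y: "y = c *s tv del + k" "k \<in> Hhat"
    unfolding H0_eq set_sum_def span_singleton by blast
  have "k \<in> E" using y Hhat_facts(2) by auto
  then show "B x y = 0" using y assms xE Hhat_facts(3) by (simp add: B_add B_scale)
qed

text \<open>Pairing with \<open>tv del\<close> removes the \<open>Hhat\<close> component. What
  remains is in the radical of \<open>Hc\<close>, hence a multiple of \<open>tv del\<close>, and
  this is detected by \<open>Hhat\<close>.\<close>

lemma K_nondegenerate: assumes "x \<in> K" "\<And>y. y \<in> K \<Longrightarrow> B x y = 0" shows "x = 0"
proof -
  obtain u k where uk: "x = u + k" "u \<in> Hc" "k \<in> Hhat" using assms(1) by (auto simp: K_def set_sum_def)
  have E [simp]: "u \<in> E" "k \<in> E" using uk Hc_H Hhat_facts(2) by auto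
  have "B x (tv del) = 0" using assms(2) del_Hc Hc_K by blast
  hence "B k (tv del) = 0" using Hc_del[OF uk(2)] by (simp add: uk(1) B_add)
  hence k0: "k = 0" using Hhat_zero uk(3) by blast
  obtain c where c: "u = (\<Sum>i<n. c i *s t i)" using Hc_repr[OF uk(2)] by blast
  have "B (\<Sum>i<n. c i *s t i) (t j) = 0" if "j < n" for j
    using assms(2)[of "t j"] t_Hc[OF that] Hc_K by (auto simp: uk(1) k0 c)
  then obtain z where z: "u = z *s tv del" using t_radical c by metis
  have "u = 0"
  proof (rule Hhat_facts(6))
    have u: "u \<in> span {tv del}" unfolding z by (simp add: span_scale span_base)
    moreover have "0 \<in> Hhat" using Hhat_facts(1) subspace_0 by blast
    ultimately show "u \<in> set_sum (H_0 sc E br B H) Hhat" unfolding H0_eq set_sum_def by force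
    fix y assume "y \<in> set_sum (H_0 sc E br B H) Hhat"
    then obtain c' k' where y: "y = c' *s tv del + k'" "k' \<in> Hhat"
      unfolding H0_eq set_sum_def span_singleton by blast
    have "y \<in> K" unfolding y(1) using y(2) Hhat_K del_Hc Hc_K K_subspace
      by (intro subspace_add subspace_scale) auto
    then show "B u y = 0" using assms(2) by (simp add: uk(1) k0)
  qed
  then show ?thesis by (simp add: uk(1) k0)
qed

lemma K_dim: "fin_dim sc K" "dim K = n + 1"
proof -
  have "dim Hhat = dim {tv del}" using Hhat_facts(4) by (simp add: H0_eq)
  also have "\<dots> = card {tv del}" using tv_del_nz by (intro dim_eq_card_independent) simp
  finally have "dim Hhat = 1" by simp
  then obtain C where C: "C \<subseteq> Hhat" "independent C" "Hhat \<subseteq> span C" "card C = 1"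
    using basis_exists[of Hhat] by metis
  obtain b where b: "C = {b}" using C(4) by (rule card_1_singletonE)
  have bnz: "b \<noteq> 0" using C(2) b by auto
  have bh: "b \<in> Hhat" using C b by simp
  have bn: "b \<notin> span (t ` {..<n})" using Hc_del[of b] Hhat_zero[OF bh] bnz unfolding Hc_eq by blast
  have ind: "independent (insert b (t ` {..<n}))"
    using t_family(2) bn by (rule independent_insertI[rotated])
  have sp: "span (insert b (t ` {..<n})) = K"
  proof
    show "span (insert b (t ` {..<n})) \<subseteq> K"
      using bh Hhat_K t_Hc Hc_K by (intro span_minimal K_subspace) auto
    show "K \<subseteq> span (insert b (t ` {..<n}))"
    proof
      fix x assume "x \<in> K"
      then obtain u k where uk: "x = u + k" "u \<in> Hc" "k \<in> Hhat" by (auto simp: K_def set_sum_def)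
      have "u \<in> span (insert b (t ` {..<n}))" using uk(2) span_mono[of "t ` {..<n}"] unfolding Hc_eq by blast
      moreover have "k \<in> span (insert b (t ` {..<n}))" using uk(3) C(3) b span_mono[of "{b}"] by blast
      ultimately show "x \<in> span (insert b (t ` {..<n}))" unfolding uk(1) by (rule span_add)
    qed
  qed
  have "b \<notin> t ` {..<n}" using bn span_base[of b "t ` {..<n}"] by blast
  hence "card (insert b (t ` {..<n})) = n + 1" using card_image[OF t_family(1)] by simp
  then show "dim K = n + 1" using dim_span_eq_card_independent[OF ind] sp by simp
  show "fin_dim sc K" unfolding fin_dim_def using sp span_superset[of "insert b (t ` {..<n})"]
    by (intro exI[of _ "insert b (t ` {..<n})"]) auto
qed

text \<open>Since \<open>K\<close> is nondegenerate, the functional taking the value 1 on each of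
  the independent t i is represented by an element of \<open>K\<close>. It is the degree operator of
  the grading.\<close>

lemma height_vector: "\<exists>d\<in>K. \<forall>i<n. B d (t i) = 1"
proof -
  have tE: "t ` {..<n} \<subseteq> E" by auto
  have KE: "K \<subseteq> E" using K_H H_subset by blast
  have "\<exists>(m::nat) u w. (\<forall>i<m. u i \<in> span (t ` {..<n}) \<and> w i \<in> K) \<and>
      (\<forall>x\<in>span (t ` {..<n}). x = (\<Sum>i<m. B x (w i) *s u i))"
  proof (rule dual_pairs[OF _ tE KE])
    fix x assume x: "x \<in> span (t ` {..<n})" "\<And>y. y \<in> K \<Longrightarrow> B x y = 0"
    have "x \<in> K" using x(1) Hc_K Hc_eq by blast
    then show "x = 0" using x(2) by (rule K_nondegenerate)
  qed simp
  then obtain m :: nat and u w where uw: "\<And>i. i < m \<Longrightarrow> u i \<in> span (t ` {..<n}) \<and> w i \<in> K"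
      "\<And>x. x \<in> span (t ` {..<n}) \<Longrightarrow> x = (\<Sum>i<m. B x (w i) *s u i)" by blast
  have "\<forall>k. \<exists>c. k < m \<longrightarrow> u k = (\<Sum>i<n. c i *s t i)"
    using uw(1) span_image_sum[of "{..<n}" _ t] by blast
  from choice[OF this] obtain c where c: "\<forall>k. k < m \<longrightarrow> u k = (\<Sum>i<n. c k i *s t i)" ..
  \<comment> \<open>The coefficient of w k is the value of that functional on u k, read off from the
    coordinates c k.\<close>
  define d where "d = (\<Sum>k<m. (\<Sum>i<n. c k i) *s w k)"
  have dK: "d \<in> K" unfolding d_def using uw(1) by (intro subspace_sum subspace_scale K_subspace) auto
  have wE [simp]: "w k \<in> E" if "k < m" for k using uw(1)[OF that] KE by blast
  have "B d (t j) = 1" if j: "j < n" for j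
  proof -
    have "t j = (\<Sum>k<m. B (t j) (w k) *s u k)" using j by (intro uw(2) span_base) auto
    also have "\<dots> = (\<Sum>k<m. \<Sum>i<n. (B (t j) (w k) * c k i) *s t i)"
      using c by (intro sum.cong refl) (simp add: scale_sum_right)
    also have "\<dots> = (\<Sum>i<n. (\<Sum>k<m. B (t j) (w k) * c k i) *s t i)"
      by (subst sum.swap) (simp add: scale_sum_left)
    finally have tj: "t j = (\<Sum>i<n. (\<Sum>k<m. B (t j) (w k) * c k i) *s t i)" .
    have "(\<Sum>i<n. (if i = j then 1 else 0) *s t i) = (\<Sum>i<n. if i = j then t i else 0)"
      by (intro sum.cong) auto
    also have "\<dots> = t j" using j by simp
    finally have "(\<Sum>i<n. ((\<Sum>k<m. B (t j) (w k) * c k i) - (if i = j then 1 else 0)) *s t i) = 0"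
      using tj by (simp add: scale_left_diff_distrib sum_subtractf)
    hence co: "(\<Sum>k<m. B (t j) (w k) * c k i) = (if i = j then 1 else 0)" if "i < n" for i
      using t_independent that by fastforce
    have "B d (t j) = (\<Sum>k<m. (\<Sum>i<n. c k i) * B (w k) (t j))"
      unfolding d_def using j by (subst B_sum) (auto simp: B_scale)
    also have "\<dots> = (\<Sum>k<m. \<Sum>i<n. B (t j) (w k) * c k i)"
      using j by (intro sum.cong refl) (simp add: B_sym[of "w _" "t j"] sum_distrib_right mult.commute)
    also have "\<dots> = (\<Sum>i<n. \<Sum>k<m. B (t j) (w k) * c k i)" by (rule sum.swap)
    also have "\<dots> = (\<Sum>i<n. if i = j then 1 else 0)" using co by simp
    also have "\<dots> = 1" using j by simp
    finally show ?thesis .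
  qed
  then show ?thesis using dK by blast
qed

section \<open>Generation of the core by simple root vectors\<close>

lemma ef_E [simp]: "i < n \<Longrightarrow> e i \<in> E" "i < n \<Longrightarrow> f i \<in> E"
  using e_rsp f_rsp rsp_E by blast+

lemma ef_nz: assumes "i < n" shows "e i \<noteq> 0" "f i \<noteq> 0"
proof -
  interpret sl2 sc E br B "e i" "f i" "cr (a i)" by (rule ef_sl2[OF assms])
  have "cr (a i) \<noteq> 0"
  proof
    assume "cr (a i) = 0"
    then show False using cr_self[OF a_Rx[OF assms]] dual_linear(4)[OF a_dual[OF assms]] by simp
  qed
  then show "e i \<noteq> 0" "f i \<noteq> 0" using xy assms by auto
qed

lemma G_subalgebra: "lie_subalgebra sc E br G"
  by (rule gen_subalgebra_subalgebra) auto

lemma G_closed: "subspace G" "x \<in> G \<Longrightarrow> y \<in> G \<Longrightarrow> br x y \<in> G"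
  using G_subalgebra by (auto simp: lie_subalgebra_def)

lemma ef_G: "i < n \<Longrightarrow> e i \<in> G" "i < n \<Longrightarrow> f i \<in> G"
  using gen_subalgebra_superset[of "e ` {..<n} \<union> f ` {..<n}"] by blast+

lemma rsp_G: assumes "\<alpha> \<in> Rx" "x \<in> rsp \<alpha>" "x \<noteq> 0" "x \<in> G" shows "rsp \<alpha> \<subseteq> G"
proof
  fix z assume "z \<in> rsp \<alpha>"
  then obtain c where "z = c *s x" using rsp_one_dim[OF assms(1-3)] by blast
  then show "z \<in> G" using assms(4) G_closed(1) subspace_scale by blast
qed

lemma pow_G: "x \<in> G \<Longrightarrow> v \<in> G \<Longrightarrow> (br x ^^ k) v \<in> G"
  by (induction k) (auto intro: G_closed(2))

text \<open>Every real root space is reached from the simple ones by the reflections \<open>s\<^sub>i\<close>, realised on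
  root vectors by powers of \<open>ad e\<^sub>i\<close> and \<open>ad f\<^sub>i\<close>.\<close>
lemma P_G: "\<alpha> \<in> A.P \<Longrightarrow> rsp \<alpha> \<subseteq> G \<and> rsp (- \<alpha>) \<subseteq> G"
proof (induction rule: A.P_induct)
  case (simple s)
  then obtain i where i: "i < n" "s = a i" using simple_a by blast
  show ?case unfolding i(2)
    using rsp_G[OF a_Rx e_rsp ef_nz(1) ef_G(1)] rsp_G[OF Rx_neg[OF a_Rx] f_rsp ef_nz(2) ef_G(2)] i(1) by blast
next
  case (step \<alpha> s k)
  obtain i where i: "i < n" "s = a i" using step(2) simple_a by blast
  define \<beta> where "\<beta> = \<alpha> - rscale (of_nat k) (a i)"
  have ax: "\<alpha> \<in> Rx" using step(1) A.P_Phi by blast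
  have bx: "\<beta> \<in> Rx" using step(5) A.P_Phi unfolding \<beta>_def i(2) by blast
  have IH: "rsp \<beta> \<subseteq> G" "rsp (- \<beta>) \<subseteq> G" using step(6) unfolding \<beta>_def i(2) by blast+
  obtain m :: int where m: "\<alpha> (cr (a i)) = of_int m" "2 * q \<alpha> (a i) = of_int m * q (a i) (a i)"
    using Rx_refl[OF a_Rx[OF i(1)] ax] by blast
  have "of_int m * q (a i) (a i) = of_nat k * q (a i) (a i)" using m(2) step(4) unfolding i(2) by linarith
  hence "of_int m = (of_nat k :: real)" using q_self_pos[OF a_Rx[OF i(1)]] by simp
  hence mk: "m = int k" by linarith
  have bk: "\<beta> (cr (a i)) = - of_nat k"
    using m(1) mk cr_self[OF a_Rx[OF i(1)]] by (simp add: \<beta>_def rscale_def)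
  have eq: "\<beta> + rscale (of_nat k) (a i) = \<alpha>" "- \<beta> + rscale (of_nat k) (- a i) = - \<alpha>"
    by (simp_all add: \<beta>_def rscale_def fun_eq_iff)
  obtain v where v: "v \<in> rsp \<beta>" "v \<noteq> 0" using R_E[OF Rx_R[OF bx]] by blast
  note w = weight_string[OF a_Rx[OF i(1)] e_rsp[OF i(1)] ef_nz(1)[OF i(1)] Rx_dual[OF bx] v bk]
  have 1: "rsp \<alpha> \<subseteq> G"
    using rsp_G[OF ax w(1)[unfolded eq] w(2)] pow_G[OF ef_G(1)[OF i(1)]] v(1) IH(1) by blast
  have "cr (- a i) = - cr (a i)" using a_dual[OF i(1)] by (simp add: cr_def tv_neg df_neg dual_neg)
  moreover have "\<beta> (- cr (a i)) = - \<beta> (cr (a i))"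
    using dual_linear(2)[OF Rx_dual[OF bx] cr_H[OF a_dual[OF i(1)]], of "- 1"] by simp
  ultimately have bk': "(- \<beta>) (cr (- a i)) = - of_nat k" using bk by simp
  obtain v' where v': "v' \<in> rsp (- \<beta>)" "v' \<noteq> 0" using R_E[OF R_neg[OF Rx_R[OF bx]]] by blast
  note w' = weight_string[OF Rx_neg[OF a_Rx[OF i(1)]] f_rsp[OF i(1)] ef_nz(2)[OF i(1)] dual_neg[OF Rx_dual[OF bx]] v' bk']
  have "rsp (- \<alpha>) \<subseteq> G"
    using rsp_G[OF Rx_neg[OF ax] w'(1)[unfolded eq] w'(2)] pow_G[OF ef_G(2)[OF i(1)]] v'(1) IH(2) by blast
  with 1 show ?case by blast
qed

lemma Rx_G: assumes "\<alpha> \<in> Rx" shows "rsp \<alpha> \<subseteq> G"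
  using A.Phi_cases[OF assms]
proof
  assume "- \<alpha> \<in> A.P"
  from P_G[OF this] show ?thesis by (simp only: minus_minus)
qed (use P_G in blast)

lemma core_eq: "core sc E br B H = G"
proof
  show "core sc E br B H \<subseteq> G"
    unfolding core_def using Rx_G by (intro gen_subalgebra_minimal[OF G_subalgebra]) blast
  have X: "(\<Union>\<alpha>\<in>Rx. rsp \<alpha>) \<subseteq> E" by auto
  have "e ` {..<n} \<union> f ` {..<n} \<subseteq> (\<Union>\<alpha>\<in>Rx. rsp \<alpha>)"
    using e_rsp f_rsp a_Rx Rx_neg by blast
  then have "e ` {..<n} \<union> f ` {..<n} \<subseteq> gen_subalgebra sc E br (\<Union>\<alpha>\<in>Rx. rsp \<alpha>)"
    using gen_subalgebra_superset by blast
  then show "G \<subseteq> core sc E br B H" unfolding core_def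
    by (intro gen_subalgebra_minimal gen_subalgebra_subalgebra X)
qed

section \<open>Verification of the Chevalley data\<close>

lemma list_wt_dual: "set is \<subseteq> {..<n} \<Longrightarrow> list_wt a is \<in> dual \<and> tv (list_wt a is) = list_wt t is"
proof (induction "is")
  case Nil
  show ?case using dual_0 tv_0 by (simp only: list_wt_simps)
next
  case (Cons i "is")
  have d: "a i \<in> dual" "list_wt a is \<in> dual" "tv (list_wt a is) = list_wt t is" using Cons a_dual by auto
  show ?case unfolding list_wt_simps tv_add[OF d(1,2)] d(3) t_def[of i] using dual_add[OF d(1,2)] by blast
qed

lemma monom_rsp:
  "set is \<subseteq> {..<n} \<Longrightarrow> monom br e is \<in> rsp (list_wt a is) \<and> monom br f is \<in> rsp (- list_wt a is)"
proof (induction "is" rule: induct_list012)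
  case 1
  show ?case using subspace_0[OF rsp_subspace] by simp
next
  case (2 i)
  have eq: "list_wt a [i] = a i" by (simp only: list_wt_simps add_0_right)
  have i: "i < n" using 2 by simp
  show ?case unfolding eq monom.simps(2) using e_rsp[OF i] f_rsp[OF i] by blast
next
  case (3 i j "is")
  have i: "i < n" using 3 by simp
  have IH: "monom br e (j # is) \<in> rsp (list_wt a (j # is))" "monom br f (j # is) \<in> rsp (- list_wt a (j # is))"
    using 3(2) 3(3) by (meson set_subset_Cons subset_trans)+
  show ?case unfolding monom.simps(3) list_wt_simps(2)[of a i "j # is"] minus_add_distrib[of "a i"]
    using rsp_bracket[OF e_rsp[OF i] IH(1)] rsp_bracket[OF f_rsp[OF i] IH(2)] by blast
qed

text \<open>A partner of x exists in the opposite root space of \<open>E\<close>, and for a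
  nonisotropic weight this whole space lies in the core. This yields \<open>real_e\<close> and
  \<open>real_f\<close>.\<close>

lemma rsp_G_nondegenerate:
  assumes "\<sigma> \<in> dual" "df \<sigma> \<sigma> \<noteq> 0" "x \<in> rsp \<sigma>" "\<And>y. y \<in> G \<Longrightarrow> B x y = 0"
  shows "x = 0"
proof (rule ccontr)
  assume "x \<noteq> 0"
  hence "\<sigma> \<in> Rx" using assms R_I Rx_I by blast
  moreover obtain y where "y \<in> rsp (- \<sigma>)" "B x y \<noteq> 0" using rsp_pairing[OF assms(1,3) \<open>x \<noteq> 0\<close>] by blast
  ultimately show False using Rx_G[OF Rx_neg] assms(4) by blast
qed

text \<open>The bracket has weight a i - a j. This is not a nonisotropic root by
  \<open>simple_diff_notin\<close>, nor an isotropic one, since simple roots congruent modulo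
  \<delta> coincide.\<close>

lemma e_f_zero: assumes "i < n" "j < n" "i \<noteq> j" shows "br (e i) (f j) = 0"
proof (rule ccontr)
  assume nz: "br (e i) (f j) \<noteq> 0"
  have "br (e i) (f j) \<in> rsp (a i + - a j)" using rsp_bracket e_rsp f_rsp assms by blast
  hence "br (e i) (f j) \<in> rsp (a i - a j)" by (simp only: add_uminus_conv_diff)
  hence R: "a i - a j \<in> R" using nz dual_diff[OF a_dual a_dual] assms R_I by blast
  show False
  proof (cases "a i - a j \<in> Rx")
    case True
    then show False using A.simple_diff_notin[OF a_simple a_simple] assms by blast
  next
    case False
    then have "a i - a j \<in> R0" using R by (simp add: roots_0_def)
    then obtain r where "a i - a j = rscale r del" using R0_VV by blast
    hence "a i = a j + rscale r del" by (metis add.commute diff_add_cancel)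
    then show False using A.simple_cong[OF a_simple a_simple] a_inj assms by blast
  qed
qed

lemma chevalley_instance:
  assumes d: "d \<in> K" "\<forall>i<n. B d (t i) = 1"
  shows "chevalley sc E br B K n e f t (\<lambda>i. 2 / df (a i) (a i)) d"
proof (unfold_locales, goal_cases)
  case 1 show ?case by (rule K_subspace)
next
  case 2 show ?case using K_H H_subset by blast
next
  case (3 h h') then show ?case using K_H H_abelian by blast
next
  case (4 h) then show ?case by (rule K_nondegenerate)
next
  case (5 i) then show ?case by simp
next
  case (6 i) then show ?case by simp
next
  case (7 i) then show ?case using t_Hc Hc_K by blast
next
  case (8 h i)
  then have "h \<in> H" using K_H by blast
  then show ?case using rsp_br[OF e_rsp[OF 8(2)]] tv(2)[OF a_dual[OF 8(2)]] by (simp add: t_def)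
next
  case (9 h i)
  then have h: "h \<in> H" using K_H by blast
  have "br h (f i) = (- a i) h *s f i" using rsp_br[OF f_rsp[OF 9(2)] h] .
  then show ?case using tv(2)[OF a_dual[OF 9(2)] h] by (simp add: t_def)
next
  case (10 i j)
  show ?case
  proof (cases "i = j")
    case True
    interpret sl2 sc E br B "e i" "f i" "cr (a i)" by (rule ef_sl2[OF 10(1)])
    show ?thesis using True xy by (simp add: cr_def t_def)
  next
    case False
    then show ?thesis using e_f_zero 10 by simp
  qed
next
  case (11 i) then show ?case using Rx_nz[OF a_Rx] by simp
next
  case 12 show ?case by (rule d(1))
next
  case (13 i) then show ?case using d(2) by blast
next
  case (14 "is" js)
  have "(\<Sum>i<n. (of_nat (count_list is i) - of_nat (count_list js i)) *s t i) = 0"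
    using 14(3) unfolding list_wt_count[OF 14(1) vector_space_axioms] list_wt_count[OF 14(2) vector_space_axioms]
    by (simp add: scale_left_diff_distrib sum_subtractf)
  hence c: "count_list is i = count_list js i" if "i < n" for i using t_independent that by fastforce
  have "count_list is i = count_list js i" for i
  proof (cases "i < n")
    case False
    then have "i \<notin> set is" "i \<notin> set js" using 14 by auto
    then show ?thesis by (simp add: count_list_0_iff)
  qed (rule c)
  then show ?case by (intro multiset_eqI) (simp add: count_mset)
next
  case (15 "is" x)
  note d = list_wt_dual[OF 15(1)]
  have "monom br e js \<in> rsp (list_wt a is)" if "mset js = mset is" for js
    using monom_rsp[of js] list_wt_mset[OF that, of a] mset_eq_setD[OF that] 15(1) by auto
  hence "span {monom br e js |js. mset js = mset is} \<subseteq> rsp (list_wt a is)"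
    by (intro span_minimal rsp_subspace) blast
  hence "x \<in> rsp (list_wt a is)" using 15(3) by blast
  moreover have "df (list_wt a is) (list_wt a is) \<noteq> 0" using 15(2) d by (simp add: dform_def)
  ultimately show ?case using rsp_G_nondegenerate[of "list_wt a is" x] d 15(4) by blast
next
  case (16 "is" x)
  note d = list_wt_dual[OF 16(1)]
  have "monom br f js \<in> rsp (- list_wt a is)" if "mset js = mset is" for js
    using monom_rsp[of js] list_wt_mset[OF that, of a] mset_eq_setD[OF that] 16(1) by auto
  hence "span {monom br f js |js. mset js = mset is} \<subseteq> rsp (- list_wt a is)"
    by (intro span_minimal rsp_subspace) blast
  hence "x \<in> rsp (- list_wt a is)" using 16(3) by blast
  moreover have "df (- list_wt a is) (- list_wt a is) \<noteq> 0"
  proof -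
    have "df (- list_wt a is) (- list_wt a is) = df (list_wt a is) (list_wt a is)"
      using d dual_neg by (simp add: df_neg)
    then show ?thesis using 16(2) d by (simp add: dform_def)
  qed
  ultimately show ?case using rsp_G_nondegenerate[of "- list_wt a is" x] dual_neg d 16(4) by blast
next
  case (17 "is")
  \<comment> \<open>This is 2 (\<rho>, \<sigma>), and it equals \<open>kap\<close> times a nonempty
    sum of positive reals.\<close>
  have "list_wt (\<lambda>i. B (t i) (t i)) is = kap * of_real (list_wt (\<lambda>i. q (a i) (a i)) is)"
    using 17(1)
  proof (induction "is")
    case (Cons i "is")
    have "B (t i) (t i) = kap * of_real (q (a i) (a i))"
      using df_q[OF a_Rx Rx_R[OF a_Rx], of i i] Cons.prems by (simp add: dform_def t_def)
    then show ?case using Cons by (simp add: distrib_left)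
  qed simp
  moreover have "list_wt (\<lambda>i. q (a i) (a i)) is > 0" using 17(1,2)
  proof (induction "is")
    case (Cons i "is")
    then show ?case using q_self_pos[OF a_Rx, of i] by (cases "is = []") (auto intro: add_pos_pos)
  qed simp
  ultimately show ?case using kap(1) by simp
qed

lemma affine_lie_algebra_K: "affine_lie_algebra sc (set_sum K (core sc E br B H)) br B K"
proof -
  obtain d where d: "d \<in> K" "\<forall>i<n. B d (t i) = 1" using height_vector by blast
  interpret c: chevalley sc E br B K n e f t "\<lambda>i. 2 / df (a i) (a i)" d
    by (rule chevalley_instance[OF d])
  define L where "L = set_sum K (core sc E br B H)"
  have L: "L = c.total" unfolding L_def core_eq c.total_eq ..
  have Lsub: "lie_subalgebra sc E br L" unfolding L by (rule c.total_subalgebra)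
  have LE: "L \<subseteq> E" using Lsub by (simp add: lie_subalgebra_def)
  have Lss: "subspace L" using Lsub by (simp add: lie_subalgebra_def)
  have KL: "K \<subseteq> L" unfolding L c.total_def using c.gr_zero by (blast intro: span_base)
  have GL: "G \<subseteq> L" unfolding L by (rule c.G_total)
  have good: "good_form sc L br B" unfolding good_form_def
  proof (intro conjI ballI allI impI)
    fix x assume "x \<in> L" "\<forall>y\<in>L. B x y = 0"
    then show "x = 0" unfolding L using c.total_nondegenerate by blast
  qed (use LE in \<open>auto simp: B_add B_scale B_invariant subset_iff intro: B_sym\<close>)
  have KLs: "lie_subalgebra sc L br K" unfolding lie_subalgebra_def
    using K_subspace KL c.K_abelian c.K_closed(1) by auto
  have "\<forall>i j. \<exists>k::int. i < n \<longrightarrow> j < n \<longrightarrow> a j (cr (a i)) = of_int k \<and> 2 * q (a j) (a i) = of_int k * q (a i) (a i)"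
    using Rx_refl[OF a_Rx a_Rx] by blast
  then obtain A :: "nat \<Rightarrow> nat \<Rightarrow> int" where A: "\<And>i j. i < n \<Longrightarrow> j < n \<Longrightarrow> a j (cr (a i)) = of_int (A i j)"
      "\<And>i j. i < n \<Longrightarrow> j < n \<Longrightarrow> 2 * q (a j) (a i) = of_int (A i j) * q (a i) (a i)"
    by metis
  \<comment> \<open>The roots a i live on \<open>H\<close>; as elements of the dual of
    \<open>K\<close> they have to vanish outside \<open>K\<close>.\<close>
  define al where "al i x = (if x \<in> K then a i x else 0)" for i x
  define hv where "hv i = cr (a i)" for i
  have hv: "hv i = (2 / df (a i) (a i)) *s t i" for i by (simp add: hv_def cr_def t_def)
  have hvK: "hv i \<in> K" if "i < n" for i unfolding hv using c.K_closed(3) c.t_K that by blast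
  have hvfam: "\<forall>i\<in>{..<n}. b i = 0" if "(\<Sum>i<n. b i *s hv i) = 0" for b
  proof
    fix i assume "i \<in> {..<n}"
    hence i: "i < n" by simp
    have "(\<Sum>i<n. (b i * (2 / df (a i) (a i))) *s t i) = 0" using that by (simp add: hv)
    from t_independent[OF this i] show "b i = 0" using Rx_nz[OF a_Rx[OF i]] by simp
  qed
  have aK: "al i h = B h (t i)" if "i < n" "h \<in> K" for i h
  proof -
    have "h \<in> H" using that(2) K_H by blast
    then show ?thesis using tv(2)[OF a_dual[OF that(1)]] that(2) by (simp add: al_def t_def)
  qed
  have alind: "b i = 0" if b: "\<forall>h\<in>K. (\<Sum>i<n. b i * al i h) = 0" and i: "i < n" for b i
  proof -
    have xK: "(\<Sum>i<n. b i *s t i) \<in> K"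
      using c.t_K by (intro subspace_sum subspace_scale K_subspace) auto
    have "(\<Sum>i<n. b i *s t i) = 0"
    proof (rule K_nondegenerate[OF xK])
      fix h assume h: "h \<in> K"
      hence hE: "h \<in> E" by simp
      have "B (\<Sum>i<n. b i *s t i) h = (\<Sum>i<n. b i * B (t i) h)"
        using hE by (subst B_sum) (auto simp: B_scale)
      also have "\<dots> = (\<Sum>i<n. b i * al i h)"
        using aK h hE by (intro sum.cong refl) (simp add: B_sym[of "t _" h])
      finally show "B (\<Sum>i<n. b i *s t i) h = 0" using b h by simp
    qed
    then show ?thesis using t_independent i by blast
  qed
  have Lgen: "L = gen_subalgebra sc L br (K \<union> e ` {..<n} \<union> f ` {..<n})"
  proof
    show "L \<subseteq> gen_subalgebra sc L br (K \<union> e ` {..<n} \<union> f ` {..<n})"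
    proof
      fix x assume x: "x \<in> L"
      show "x \<in> gen_subalgebra sc L br (K \<union> e ` {..<n} \<union> f ` {..<n})"
        unfolding gen_subalgebra_def
      proof (rule InterI)
        fix S assume "S \<in> {S. lie_subalgebra sc L br S \<and> K \<union> e ` {..<n} \<union> f ` {..<n} \<subseteq> S}"
        hence S: "lie_subalgebra sc L br S" "K \<subseteq> S" "e ` {..<n} \<union> f ` {..<n} \<subseteq> S" by auto
        \<comment> \<open>Generation is meant inside \<open>L\<close>, whereas \<open>G\<close> was
          generated inside \<open>E\<close>; a subalgebra of \<open>L\<close> is also one of
          \<open>E\<close>, so it contains \<open>G\<close>.\<close>
        have SE: "lie_subalgebra sc E br S" using S(1) LE by (auto simp: lie_subalgebra_def)
        have "G \<subseteq> S" by (rule gen_subalgebra_minimal[OF SE S(3)])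
        moreover have "subspace S" using S(1) by (simp add: lie_subalgebra_def)
        moreover obtain y z where "x = y + z" "y \<in> K" "z \<in> G"
          using x unfolding L_def core_eq set_sum_def by blast
        ultimately show "x \<in> S" using S(2) by (auto intro: subspace_add)
      qed
    qed
    have "lie_subalgebra sc L br L" using Lsub by (simp add: lie_subalgebra_def)
    moreover have "K \<union> e ` {..<n} \<union> f ` {..<n} \<subseteq> L" using KL GL ef_G by blast
    ultimately show "gen_subalgebra sc L br (K \<union> e ` {..<n} \<union> f ` {..<n}) \<subseteq> L"
      by (auto simp: gen_subalgebra_def)
  qed
  have "affine_lie_algebra sc L br B K"
    unfolding affine_lie_algebra_def
  proof (rule conjI[OF subalgebra_lie_algebra[OF Lsub] conjI[OF good conjI[OF KLs]]],
      rule exI[of _ n], rule exI[of _ A], rule exI[of _ al], rule exI[of _ hv], rule exI[of _ e],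
      rule exI[of _ f], intro conjI)
    show "affine_gcm n A" using A.affine_gcm_simple[OF a_bij A(2)] .
    show "fin_dim sc K" "dim K = n + 1" by (rule K_dim)+
    show "\<forall>i<n. al i \<in> dual_space sc K \<and> hv i \<in> K"
    proof (intro allI impI conjI)
      fix i assume i: "i < n"
      show "hv i \<in> K" by (rule hvK[OF i])
      have "al i (x + y) = al i x + al i y" if x: "x \<in> K" and y: "y \<in> K" for x y
      proof -
        have "x \<in> H" "y \<in> H" using x y K_H by blast+
        then show ?thesis using x y c.K_closed(2)[OF x y] dual_linear(1)[OF a_dual[OF i]] by (simp add: al_def)
      qed
      moreover have "al i (b *s x) = b * al i x" if x: "x \<in> K" for b x
      proof -
        have "x \<in> H" using x K_H by blast
        then show ?thesis using x c.K_closed(3)[OF x] dual_linear(2)[OF a_dual[OF i]] by (simp add: al_def)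
      qed
      moreover have "al i x = 0" if "x \<notin> K" for x using that by (simp add: al_def)
      ultimately show "al i \<in> dual_space sc K" unfolding dual_space_def by blast
    qed
    show "\<forall>c. (\<forall>h\<in>K. (\<Sum>i<n. c i * al i h) = 0) \<longrightarrow> (\<forall>i<n. c i = 0)" using alind by blast
    show "inj_on hv {..<n}" "independent (hv ` {..<n})"
      by (rule independent_family[OF finite_lessThan hvfam]; assumption)+
    show "\<forall>i<n. \<forall>j<n. al j (hv i) = of_int (A i j)" using hvK A(1) by (simp add: al_def hv_def)
    show "\<forall>i<n. e i \<in> L \<and> f i \<in> L" using ef_G GL by blast
    show "\<forall>h\<in>K. \<forall>h'\<in>K. br h h' = 0" using c.K_abelian by blast
    show "\<forall>i<n. \<forall>j<n. br (e i) (f j) = (if i = j then hv i else 0)" using c.e_f by (simp add: hv)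
    show "\<forall>i<n. \<forall>h\<in>K. br h (e i) = al i h *s e i \<and> br h (f i) = (- al i h) *s f i"
      using c.K_e c.K_f aK by simp
    show "L = gen_subalgebra sc L br (K \<union> e ` {..<n} \<union> f ` {..<n})" by (rule Lgen)
    show "\<forall>I. lie_ideal sc L br I \<and> I \<inter> K = {0} \<longrightarrow> I = {0}" unfolding L using c.no_ideal by blast
  qed
  then show ?thesis by (simp only: L_def)
qed

end

theorem theorem5p8:
  fixes sc :: "complex \<Rightarrow> 'a::ab_group_add \<Rightarrow> 'a"
    and E :: "'a set" and br :: "'a \<Rightarrow> 'a \<Rightarrow> 'a" and B :: "'a \<Rightarrow> 'a \<Rightarrow> complex"
    and H :: "'a set" and Rd :: "('a \<Rightarrow> complex) set" and Hhat0 :: "'a set"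
  assumes "eala sc E br B H"
    and "nullity sc E br B H = 1"
    and "reduced_quotient sc E br B H"
    and "Rdot_ok sc E br B H Rd"
    and "Hhat0_ok sc E br B H Rd Hhat0"
  shows "affine_lie_algebra sc
           (set_sum (set_sum (H_c sc E br B H) Hhat0) (core sc E br B H)) br B
           (set_sum (H_c sc E br B H) Hhat0)"
proof -
  have lie: "lie_algebra sc E br" and form: "good_form sc E br B" using assms(1) by (auto simp: eala_def)
  interpret eala_null1 sc E br B H Rd Hhat0
  proof (intro eala_null1.intro eala_form.intro lie_form.intro lie_form_axioms.intro
      eala_form_axioms.intro eala_null1_axioms.intro)
    show "vector_space sc" using lie by (simp add: lie_algebra_def)
  qed (use assms lie form in auto)
  obtain h0 where h0: "affine_roots rscale q (\<lambda>\<phi>. Re (\<phi> h0)) Rx del" using affine_roots_Rx by blast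
  interpret A: affine_roots rscale q "\<lambda>\<phi>. Re (\<phi> h0)" Rx del by (rule h0)
  define n where "n = card A.simple"
  obtain a where a: "bij_betw a {..<n} A.simple"
    using ex_bij_betw_nat_finite[OF A.finite_simple] by (auto simp: n_def atLeast0LessThan)
  have aRx: "a i \<in> Rx" if "i < n" for i using a that A.simple_Phi by (auto simp: bij_betw_def)
  have "\<exists>x y. x \<in> rsp (a i) \<and> y \<in> rsp (- a i) \<and> sl2 sc E br B x y (cr (a i))" if "i < n" for i
    using R_E[OF Rx_R[OF aRx[OF that]]] sl2_triple[OF aRx[OF that]] by metis
  then obtain e f where ef: "\<And>i. i < n \<Longrightarrow> e i \<in> rsp (a i) \<and> f i \<in> rsp (- a i) \<and> sl2 sc E br B (e i) (f i) (cr (a i))"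
    by metis
  interpret b: eala_based sc E br B H Rd Hhat0 h0 n a e f
    by (intro eala_based.intro eala_null1_axioms eala_based_axioms.intro) (use h0 a ef in auto)
  show ?thesis using b.affine_lie_algebra_K unfolding b.K_def .
qed

end
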